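(* Let $n\geqslant3$, let $S\subset\mathbb P^{n+1}$ be a smooth cubic hypersurface (over $\mathbb C$, of dimension $n$), let $H_0\subset\mathbb P^{n+1}$ be a hyperplane, and put $B=S\cap H_0$, which need not be smooth. Then $S\setminus B$ admits a finite global dominating family of holomorphic sprays on trivial line bundles. In particular, $S\setminus B$ is holomorphically elliptic.
   Context: A holomorphic spray on a complex manifold $M$ is a triple $(E,p,s)$, where $p:E\to M$ is a holomorphic vector bundle and $s:E\to M$ is a holomorphic map, defined on all of $E$, with $s(0_x)=x$ for all $x\in M$. A finite family of sprays $(E_j,p_j,s_j)$ is dominating if $T_xM=\sum_j (ds_j)_{0_x}(E_{j,x})$ for all $x\in M$ (identifying the vertical tangent space of $E_j$ at $0_x$ with $E_{j,x}$). $M$ is holomorphically elliptic if it admits a single dominating holomorphic spray. *)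

theory Defs
  imports "HOL-Analysis.Analysis"
begin

section \<open>Coordinate spaces and holomorphic maps between their open subsets\<close>

text \<open>The space of \<open>k\<close>-tuples of complex numbers is the set of sequences vanishing from index \<open>k\<close>
  on (compare \<open>Euclidean_space\<close> in the library), so that \<open>k\<close> can be an ordinary natural number and
  \<open>cspace d\<close> is the standard linear subspace of \<open>cspace k\<close> for \<open>d \<le> k\<close>. The product topology of
  \<open>nat \<Rightarrow> complex\<close> induces the usual topology on it.\<close>

definition cspace :: "nat \<Rightarrow> (nat \<Rightarrow> complex) set" where
  "cspace k = {z. \<forall>i\<ge>k. z i = 0}"

abbreviation cspace_top :: "nat \<Rightarrow> (nat \<Rightarrow> complex) topology" where
  "cspace_top k \<equiv> top_of_set (cspace k)"

text \<open>Complex Frechet differentiability at every point of \<open>U\<close>, for \<open>U\<close> open in \<open>cspace k\<close>.\<close>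

definition holomorphic_fun :: "nat \<Rightarrow> (nat \<Rightarrow> complex) set \<Rightarrow> ((nat \<Rightarrow> complex) \<Rightarrow> complex) \<Rightarrow> bool" where
  "holomorphic_fun k U f \<longleftrightarrow>
     (\<forall>z\<in>U. \<exists>a :: nat \<Rightarrow> complex.
        ((\<lambda>w. (f w - f z - (\<Sum>i<k. a i * (w i - z i)))
              / complex_of_real (L2_set (\<lambda>i. cmod (w i - z i)) {..<k})) \<longlongrightarrow> 0) (at z within U))"

definition holomorphic_between ::
  "nat \<Rightarrow> nat \<Rightarrow> (nat \<Rightarrow> complex) set \<Rightarrow> ((nat \<Rightarrow> complex) \<Rightarrow> nat \<Rightarrow> complex) \<Rightarrow> bool" where
  "holomorphic_between k l U f \<longleftrightarrow>
     openin (cspace_top k) U \<and> f ` U \<subseteq> cspace l \<and> (\<forall>j<l. holomorphic_fun k U (\<lambda>z. f z j))"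


section \<open>Complex manifolds\<close>

type_synonym 'a chart = "'a set \<times> ('a \<Rightarrow> nat \<Rightarrow> complex)"

record 'a cmanifold =
  mtop :: "'a topology"
  cdim :: nat
  atlas :: "'a chart set"

abbreviation points :: "'a cmanifold \<Rightarrow> 'a set" where
  "points M \<equiv> topspace (mtop M)"

definition is_chart :: "'a topology \<Rightarrow> nat \<Rightarrow> 'a chart \<Rightarrow> bool" where
  "is_chart X k = (\<lambda>(U, \<phi>). openin X U \<and> openin (cspace_top k) (\<phi> ` U) \<and>
     homeomorphic_map (subtopology X U) (top_of_set (\<phi> ` U)) \<phi>)"

definition compatible_charts :: "nat \<Rightarrow> 'a chart \<Rightarrow> 'a chart \<Rightarrow> bool" where
  "compatible_charts k = (\<lambda>(U, \<phi>) (V, \<psi>).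
     holomorphic_between k k (\<phi> ` (U \<inter> V)) (\<psi> \<circ> inv_into U \<phi>) \<and>
     holomorphic_between k k (\<psi> ` (U \<inter> V)) (\<phi> \<circ> inv_into V \<psi>))"

definition complex_manifold :: "'a cmanifold \<Rightarrow> bool" where
  "complex_manifold M \<longleftrightarrow>
     Hausdorff_space (mtop M) \<and> second_countable (mtop M) \<and>
     (\<forall>c\<in>atlas M. is_chart (mtop M) (cdim M) c) \<and>
     (\<Union>c\<in>atlas M. fst c) = points M \<and>
     (\<forall>c\<in>atlas M. \<forall>c'\<in>atlas M. compatible_charts (cdim M) c c')"

definition maximal_atlas :: "'a cmanifold \<Rightarrow> 'a chart set" where
  "maximal_atlas M =
     {c. is_chart (mtop M) (cdim M) c \<and> (\<forall>c'\<in>atlas M. compatible_charts (cdim M) c c')}"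

definition holomorphic_map :: "'a cmanifold \<Rightarrow> 'b cmanifold \<Rightarrow> ('a \<Rightarrow> 'b) \<Rightarrow> bool" where
  "holomorphic_map M N f \<longleftrightarrow> continuous_map (mtop M) (mtop N) f \<and>
     (\<forall>(U, \<phi>)\<in>atlas M. \<forall>(V, \<psi>)\<in>atlas N.
        holomorphic_between (cdim M) (cdim N) (\<phi> ` {x\<in>U. f x \<in> V}) (\<psi> \<circ> f \<circ> inv_into U \<phi>))"

definition biholomorphic_map :: "'a cmanifold \<Rightarrow> 'b cmanifold \<Rightarrow> ('a \<Rightarrow> 'b) \<Rightarrow> bool" where
  "biholomorphic_map M N f \<longleftrightarrow> bij_betw f (points M) (points N) \<and>
     holomorphic_map M N f \<and> holomorphic_map N M (inv_into (points M) f)"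

definition open_submanifold :: "'a cmanifold \<Rightarrow> 'a set \<Rightarrow> 'a cmanifold" where
  "open_submanifold M W =
     \<lparr>mtop = subtopology (mtop M) W, cdim = cdim M, atlas = {(U \<inter> W, \<phi>) |U \<phi>. (U, \<phi>) \<in> atlas M}\<rparr>"

text \<open>The structure induced on a (locally closed) \<open>d\<close>-dimensional submanifold \<open>Y\<close> of \<open>M\<close>: its charts
  are the restrictions to \<open>Y\<close> of the charts of \<open>M\<close> in which \<open>Y\<close> becomes the linear subspace
  \<open>cspace d\<close>.\<close>

definition submanifold :: "'a cmanifold \<Rightarrow> nat \<Rightarrow> 'a set \<Rightarrow> 'a cmanifold" where
  "submanifold M d Y =
     \<lparr>mtop = subtopology (mtop M) Y, cdim = d,
      atlas = {(U \<inter> Y, \<phi>) |U \<phi>. (U, \<phi>) \<in> maximal_atlas M \<and> \<phi> ` (U \<inter> Y) = \<phi> ` U \<inter> cspace d}\<rparr>"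

text \<open>The product of \<open>M\<close> with \<open>cspace r\<close>; in charts the two coordinate tuples are concatenated.\<close>

definition times_cspace :: "'a cmanifold \<Rightarrow> nat \<Rightarrow> ('a \<times> (nat \<Rightarrow> complex)) cmanifold" where
  "times_cspace M r =
     \<lparr>mtop = prod_topology (mtop M) (cspace_top r), cdim = cdim M + r,
      atlas = {(U \<times> cspace r, \<lambda>(x, v) i. if i < cdim M then \<phi> x i else v (i - cdim M)) |U \<phi>.
                 (U, \<phi>) \<in> atlas M}\<rparr>"


section \<open>Holomorphic vector bundles\<close>

record ('a, 'e) vbundle =
  total :: "'e cmanifold"
  proj :: "'e \<Rightarrow> 'a"
  vrank :: nat
  vadd :: "'e \<Rightarrow> 'e \<Rightarrow> 'e"
  vscale :: "complex \<Rightarrow> 'e \<Rightarrow> 'e"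
  vzero :: "'a \<Rightarrow> 'e"

definition fibre :: "('a, 'e) vbundle \<Rightarrow> 'a \<Rightarrow> 'e set" where
  "fibre E x = {e \<in> points (total E). proj E e = x}"

text \<open>A local trivialization over \<open>U\<close>. It is a bijection of each fibre over \<open>U\<close> with
  \<open>cspace (vrank E)\<close> that respects the linear operations, so the vector space axioms hold in the
  fibres.\<close>

definition local_trivialization ::
  "'a cmanifold \<Rightarrow> ('a, 'e) vbundle \<Rightarrow> 'a set \<Rightarrow> ('e \<Rightarrow> 'a \<times> (nat \<Rightarrow> complex)) \<Rightarrow> bool" where
  "local_trivialization M E U \<theta> \<longleftrightarrow>
     openin (mtop M) U \<and>
     biholomorphic_map (open_submanifold (total E) {e \<in> points (total E). proj E e \<in> U})
       (times_cspace (open_submanifold M U) (vrank E)) \<theta> \<and>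
     (\<forall>x\<in>U. \<forall>e\<in>fibre E x. fst (\<theta> e) = x) \<and>
     (\<forall>x\<in>U. \<forall>e\<in>fibre E x. \<forall>e'\<in>fibre E x.
        snd (\<theta> (vadd E e e')) = (\<lambda>i. snd (\<theta> e) i + snd (\<theta> e') i)) \<and>
     (\<forall>x\<in>U. \<forall>e\<in>fibre E x. \<forall>t. snd (\<theta> (vscale E t e)) = (\<lambda>i. t * snd (\<theta> e) i)) \<and>
     (\<forall>x\<in>U. snd (\<theta> (vzero E x)) = (\<lambda>i. 0))"

definition holomorphic_vector_bundle :: "'a cmanifold \<Rightarrow> ('a, 'e) vbundle \<Rightarrow> bool" where
  "holomorphic_vector_bundle M E \<longleftrightarrow>
     complex_manifold M \<and> complex_manifold (total E) \<and> holomorphic_map (total E) M (proj E) \<and>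
     (\<forall>x\<in>points M. vzero E x \<in> fibre E x \<and>
        (\<forall>e\<in>fibre E x. \<forall>e'\<in>fibre E x. vadd E e e' \<in> fibre E x) \<and>
        (\<forall>e\<in>fibre E x. \<forall>t. vscale E t e \<in> fibre E x)) \<and>
     (\<forall>x\<in>points M. \<exists>U \<theta>. x \<in> U \<and> local_trivialization M E U \<theta>)"

definition trivial_bundle :: "'a cmanifold \<Rightarrow> nat \<Rightarrow> ('a, 'a \<times> (nat \<Rightarrow> complex)) vbundle" where
  "trivial_bundle M r =
     \<lparr>total = times_cspace M r, proj = fst, vrank = r,
      vadd = (\<lambda>(x, v) (y, w). (x, \<lambda>i. v i + w i)),
      vscale = (\<lambda>t (x, v). (x, \<lambda>i. t * v i)),
      vzero = (\<lambda>x. (x, \<lambda>i. 0))\<rparr>"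

abbreviation trivial_line_bundle :: "'a cmanifold \<Rightarrow> ('a, 'a \<times> (nat \<Rightarrow> complex)) vbundle" where
  "trivial_line_bundle M \<equiv> trivial_bundle M 1"


section \<open>Sprays and ellipticity\<close>

definition holomorphic_spray :: "'a cmanifold \<Rightarrow> ('a, 'e) vbundle \<Rightarrow> ('e \<Rightarrow> 'a) \<Rightarrow> bool" where
  "holomorphic_spray M E s \<longleftrightarrow>
     holomorphic_vector_bundle M E \<and> holomorphic_map (total E) M s \<and>
     (\<forall>x\<in>points M. s (vzero E x) = x)"

text \<open>A chart \<open>\<psi>\<close> around \<open>x\<close> identifies the tangent space at \<open>x\<close> with \<open>cspace (cdim M)\<close>. The vertical
  tangent vector at \<open>0\<^sub>x\<close> given by \<open>e\<close> in the fibre is the velocity at \<open>t = 0\<close> of the curve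
  \<open>t \<mapsto> t e\<close>; hence its image under \<open>ds\<close> is the velocity of \<open>t \<mapsto> s (t e)\<close>.\<close>

definition vertical_image ::
  "('a, 'e) vbundle \<Rightarrow> ('e \<Rightarrow> 'a) \<Rightarrow> ('a \<Rightarrow> nat \<Rightarrow> complex) \<Rightarrow> 'a \<Rightarrow> (nat \<Rightarrow> complex) set" where
  "vertical_image E s \<psi> x =
     (\<lambda>e i. deriv (\<lambda>t. \<psi> (s (vscale E t e)) i) 0) ` fibre E x"

definition dominating_spray_family ::
  "'a cmanifold \<Rightarrow> 'j set \<Rightarrow> ('j \<Rightarrow> ('a, 'e) vbundle) \<Rightarrow> ('j \<Rightarrow> 'e \<Rightarrow> 'a) \<Rightarrow> bool" where
  "dominating_spray_family M J E s \<longleftrightarrow>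
     complex_manifold M \<and> finite J \<and> (\<forall>j\<in>J. holomorphic_spray M (E j) (s j)) \<and>
     (\<forall>x\<in>points M. \<forall>(U, \<psi>)\<in>atlas M. x \<in> U \<longrightarrow>
        {\<lambda>i. \<Sum>j\<in>J. w j i |w. \<forall>j\<in>J. w j \<in> vertical_image (E j) (s j) \<psi> x} = cspace (cdim M))"

definition dominating_spray :: "'a cmanifold \<Rightarrow> ('a, 'e) vbundle \<Rightarrow> ('e \<Rightarrow> 'a) \<Rightarrow> bool" where
  "dominating_spray M E s \<longleftrightarrow> dominating_spray_family M {()} (\<lambda>_. E) (\<lambda>_. s)"

text \<open>The bundle in the definition of ellipticity ranges over all holomorphic vector bundles with
  arbitrary rank and manifold structure whose total space has points of type
  \<open>'a \<times> (nat \<Rightarrow> complex)\<close>. This is no restriction: choosing a linear isomorphism of each fibre with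
  \<open>cspace r\<close> carries any bundle of rank \<open>r\<close> to one of these.\<close>

definition holomorphically_elliptic :: "'a cmanifold \<Rightarrow> bool" where
  "holomorphically_elliptic M \<longleftrightarrow>
     (\<exists>(E :: ('a, 'a \<times> (nat \<Rightarrow> complex)) vbundle) s. dominating_spray M E s)"


section \<open>Projective space and hypersurfaces\<close>

text \<open>A point of projective space is a punctured line through the origin.\<close>

type_synonym ppoint = "(nat \<Rightarrow> complex) set"

definition punctured_cspace :: "nat \<Rightarrow> (nat \<Rightarrow> complex) set" where
  "punctured_cspace k = cspace k - {\<lambda>i. 0}"

definition ppt :: "(nat \<Rightarrow> complex) \<Rightarrow> ppoint" where
  "ppt z = {(\<lambda>i. t * z i) |t. t \<noteq> 0}"

definition proj_points :: "nat \<Rightarrow> ppoint set" where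
  "proj_points m = ppt ` punctured_cspace (m + 1)"

definition proj_top :: "nat \<Rightarrow> ppoint topology" where
  "proj_top m = topology (\<lambda>V. V \<subseteq> proj_points m \<and>
     openin (top_of_set (punctured_cspace (m + 1))) {z \<in> punctured_cspace (m + 1). ppt z \<in> V})"

text \<open>The affine chart where the \<open>i\<close>-th homogeneous coordinate is nonzero: normalize it to \<open>1\<close>, then
  drop it.\<close>

definition affine_chart :: "nat \<Rightarrow> nat \<Rightarrow> ppoint chart" where
  "affine_chart m i =
     (ppt ` {z \<in> punctured_cspace (m + 1). z i \<noteq> 0},
      \<lambda>p. let z = (THE z. z \<in> p \<and> z i = 1) in (\<lambda>j. z (if j < i then j else Suc j)))"

definition proj_space :: "nat \<Rightarrow> ppoint cmanifold" where
  "proj_space m = \<lparr>mtop = proj_top m, cdim = m, atlas = affine_chart m ` {..m}\<rparr>"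

text \<open>The homogeneous polynomial of degree \<open>d\<close> in \<open>k\<close> variables with coefficients \<open>c\<close>.\<close>

definition multi_indices :: "nat \<Rightarrow> nat \<Rightarrow> (nat \<Rightarrow> nat) set" where
  "multi_indices k d = {\<alpha>. (\<forall>i\<ge>k. \<alpha> i = 0) \<and> (\<Sum>i<k. \<alpha> i) = d}"

definition form :: "nat \<Rightarrow> nat \<Rightarrow> ((nat \<Rightarrow> nat) \<Rightarrow> complex) \<Rightarrow> (nat \<Rightarrow> complex) \<Rightarrow> complex" where
  "form k d c z = (\<Sum>\<alpha>\<in>multi_indices k d. c \<alpha> * (\<Prod>i<k. z i ^ \<alpha> i))"

definition partial_deriv :: "nat \<Rightarrow> ((nat \<Rightarrow> complex) \<Rightarrow> complex) \<Rightarrow> (nat \<Rightarrow> complex) \<Rightarrow> complex" where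
  "partial_deriv i f z = deriv (\<lambda>t. f (z(i := t))) (z i)"

text \<open>Smoothness is the Jacobian criterion for the defining form. It also excludes the zero form.\<close>

definition smooth_hypersurface :: "nat \<Rightarrow> nat \<Rightarrow> ppoint set \<Rightarrow> bool" where
  "smooth_hypersurface m d S \<longleftrightarrow>
     (\<exists>c. S = ppt ` {z \<in> punctured_cspace (m + 1). form (m + 1) d c z = 0} \<and>
        (\<forall>z\<in>punctured_cspace (m + 1). form (m + 1) d c z = 0 \<longrightarrow>
           (\<exists>i\<le>m. partial_deriv i (form (m + 1) d c) z \<noteq> 0)))"

definition hyperplane :: "nat \<Rightarrow> ppoint set \<Rightarrow> bool" where
  "hyperplane m H \<longleftrightarrow>
     (\<exists>a\<in>punctured_cspace (m + 1).
        H = ppt ` {z \<in> punctured_cspace (m + 1). (\<Sum>i\<le>m. a i * z i) = 0})"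

lemma openin_proj_top:
  "openin (proj_top m) V \<longleftrightarrow> V \<subseteq> proj_points m \<and>
     openin (top_of_set (punctured_cspace (m + 1))) {z \<in> punctured_cspace (m + 1). ppt z \<in> V}"
proof -
  let ?C = "punctured_cspace (m + 1)"
  let ?P = "\<lambda>V. V \<subseteq> proj_points m \<and> openin (top_of_set ?C) {z \<in> ?C. ppt z \<in> V}"
  have "istopology ?P"
    unfolding istopology_def
  proof (intro conjI allI impI)
    fix V W assume V: "?P V" and W: "?P W"
    show "V \<inter> W \<subseteq> proj_points m" using V by blast
    have "{z \<in> ?C. ppt z \<in> V \<inter> W} = {z \<in> ?C. ppt z \<in> V} \<inter> {z \<in> ?C. ppt z \<in> W}" by blast
    then show "openin (top_of_set ?C) {z \<in> ?C. ppt z \<in> V \<inter> W}"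
      using V W by (simp only: openin_Int)
  next
    fix \<K> assume K: "\<forall>K\<in>\<K>. ?P K"
    show "\<Union>\<K> \<subseteq> proj_points m" using K by blast
    have "{z \<in> ?C. ppt z \<in> \<Union>\<K>} = \<Union>((\<lambda>K. {z \<in> ?C. ppt z \<in> K}) ` \<K>)" by blast
    moreover have "openin (top_of_set ?C) (\<Union>((\<lambda>K. {z \<in> ?C. ppt z \<in> K}) ` \<K>))"
      using K by (intro openin_Union) blast
    ultimately show "openin (top_of_set ?C) {z \<in> ?C. ppt z \<in> \<Union>\<K>}" by simp
  qed
  then show ?thesis by (simp add: proj_top_def)
qed

end

theory Submission
  imports Defs "HOL-Library.Function_Algebras" "HOL-Computational_Algebra.Fundamental_Theorem_Algebra"
begin

text \<open>Write the complement of the hyperplane section as the affine cubic \<open>X = {F = 0, dot = 1}\<close> and let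
  \<open>T\<close> be the polarization of \<open>F\<close>. A line \<open>\<langle>u, v\<rangle>\<close> on the cubic and a point \<open>x\<close> of \<open>X\<close> span a plane
  which meets the cubic in the line and a residual conic through \<open>x\<close>. The Hamiltonian flow of the
  equation of this conic is linear, hence exists for all times, and stays in \<open>X\<close>; with its time as fibre
  coordinate it is a spray on the trivial line bundle. It need not be the flow of a vector field on \<open>X\<close>.

  The velocity of this spray at \<open>x\<close> is \<open>T x x u v - T x x v u\<close> modulo \<open>x\<close>. So these sprays fail to
  dominate at \<open>x\<close> only if all lines on the cubic meet some codimension two subspace \<open>W\<close>. In that case
  fix a line \<open>L\<close> that meets \<open>W\<close> in one point \<open>w\<close>. The discriminant of the residual conics in the planes
  containing \<open>L\<close> is a quintic \<open>\<Delta>\<close>; outside the hyperplane \<open>h = 0\<close> spanned by \<open>L\<close> and \<open>W\<close>, a degenerate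
  conic consists of lines through \<open>w\<close>, so that \<open>\<Delta> = 0\<close> forces \<open>A = T w w = 0\<close>. Hence \<open>\<Delta> = c A\<^sup>i h\<^sup>j\<close> is
  divisible by the square of a linear form \<open>g\<close>. Over \<open>g = 0\<close> the derivative of \<open>\<Delta>\<close> vanishes, and since
  the cubic is smooth all conics there have rank at most one; this again produces a singular point.\<close>

section \<open>Polynomial functions of one complex variable\<close>

text \<open>In coordinates \<open>(r, s, t)\<close> for \<open>r x + s u + t v\<close> the cubic is
  \<open>r\<close> times the residual conic. The cross product of the covector \<open>dot\<close>
  with the gradient of the conic is tangent to the level sets of both, so an orbit from
  \<open>x\<close>, where the conic vanishes, stays in \<open>X\<close>. The plane itself moves with
  \<open>x\<close>; the formulas are polynomial or entire in \<open>x\<close>, so planes that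
  degenerate need no separate case. Domination is tested on covectors. From a covector that
  annihilates all velocities at \<open>x\<close>, subtract its value at \<open>x\<close> times
  \<open>dot\<close>; the resulting \<open>\<beta>'\<close> kills \<open>x\<close>, and the two-form
  \<open>T x x \<and> \<beta>'\<close> vanishes on a line exactly if the line meets the common
  kernel \<open>W\<close> of \<open>T x x\<close> and \<open>\<beta>'\<close>. The bound
  \<open>n \<ge> 3\<close> provides five homogeneous coordinates, so three linear conditions still
  leave two independent vectors \<open>u\<close>, \<open>v\<close>. If \<open>T u u\<close>,
  \<open>T u v\<close>, \<open>T v v\<close> are all multiples of one linear form, then a binary
  quadratic equation selects a combination of \<open>u\<close> and \<open>v\<close> at which the
  differential of the cubic vanishes. This is how the final contradiction with smoothness
  arises.\<close>

definition polyfun :: "(complex \<Rightarrow> complex) \<Rightarrow> bool" where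
  "polyfun f \<longleftrightarrow> (\<exists>p. \<forall>t. f t = poly p t)"

lemma polyfun_const: "polyfun (\<lambda>t. c)"
  unfolding polyfun_def by (intro exI[of _ "[:c:]"]) simp

lemma polyfun_id: "polyfun (\<lambda>t. t)"
  unfolding polyfun_def by (intro exI[of _ "[:0, 1:]"]) simp

lemma polyfun_add: "polyfun f \<Longrightarrow> polyfun g \<Longrightarrow> polyfun (\<lambda>t. f t + g t)"
  unfolding polyfun_def by (metis poly_add)

lemma polyfun_diff: "polyfun f \<Longrightarrow> polyfun g \<Longrightarrow> polyfun (\<lambda>t. f t - g t)"
  unfolding polyfun_def by (metis poly_diff)

lemma polyfun_uminus: "polyfun f \<Longrightarrow> polyfun (\<lambda>t. - f t)"
  unfolding polyfun_def by (metis poly_minus)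

lemma polyfun_mult: "polyfun f \<Longrightarrow> polyfun g \<Longrightarrow> polyfun (\<lambda>t. f t * g t)"
  unfolding polyfun_def by (metis poly_mult)

lemma polyfun_power: "polyfun f \<Longrightarrow> polyfun (\<lambda>t. f t ^ n)"
  unfolding polyfun_def by (metis poly_power)

lemmas polyfun_intros =
  polyfun_const polyfun_id polyfun_add polyfun_diff polyfun_uminus polyfun_mult polyfun_power

lemma polyfunE:
  assumes "polyfun f"
  obtains p where "f = poly p"
  using assms unfolding polyfun_def by (metis ext)

lemma polyfun_isCont: "polyfun f \<Longrightarrow> isCont f a"
  by (elim polyfunE) simp

lemma polyfun_differentiable: "polyfun f \<Longrightarrow> f field_differentiable (at a)"
  by (elim polyfunE) (auto simp: field_differentiable_def intro: poly_DERIV)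

lemma polyfun_no_root: "polyfun f \<Longrightarrow> (\<And>t. f t \<noteq> 0) \<Longrightarrow> f t = f u"
  unfolding polyfun_def by (metis constant_def fundamental_theorem_of_algebra)

text \<open>Splitting off the full power of the linear factor leaves a polynomial without roots,
  constant by the fundamental theorem of algebra. No root at 0 is presupposed, so the exponent may
  be 0.\<close>

lemma polyfun_single_root:
  assumes "polyfun f" "\<And>t. f t = 0 \<Longrightarrow> t = 0"
  obtains c i where "\<And>t. f t = c * t ^ i"
proof -
  obtain p where p: "\<And>t. f t = poly p t"
    using assms(1) unfolding polyfun_def by blast
  have "p \<noteq> 0"
    using p assms(2)[of 1] by auto
  then obtain q where q: "p = [:0, 1:] ^ order 0 p * q" and nd: "\<not> [:0, 1:] dvd q"
    using order_decomp[of p 0] by auto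
  have q0: "poly q t \<noteq> 0" for t
  proof (cases "t = 0")
    case True
    then show ?thesis
      using nd by (metis dvd_iff_poly_eq_0 minus_zero)
  next
    case False
    then show ?thesis
      using assms(2)[of t] p q by (metis mult_zero_right poly_mult)
  qed
  then have "poly q t = poly q 0" for t
    using fundamental_theorem_of_algebra[of q] unfolding constant_def by metis
  moreover have "f t = t ^ order 0 p * poly q t" for t
    unfolding p by (subst q) (simp add: poly_power)
  ultimately have "f t = poly q 0 * t ^ order 0 p" for t by simp
  then show ?thesis by (rule that)
qed

text \<open>Continuity fills in the exceptional points. This extends identities known only off some
  hyperplanes, along a line whose parameter is 0 at the point in question.\<close>

lemma polyfun_eq_at_0:
  assumes "polyfun f" "polyfun g" "finite X" "\<And>t. t \<notin> X \<Longrightarrow> f t = g t"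
  shows "f 0 = g 0"
proof -
  have "((\<lambda>t. f t - g t) \<longlongrightarrow> f 0 - g 0) (at 0)"
    using polyfun_isCont[OF assms(1)] polyfun_isCont[OF assms(2)] by (auto simp: isCont_def intro!: tendsto_diff)
  moreover have "eventually (\<lambda>t. t \<notin> X) (at (0::complex))"
    using islimpt_finite[OF assms(3)] unfolding islimpt_iff_eventually by simp
  then have "eventually (\<lambda>t. f t - g t = 0) (at 0)"
    by eventually_elim (simp add: assms(4))
  ultimately have "((\<lambda>t. 0) \<longlongrightarrow> f 0 - g 0) (at (0::complex))"
    by (rule Lim_transform_eventually)
  from tendsto_unique[OF trivial_limit_at this tendsto_const] show ?thesis by simp
qed

text \<open>\<open>G\<close> is a binary form seen through its two dehomogenizations. If
  \<open>G 1\<close> has no root it is constant, so the other one is a constant times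
  \<open>s ^ m\<close> and vanishes at the point \<open>(0, 1)\<close>.\<close>

lemma homogeneous_root:
  fixes G :: "complex \<Rightarrow> complex \<Rightarrow> complex"
  assumes "polyfun (G 1)" "polyfun (\<lambda>s. G s 1)" "m > 0"
    and hom: "\<And>s. s \<noteq> 0 \<Longrightarrow> G s 1 = s ^ m * G 1 (1 / s)"
  shows "\<exists>s t. (s \<noteq> 0 \<or> t \<noteq> 0) \<and> G s t = 0"
proof (cases "\<exists>t. G 1 t = 0")
  case True
  then show ?thesis by (metis zero_neq_one)
next
  case False
  then have "G 1 t = G 1 0" for t
    using polyfun_no_root[OF assms(1)] by blast
  then have eq: "G s 1 = s ^ m * G 1 0" if "s \<notin> {0}" for s
    using hom that by (metis singletonI)
  have pf: "polyfun (\<lambda>s. s ^ m * G 1 0)" by (intro polyfun_intros)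
  have "G 0 1 = 0 ^ m * G 1 0"
    using polyfun_eq_at_0[OF assms(2) pf, of "{0}"] eq by blast
  then show ?thesis
    using assms(3) by (intro exI[of _ 0] exI[of _ 1]) simp
qed

text \<open>The binomial factors, here and in the cubic case, are those that appear when a polarized
  form is expanded.\<close>

lemma binary_quadratic_root:
  "\<exists>s t :: complex. (s \<noteq> 0 \<or> t \<noteq> 0) \<and> a * s^2 + 2 * b * s * t + c * t^2 = 0"
proof (rule homogeneous_root[where m = 2])
  show "polyfun (\<lambda>t. a * 1^2 + 2 * b * 1 * t + c * t^2)" "polyfun (\<lambda>s. a * s^2 + 2 * b * s * 1 + c * 1^2)"
    by (intro polyfun_intros)+
  fix s :: complex assume "s \<noteq> 0"
  then have "s * (1 / s) = 1" by simp
  then show "a * s^2 + 2 * b * s * 1 + c * 1^2 = s^2 * (a * 1^2 + 2 * b * 1 * (1 / s) + c * (1 / s)^2)"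
    unfolding power_one mult_1_right mult_1_left by algebra
qed simp

lemma binary_cubic_root:
  "\<exists>s t :: complex. (s \<noteq> 0 \<or> t \<noteq> 0) \<and> a * s^3 + 3 * b * s^2 * t + 3 * c * s * t^2 + d * t^3 = 0"
proof (rule homogeneous_root[where m = 3])
  show "polyfun (\<lambda>t. a * 1^3 + 3 * b * 1^2 * t + 3 * c * 1 * t^2 + d * t^3)"
    "polyfun (\<lambda>s. a * s^3 + 3 * b * s^2 * 1 + 3 * c * s * 1^2 + d * 1^3)"
    by (intro polyfun_intros)+
  fix s :: complex assume "s \<noteq> 0"
  then have "s * (1 / s) = 1" by simp
  then show "a * s^3 + 3 * b * s^2 * 1 + 3 * c * s * 1^2 + d * 1^3
      = s^3 * (a * 1^3 + 3 * b * 1^2 * (1 / s) + 3 * c * 1 * (1 / s)^2 + d * (1 / s)^3)"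
    unfolding power_one mult_1_right mult_1_left by algebra
qed simp

lemma quadratic_root:
  assumes a: "a \<noteq> 0"
  shows "\<exists>s::complex. a * s^2 + 2 * b * s + c = 0"
proof -
  define r where "r = csqrt (b^2 - a * c)"
  have r: "r^2 = b^2 - a * c" by (simp add: r_def)
  have "a * ((r - b) * inverse a)^2 + 2 * b * ((r - b) * inverse a) + c = 0"
    using a r left_inverse[OF a] by algebra
  then show ?thesis by blast
qed

section \<open>Symmetric trilinear forms\<close>

locale cubic = vector_space sc
  for sc :: "complex \<Rightarrow> 'v::ab_group_add \<Rightarrow> 'v" (infixr "\<cdot>" 75) +
  fixes T :: "'v \<Rightarrow> 'v \<Rightarrow> 'v \<Rightarrow> complex"
  assumes T_add1: "T (x + y) u v = T x u v + T y u v"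
    and T_sc1: "T (c \<cdot> x) u v = c * T x u v"
    and T_swap12: "T x y z = T y x z"
    and T_swap23: "T x y z = T x z y"
begin

lemma T_add2: "T u (x + y) v = T u x v + T u y v"
  by (metis T_add1 T_swap12)
lemma T_add3: "T u v (x + y) = T u v x + T u v y"
  by (metis T_add2 T_swap23)
lemma T_sc2: "T u (c \<cdot> x) v = c * T u x v"
  by (metis T_sc1 T_swap12)
lemma T_sc3: "T u v (c \<cdot> x) = c * T u v x"
  by (metis T_sc2 T_swap23)

lemmas T_lin = T_add1 T_add2 T_add3 T_sc1 T_sc2 T_sc3

lemma T_diff1: "T (x - y) u v = T x u v - T y u v"
  by (metis T_add1 add_diff_cancel_right' diff_add_cancel)
lemma T_diff2: "T u (x - y) v = T u x v - T u y v"
  by (metis T_diff1 T_swap12)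
lemma T_diff3: "T u v (x - y) = T u v x - T u v y"
  by (metis T_diff2 T_swap23)

lemmas T_diff = T_diff1 T_diff2 T_diff3

text \<open>The vectors will be infinite sequences of which \<open>T\<close> sees only an initial segment, so the radical plays
  the role of the zero space.\<close>

definition null :: "'v \<Rightarrow> bool" where "null x \<longleftrightarrow> (\<forall>y z. T x y z = 0)"

definition linf :: "('v \<Rightarrow> complex) \<Rightarrow> bool" where
  "linf f \<longleftrightarrow> (\<forall>x y. f (x + y) = f x + f y) \<and> (\<forall>c x. f (c \<cdot> x) = c * f x)"

text \<open>These are the coefficients of the cubic restricted to the span of \<open>u\<close> and
  \<open>v\<close>. Independence of \<open>u\<close> and \<open>v\<close> is not part of the notion;
  it is obtained separately.\<close>

definition line :: "'v \<Rightarrow> 'v \<Rightarrow> bool" where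
  "line u v \<longleftrightarrow> T u u u = 0 \<and> T u u v = 0 \<and> T u v v = 0 \<and> T v v v = 0"

lemma linf_T [simp]: "linf (T u v)" 
  by (auto simp: linf_def T_lin)
lemma linf_add: "linf f \<Longrightarrow> f (x + y) = f x + f y"
  and linf_sc: "linf f \<Longrightarrow> f (c \<cdot> x) = c * f x"
  by (auto simp: linf_def)
lemma linf_diff: "linf f \<Longrightarrow> f (x - y) = f x - f y"
  by (metis linf_def add_diff_cancel_right' diff_add_cancel)
lemma linf_comb: "linf f \<Longrightarrow> linf g \<Longrightarrow> linf (\<lambda>x. a * f x + b * g x)"
  by (auto simp: linf_def algebra_simps)

text \<open>In the plane spanned by the line \<open>\<langle>w, z\<rangle>\<close> and \<open>x\<close> the residual conic has the Gram matrix
  \<open>[[2F, 3b, 3e], [3b, 6A, 6B], [3e, 6B, 6C]]\<close>, up to a factor; its determinant is \<open>18\<close> times the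
  following quintic.\<close>

definition disc :: "'v \<Rightarrow> 'v \<Rightarrow> 'v \<Rightarrow> complex" where
  "disc w z x = 4 * T x x x * (T w w x * T z z x - (T w z x)^2)
     - 3 * ((T w x x)^2 * T z z x - 2 * T w x x * T z x x * T w z x + (T z x x)^2 * T w w x)"

lemma disc_polyfun: "polyfun (\<lambda>t. disc w z (x + t \<cdot> y))"
  unfolding disc_def T_lin by (intro polyfun_intros)

lemma disc_scale: "disc w z (c \<cdot> x) = c ^ 5 * disc w z x"
  unfolding disc_def T_lin by (simp add: algebra_simps power2_eq_square numeral_eq_Suc)

lemma null_sc: "null (c \<cdot> x) \<Longrightarrow> c \<noteq> 0 \<Longrightarrow> null x"
  by (auto simp: null_def T_lin)

lemma null_T: "null x \<Longrightarrow> T x y z = 0" "null x \<Longrightarrow> T y x z = 0" "null x \<Longrightarrow> T y z x = 0"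
  by (auto simp: null_def) (metis T_swap12, metis T_swap12 T_swap23)

lemma T_perm:
  "T x w x = T w x x" "T x x w = T w x x" "T w x w = T w w x" "T x w w = T w w x"
  "T w x z = T w z x" "T z w x = T w z x" "T z x w = T w z x" "T x w z = T w z x" "T x z w = T w z x"
  by (metis T_swap12 T_swap23)+

text \<open>\<open>T\<close> vanishes on the line itself, so every surviving term has a factor
  \<open>r\<close>, \<open>r'\<close> or \<open>r''\<close>. On the diagonal this exhibits the cubic
  as \<open>r\<close> times the residual conic.\<close>

lemma line_T:
  assumes "line w z"
  shows "T (r \<cdot> x + s \<cdot> w + t \<cdot> z) (r' \<cdot> x + s' \<cdot> w + t' \<cdot> z) (r'' \<cdot> x + s'' \<cdot> w + t'' \<cdot> z)
    = r * r' * r'' * T x x x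
    + (r * r' * s'' + r * s' * r'' + s * r' * r'') * T w x x
    + (r * r' * t'' + r * t' * r'' + t * r' * r'') * T z x x
    + (r * s' * s'' + s * r' * s'' + s * s' * r'') * T w w x
    + (r * t' * t'' + t * r' * t'' + t * t' * r'') * T z z x
    + (r * s' * t'' + r * t' * s'' + s * r' * t'' + t * r' * s'' + s * t' * r'' + t * s' * r'') * T w z x"
proof -
  have z: "T w w w = 0" "T w w z = 0" "T w z w = 0" "T z w w = 0" "T w z z = 0" "T z w z = 0" "T z z w = 0" "T z z z = 0"
    using assms unfolding line_def by (metis T_swap12 T_swap23)+
  show ?thesis
    unfolding T_lin z T_perm(1-4)[where x = x and w = w] T_perm(1-4)[where x = x and w = z]
      T_perm(5-9)[where x = x and w = w and z = z] by (simp add: algebra_simps)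
qed

text \<open>The hypothesis is the vanishing determinant of the symmetric matrix
  \<open>[[a, b, c], [b, d, e], [c, e, f]]\<close>, to be used for the Gram matrix of a
  conic.\<close>

lemma kernel3:
  fixes a b c d e f :: complex
  assumes "a * (d * f - e^2) - b * (b * f - c * e) + c * (b * e - c * d) = 0"
  shows "\<exists>r s t. (r \<noteq> 0 \<or> s \<noteq> 0 \<or> t \<noteq> 0) \<and> a * r + b * s + c * t = 0 \<and> b * r + d * s + e * t = 0 \<and> c * r + e * s + f * t = 0"
proof -
  define M :: "complex^3^3" where "M = vector [vector [a, b, c], vector [b, d, e], vector [c, e, f]]"
  have "det M = 0"
    unfolding det_3 M_def vector_3 using assms by algebra
  then have "\<not> (\<exists>B. B ** M = mat 1)"
    using invertible_det_nz[of M] unfolding invertible_left_inverse by simp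
  then obtain x where x: "M *v x = 0" "x \<noteq> 0"
    unfolding matrix_left_invertible_ker by blast
  have "(M *v x) $ i = 0" for i using x by simp
  from this[of 1] this[of 2] this[of 3] show ?thesis
    using x(2) unfolding matrix_vector_mult_def M_def
    by (intro exI[of _ "x$1"] exI[of _ "x$2"] exI[of _ "x$3"]) (auto simp: sum_3 vec_eq_iff forall_3)
qed

text \<open>A degenerate conic consists of lines through its vertex, a kernel vector of the Gram
  matrix. The hypothesis \<open>ne\<close> says that \<open>w\<close> is not such a vector. The
  minor \<open>r * t' - r' * t\<close> omits the coordinate along \<open>w\<close>; in the
  coordinates of the plane it is nonzero exactly if the line found avoids \<open>w\<close>.\<close>

lemma residual_line:
  assumes l: "line w z" and d: "disc w z x = 0"
    and ne: "T w w x \<noteq> 0 \<or> T w z x \<noteq> 0 \<or> T w x x \<noteq> 0"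
  shows "\<exists>r s t r' s' t'. r * t' - r' * t \<noteq> 0 \<and>
    line (r \<cdot> x + s \<cdot> w + t \<cdot> z) (r' \<cdot> x + s' \<cdot> w + t' \<cdot> z)"
proof -
  define F where "F = T x x x" define b where "b = T w x x" define e where "e = T z x x"
  define A where "A = T w w x" define B where "B = T w z x" define C where "C = T z z x"
  note defs = F_def b_def e_def A_def B_def C_def
  have "(2 * F) * ((6 * A) * (6 * C) - (6 * B)^2) - (3 * b) * ((3 * b) * (6 * C) - (3 * e) * (6 * B))
      + (3 * e) * ((3 * b) * (6 * B) - (3 * e) * (6 * A)) = 18 * disc w z x"
    unfolding disc_def defs[symmetric] by algebra
  then obtain r s t where k0: "r \<noteq> 0 \<or> s \<noteq> 0 \<or> t \<noteq> 0"
    and k: "2 * F * r + 3 * b * s + 3 * e * t = 0" "3 * b * r + 6 * A * s + 6 * B * t = 0" "3 * e * r + 6 * B * s + 6 * C * t = 0"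
    using kernel3[of "2 * F" "6 * A" "6 * C" "6 * B" "3 * b" "3 * e"] d by auto
  have rt: "r \<noteq> 0 \<or> t \<noteq> 0"
    using k k0 ne unfolding A_def[symmetric] B_def[symmetric] b_def[symmetric] by auto
  \<comment> \<open>The second point is sought on the line joining \<open>w\<close> to
    \<open>(r1, 0, t1)\<close>, which misses the vertex by this choice.\<close>
  define r1 t1 :: complex where "r1 = (if r = 0 then 1 else 0)" and "t1 = (if r = 0 then 0 else 1)"
  have d1: "r * t1 - r1 * t \<noteq> 0" using rt by (auto simp: r1_def t1_def)
  define Q where "Q = 3 * b * r1 + 6 * B * t1"
  define q where "q = 2 * F * r1^2 + 6 * e * r1 * t1 + 6 * C * t1^2"
  \<comment> \<open>Intersection of that line with the conic, required to differ from
    \<open>w\<close>, hence \<open>\<tau> \<noteq> 0\<close>. If \<open>w\<close> lies on the conic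
    (\<open>A = 0\<close>), the other intersection solves a linear equation with coefficient
    \<open>Q\<close>, nonzero because \<open>w\<close> is not a vertex.\<close>
  obtain \<sigma> \<tau> where st: "\<tau> \<noteq> 0" "6 * A * \<sigma>^2 + 2 * Q * \<sigma>*\<tau> + q * \<tau>^2 = 0"
  proof (cases "A = 0")
    case True
    have "Q \<noteq> 0"
    proof
      assume "Q = 0"
      then have "(r * t1 - r1 * t) * b = 0" "(r * t1 - r1 * t) * B = 0"
        using k(2) True unfolding Q_def by algebra+
      then show False using d1 ne True unfolding A_def[symmetric] B_def[symmetric] b_def[symmetric] by simp
    qed
    then show ?thesis
      using that[of "2 * Q" "-q"] True by (simp add: power2_eq_square)
  next
    case False
    then show ?thesis
      using that[of 1] quadratic_root[of "6 * A" Q q] by auto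
  qed
  have q1: "F * r^2 + 3 * b * r * s + 3 * e * r * t + 3 * A * s^2 + 6 * B * s * t + 3 * C * t^2 = 0"
    using k by algebra
  have q2: "F * (\<tau>*r1)^2 + 3 * b * (\<tau>*r1) * \<sigma> + 3 * e * (\<tau>*r1) * (\<tau>*t1) + 3 * A * \<sigma>^2 + 6 * B * \<sigma>*(\<tau>*t1) + 3 * C * (\<tau>*t1)^2 = 0"
    using st(2) unfolding Q_def q_def by algebra
  have "r * (\<tau>*t1) - (\<tau>*r1) * t \<noteq> 0"
    using d1 st(1) by (metis mult.assoc mult.left_commute no_zero_divisors right_diff_distrib)
  moreover have "line (r \<cdot> x + s \<cdot> w + t \<cdot> z) ((\<tau>*r1) \<cdot> x + \<sigma> \<cdot> w + (\<tau>*t1) \<cdot> z)"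
  proof -
    have q1': "r * r * r * F + (r * r * s + r * s * r + s * r * r) * b + (r * r * t + r * t * r + t * r * r) * e +
      (r * s * s + s * r * s + s * s * r) * A + (r * t * t + t * r * t + t * t * r) * C +
      (r * s * t + r * t * s + s * r * t + t * r * s + s * t * r + t * s * r) * B
      = r * (F * r^2 + 3 * b * r * s + 3 * e * r * t + 3 * A * s^2 + 6 * B * s * t + 3 * C * t^2)" for r s t
      by algebra
    \<comment> \<open>\<open>e1\<close> and \<open>e2\<close> are the mixed values of
      \<open>T\<close> at the vertex and a second point. Three times such a value combines values of
      the conic with the kernel equations \<open>k\<close> of the vertex, all of which
      vanish.\<close>
    have e1: "r * r * r2 * F + (r * r * s2 + r * s * r2 + s * r * r2) * b + (r * r * t2 + r * t * r2 + t * r * r2) * e +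
      (r * s * s2 + s * r * s2 + s * s * r2) * A + (r * t * t2 + t * r * t2 + t * t * r2) * C +
      (r * s * t2 + r * t * s2 + s * r * t2 + t * r * s2 + s * t * r2 + t * s * r2) * B = 0" (is "?X = 0") for r2 s2 t2
    proof -
      have "3 * ?X = r2 * (F * r^2 + 3 * b * r * s + 3 * e * r * t + 3 * A * s^2 + 6 * B * s * t + 3 * C * t^2)
       + r * (r2 * (2 * F * r + 3 * b * s + 3 * e * t) + s2 * (3 * b * r + 6 * A * s + 6 * B * t) + t2 * (3 * e * r + 6 * B * s + 6 * C * t))"
        by (simp add: algebra_simps power2_eq_square)
      then have "3 * ?X = 0" unfolding q1 k by (simp only: mult_zero_right add_0)
      then show ?thesis by (metis mult_eq_0_iff zero_neq_numeral)
    qed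
    have e2: "r * r2 * r2 * F + (r * r2 * s2 + r * s2 * r2 + s * r2 * r2) * b + (r * r2 * t2 + r * t2 * r2 + t * r2 * r2) * e +
      (r * s2 * s2 + s * r2 * s2 + s * s2 * r2) * A + (r * t2 * t2 + t * r2 * t2 + t * t2 * r2) * C +
      (r * s2 * t2 + r * t2 * s2 + s * r2 * t2 + t * r2 * s2 + s * t2 * r2 + t * s2 * r2) * B = 0" (is "?X = 0")
      if q2: "F * r2^2 + 3 * b * r2 * s2 + 3 * e * r2 * t2 + 3 * A * s2^2 + 6 * B * s2 * t2 + 3 * C * t2^2 = 0" for r2 s2 t2
    proof -
      have "3 * ?X = r * (F * r2^2 + 3 * b * r2 * s2 + 3 * e * r2 * t2 + 3 * A * s2^2 + 6 * B * s2 * t2 + 3 * C * t2^2)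
       + r2 * (r2 * (2 * F * r + 3 * b * s + 3 * e * t) + s2 * (3 * b * r + 6 * A * s + 6 * B * t) + t2 * (3 * e * r + 6 * B * s + 6 * C * t))"
        by (simp add: algebra_simps power2_eq_square)
      then have "3 * ?X = 0" unfolding q2 k by (simp only: mult_zero_right add_0)
      then show ?thesis by (metis mult_eq_0_iff zero_neq_numeral)
    qed
    show ?thesis
      unfolding line_def[of "r \<cdot> x + s \<cdot> w + t \<cdot> z"] line_T[OF l] defs[symmetric]
      by (intro conjI) (simp only: q1' q1 mult_zero_right, rule e1, rule e2[OF q2], simp only: q1' q2 mult_zero_right)
  qed
  ultimately show ?thesis by blast
qed

lemma linf_comb_eq:
  assumes "linf f" "linf g" "\<And>x. f x = 0 \<Longrightarrow> g x = 0" "f a \<noteq> 0"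
  shows "g x = g a / f a * f x"
proof -
  have "f (x - (f x / f a) \<cdot> a) = 0"
    using assms by (simp add: linf_diff linf_sc)
  then have "g (x - (f x / f a) \<cdot> a) = 0" by (rule assms)
  then show ?thesis using assms by (simp add: linf_diff linf_sc)
qed

text \<open>\<open>\<Delta>\<close> can only vanish on \<open>A = 0\<close> and \<open>h = 0\<close>, so it is a multiple of \<open>A\<^sup>i h\<^sup>j\<close> with \<open>i + j = 5\<close>, and one of the
  exponents is at least 2.\<close>

lemma quintic_factor:
  assumes pf: "\<And>x y. polyfun (\<lambda>t. \<Delta> (x + t \<cdot> y))" and hom: "\<And>c x. \<Delta> (c \<cdot> x) = c ^ 5 * \<Delta> x"
    and lA: "linf A" and lh: "linf h" and a: "A a \<noteq> 0" and b: "h b \<noteq> 0"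
    and key: "\<And>x. h x \<noteq> 0 \<Longrightarrow> \<Delta> x = 0 \<Longrightarrow> A x = 0"
  shows "\<exists>g R. (g = A \<or> g = h) \<and> (\<forall>x. \<Delta> x = g x ^ 2 * R x) \<and> (\<forall>x y. polyfun (\<lambda>t. R (x + t \<cdot> y)))"
proof -
  note lin = linf_add[OF lA] linf_sc[OF lA] linf_add[OF lh] linf_sc[OF lh] linf_diff[OF lA] linf_diff[OF lh]
  \<comment> \<open>In a direction killed by \<open>A\<close> and \<open>h\<close> no zero of
    \<open>\<Delta>\<close> is met, and a polynomial without zeros is constant. So off the two
    hyperplanes \<open>\<Delta>\<close> depends only on the values of \<open>A\<close> and
    \<open>h\<close>.\<close>
  have shift: "\<Delta> (x + y) = \<Delta> x" if "h x \<noteq> 0" "A x \<noteq> 0" "A y = 0" "h y = 0" for x y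
  proof -
    have "\<Delta> (x + t \<cdot> y) \<noteq> 0" for t
      using key[of "x + t \<cdot> y"] that by (auto simp: lin)
    from polyfun_no_root[OF pf this, of 1 0] show ?thesis by simp
  qed
  have pfl: "polyfun (\<lambda>t. f (x + t \<cdot> y))" if "linf f" for f x y
    unfolding linf_add[OF that] linf_sc[OF that] by (intro polyfun_intros)
  show ?thesis
  proof (cases "(\<exists>x. h x = 0 \<and> A x \<noteq> 0) \<and> (\<exists>x. A x = 0 \<and> h x \<noteq> 0)")
    \<comment> \<open>One kernel contains the other, so \<open>A\<close> and \<open>h\<close> are
      proportional and \<open>\<Delta>\<close> is a multiple of \<open>h ^ 5\<close>.\<close>
    case False
    then consider "\<And>x. h x = 0 \<Longrightarrow> A x = 0" | "\<And>x. A x = 0 \<Longrightarrow> h x = 0" by blast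
    then have "\<exists>\<kappa>. \<forall>x. A x = \<kappa> * h x"
    proof cases
      case 1
      then show ?thesis using linf_comb_eq[OF lh lA _ b] by blast
    next
      case 2
      have eq: "h x = h a / A a * A x" for x by (rule linf_comb_eq[OF lA lh 2 a])
      then have "h a \<noteq> 0" using b by (metis div_0 mult_zero_left)
      then have "A x = A a / h a * h x" for x using a eq[of x] by simp
      then show ?thesis by blast
    qed
    then obtain \<kappa> where \<kappa>: "\<And>x. A x = \<kappa> * h x" by blast
    have \<kappa>0: "\<kappa> \<noteq> 0" using a \<kappa> by auto
    define x0 where "x0 = (1 / h b) \<cdot> b"
    have x0: "h x0 = 1" using b by (simp add: x0_def lin)
    have 1: "\<Delta> x = h x ^ 5 * \<Delta> x0" if "h x \<noteq> 0" for x
    proof -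
      have "\<Delta> (h x \<cdot> x0 + (x - h x \<cdot> x0)) = \<Delta> (h x \<cdot> x0)"
        by (rule shift) (use that x0 \<kappa>0 in \<open>simp_all add: \<kappa> lin\<close>)
      then show ?thesis by (simp add: hom)
    qed
    have "\<Delta> x = h x ^ 2 * (h x ^ 3 * \<Delta> x0)" for x
    proof -
      have "\<Delta> (x + t \<cdot> x0) = h (x + t \<cdot> x0) ^ 5 * \<Delta> x0" if "t \<notin> {- h x}" for t
        by (rule 1) (use that in \<open>auto simp: lin x0 add_eq_0_iff2 add.commute\<close>)
      moreover have "polyfun (\<lambda>t. h (x + t \<cdot> x0) ^ 5 * \<Delta> x0)"
        by (intro polyfun_intros pfl lh)
      ultimately have "\<Delta> (x + 0 \<cdot> x0) = h (x + 0 \<cdot> x0) ^ 5 * \<Delta> x0"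
        by (intro polyfun_eq_at_0[OF pf, of _ "{- h x}" x x0]) auto
      then show ?thesis by (simp add: power2_eq_square numeral_eq_Suc)
    qed
      moreover have "polyfun (\<lambda>t. h (x + t \<cdot> y) ^ 3 * \<Delta> x0)" for x y
        by (intro polyfun_intros pfl lA lh)
      ultimately show ?thesis
        by (intro exI[of _ h] exI[of _ "\<lambda>x. h x ^ 3 * \<Delta> x0"]) blast
  next
    case True
    then obtain y1 y0 where y: "h y1 = 0" "A y1 \<noteq> 0" "A y0 = 0" "h y0 \<noteq> 0" by blast
    \<comment> \<open>Dual to \<open>A\<close> and \<open>h\<close>. On
      \<open>x0 + t \<cdot> x1\<close> a zero forces \<open>A = t = 0\<close>, on
      \<open>x1 + t \<cdot> x0\<close> it forces \<open>h = t = 0\<close>; so both restrictions are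
      monomials.\<close>
    define x1 x0 where "x1 = (1 / A y1) \<cdot> y1" and "x0 = (1 / h y0) \<cdot> y0"
    have x: "h x1 = 0" "A x1 = 1" "A x0 = 0" "h x0 = 1"
      using y by (simp_all add: x1_def x0_def lin)
    obtain c i where P: "\<And>t. \<Delta> (x0 + t \<cdot> x1) = c * t ^ i"
    proof (rule polyfun_single_root[OF pf])
      show "t = 0" if "\<Delta> (x0 + t \<cdot> x1) = 0" for t
        using key[OF _ that] x by (simp add: lin)
    qed blast
    obtain c' j where Q: "\<And>t. \<Delta> (x1 + t \<cdot> x0) = c' * t ^ j"
    proof (rule polyfun_single_root[OF pf])
      show "t = 0" if "\<Delta> (x1 + t \<cdot> x0) = 0" for t
        using key[OF _ that] x by (auto simp: lin)
    qed blast
    have PQ: "c' * s ^ j = s ^ 5 * (c * (1 / s) ^ i)" if "s \<noteq> 0" for s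
    proof -
      have "x1 + s \<cdot> x0 = s \<cdot> (x0 + (1 / s) \<cdot> x1)"
        using that by (simp add: scale_right_distrib)
      then show ?thesis using P Q hom by metis
    qed
    \<comment> \<open>Both monomials restrict the same form of degree 5, which ties their exponents
      together; the values at 1 and 2 suffice to see it. For \<open>c = 0\<close> the exponents are
      arbitrary and 5, 0 are taken.\<close>
    obtain i' j' where ij: "i' + j' = 5" and P': "\<And>t. \<Delta> (x0 + t \<cdot> x1) = c * t ^ i'"
    proof (cases "c = 0")
      case True
      then show ?thesis using that[of 5 0] P by simp
    next
      case False
      have "c' = c" using PQ[of 1] by simp
      then have "(2::complex) ^ (i + j) = 2 ^ 5"
        using PQ[of 2] False by (simp add: field_simps power_add)
      then have "of_nat (2 ^ (i + j)) = (of_nat (2 ^ 5) :: complex)" by simp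
      then have "(2::nat) ^ (i + j) = 2 ^ 5" unfolding of_nat_eq_iff .
      then have "i + j = 5" by (subst (asm) power_inject_exp) auto
      then show ?thesis using that P by blast
    qed
    have 1: "\<Delta> x = c * A x ^ i' * h x ^ j'" if "A x \<noteq> 0" "h x \<noteq> 0" for x
    proof -
      let ?v = "h x \<cdot> (x0 + (A x / h x) \<cdot> x1)"
      have "\<Delta> (?v + (x - ?v)) = \<Delta> ?v"
        by (rule shift) (use that x in \<open>simp_all add: lin\<close>)
      then have "\<Delta> x = h x ^ 5 * (c * (A x / h x) ^ i')"
        by (simp add: hom P')
      then show ?thesis
        using that ij[symmetric] by (simp add: power_add power_divide)
    qed
    have all: "\<Delta> x = c * A x ^ i' * h x ^ j'" for x
    proof -
      \<comment> \<open>Both \<open>A\<close> and \<open>h\<close> grow with slope 1 in this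
        direction, so at most two parameters are exceptional.\<close>
      let ?y = "x0 + x1"
      have "\<Delta> (x + t \<cdot> ?y) = c * A (x + t \<cdot> ?y) ^ i' * h (x + t \<cdot> ?y) ^ j'" if "t \<notin> {- h x, - A x}" for t
        by (rule 1) (use that in \<open>auto simp: lin x add_eq_0_iff2 add.commute\<close>)
      moreover have "polyfun (\<lambda>t. c * A (x + t \<cdot> ?y) ^ i' * h (x + t \<cdot> ?y) ^ j')"
        by (intro polyfun_intros pfl lh lA)
      ultimately have "\<Delta> (x + 0 \<cdot> ?y) = c * A (x + 0 \<cdot> ?y) ^ i' * h (x + 0 \<cdot> ?y) ^ j'"
        by (intro polyfun_eq_at_0[OF pf, of _ "{- h x, - A x}" x ?y]) auto
      then show ?thesis by simp
    qed
    consider "i' \<ge> 2" | "j' \<ge> 2" using ij by linarith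
    then show ?thesis
    proof cases
      case 1
      then have "\<Delta> x = A x ^ 2 * (c * A x ^ (i' - 2) * h x ^ j')" for x
        unfolding all by (metis (no_types, lifting) le_add_diff_inverse mult.assoc mult.left_commute power_add)
      moreover have "polyfun (\<lambda>t. c * A (x + t \<cdot> y) ^ (i' - 2) * h (x + t \<cdot> y) ^ j')" for x y
        by (intro polyfun_intros pfl lA lh)
      ultimately show ?thesis
        by (intro exI[of _ A] exI[of _ "\<lambda>x. c * A x ^ (i' - 2) * h x ^ j'"]) blast
    next
      case 2
      then have "\<Delta> x = h x ^ 2 * (c * A x ^ i' * h x ^ (j' - 2))" for x
        unfolding all by (metis (no_types, lifting) le_add_diff_inverse mult.assoc mult.left_commute power_add)
      moreover have "polyfun (\<lambda>t. c * A (x + t \<cdot> y) ^ i' * h (x + t \<cdot> y) ^ (j' - 2))" for x y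
        by (intro polyfun_intros pfl lA lh)
      ultimately show ?thesis
        by (intro exI[of _ h] exI[of _ "\<lambda>x. c * A x ^ i' * h x ^ (j' - 2)"]) blast
    qed
  qed
qed

end

section \<open>Lines on a smooth cubic\<close>

text \<open>Up to the factor 12 this is the coefficient of \<open>t^2\<close> on the left, while the
  right hand side is a multiple of \<open>t^4\<close>. The four values 1, -1, 2, -2 isolate
  it.\<close>

lemma linear_coeff_zero:
  fixes F :: complex
  assumes H: "\<And>t. 4 * (F + 3 * t * f1 + 3 * t^2 * f2 + t^3 * f3) * (t * A) = 3 * (t^2 * c)^2"
  shows "f1 * A = 0"
proof -
  have "4 * (F + 3 * f1 + 3 * f2 + f3) * A = 3 * (c * c)" "- 4 * (F - 3 * f1 + 3 * f2 - f3) * A = 3 * (c * c)"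
    using H[of 1] H[of "-1"] by (simp_all add: power2_eq_square power3_eq_cube algebra_simps)
  moreover have "8 * (F + 6 * f1 + 12 * f2 + 8 * f3) * A = 48 * (c * c)" "- 8 * (F - 6 * f1 + 12 * f2 - 8 * f3) * A = 48 * (c * c)"
    using H[of 2] H[of "-2"] by (simp_all add: power2_eq_square power3_eq_cube algebra_simps)
  ultimately show ?thesis by algebra
qed

text \<open>\<open>T p p\<close> is a third of the differential of the cubic at \<open>p\<close>,
  and its vanishing already puts \<open>p\<close> on the cubic. So the first assumption says that
  the cone is singular only along the radical.\<close>

locale smooth_cubic = cubic sc T
  for sc :: "complex \<Rightarrow> 'v::ab_group_add \<Rightarrow> 'v" (infixr "\<cdot>" 75) and T +
  assumes smooth: "(\<And>z. T p p z = 0) \<Longrightarrow> null p"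
    \<comment> \<open>the quotient by the radical has dimension at least five\<close>
    and four_linf: "linf f1 \<Longrightarrow> linf f2 \<Longrightarrow> linf f3 \<Longrightarrow> linf f4 \<Longrightarrow>
      \<exists>x. f1 x = 0 \<and> f2 x = 0 \<and> f3 x = 0 \<and> f4 x = 0 \<and> \<not> null x"
begin

definition indep :: "'v \<Rightarrow> 'v \<Rightarrow> bool" where
  "indep u v \<longleftrightarrow> (\<forall>s t. null (s \<cdot> u + t \<cdot> v) \<longrightarrow> s = 0 \<and> t = 0)"

lemma indepI:
  assumes "linf f" "f v = 0" "\<And>x. null x \<Longrightarrow> f x = 0" "f u \<noteq> 0" "\<not> null v"
  shows "indep u v"
  unfolding indep_def
proof (intro allI impI)
  fix s t assume n: "null (s \<cdot> u + t \<cdot> v)"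
  then have "s * f u = 0"
    using assms(3)[OF n] assms(1,2) by (simp add: linf_add linf_sc)
  then have "s = 0" using assms(4) by simp
  with n assms(5) null_sc[of t v] show "s = 0 \<and> t = 0" by auto
qed

lemma null_T3: "null x \<Longrightarrow> T a b x = 0" by (rule null_T)

text \<open>The second vector is taken in the kernel of a functional \<open>T a b\<close> that
  separates the first vector from the radical; this is the fourth linear condition.\<close>

lemma three_linf_indep:
  assumes "linf f1" "linf f2" "linf f3"
  shows "\<exists>u v. indep u v \<and> f1 u = 0 \<and> f2 u = 0 \<and> f3 u = 0 \<and> f1 v = 0 \<and> f2 v = 0 \<and> f3 v = 0"
proof -
  obtain u where u: "f1 u = 0" "f2 u = 0" "f3 u = 0" "\<not> null u"
    using four_linf[OF assms assms(3)] by blast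
  then obtain a b where "T a b u \<noteq> 0" unfolding null_def by (metis T_swap12 T_swap23)
  moreover obtain v where v: "f1 v = 0" "f2 v = 0" "f3 v = 0" "T a b v = 0" "\<not> null v"
    using four_linf[OF assms linf_T] by blast
  ultimately have "indep u v"
    by (intro indepI[OF linf_T]) (auto simp: null_T3)
  then show ?thesis using u v by blast
qed

text \<open>The three functionals are multiples \<open>a\<close>, \<open>b\<close>, \<open>c\<close>
  of \<open>g\<close>, so the differential at \<open>s \<cdot> u + t \<cdot> v\<close> is a binary
  quadratic form in \<open>(s, t)\<close> times \<open>g\<close>. A root of that form is a singular
  point.\<close>

lemma no_singular_pencil:
  assumes g: "linf g" and i: "indep u v"
    and ker: "\<And>x. g x = 0 \<Longrightarrow> T u u x = 0 \<and> T u v x = 0 \<and> T v v x = 0"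
  shows False
proof -
  have uv: "\<exists>c. \<forall>x. T y y' x = c * g x" if "\<And>x. g x = 0 \<Longrightarrow> T y y' x = 0" for y y'
  proof (cases "\<forall>x. g x = 0")
    case True
    then show ?thesis using that by auto
  next
    case False
    then obtain a where "g a \<noteq> 0" by blast
    then show ?thesis using linf_comb_eq[OF g linf_T that] by blast
  qed
  obtain a where a: "\<And>x. T u u x = a * g x" using uv[of u u] ker by blast
  obtain b where b: "\<And>x. T u v x = b * g x" using uv[of u v] ker by blast
  obtain c where c: "\<And>x. T v v x = c * g x" using uv[of v v] ker by blast
  obtain s t where st: "s \<noteq> 0 \<or> t \<noteq> 0" "a * s^2 + 2 * b * s * t + c * t^2 = 0"
    using binary_quadratic_root by blast
  have "T (s \<cdot> u + t \<cdot> v) (s \<cdot> u + t \<cdot> v) x = (a * s^2 + 2 * b * s * t + c * t^2) * g x" for x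
    unfolding T_lin T_swap12[of v u] a b c by (simp add: algebra_simps power2_eq_square)
  then have "null (s \<cdot> u + t \<cdot> v)" using st(2) smooth by simp
  then show False using i st(1) unfolding indep_def by blast
qed

text \<open>On \<open>T z z = 0\<close> modulo \<open>z\<close>, of dimension at least three, a line through \<open>z\<close> is a common zero of the
  quadratic form \<open>T z\<close> and the cubic form. Such a zero is found by projecting the conic from one of its
  points \<open>p\<close>, which parametrizes it by \<open>\<phi>\<close> and turns the cubic into a binary sextic.\<close>

lemma line_through:
  assumes z: "T z z z = 0" and f: "linf f" "f z \<noteq> 0"
  shows "\<exists>w. \<not> null w \<and> f w = 0 \<and> line w z"
proof -
  obtain y1 y2 where y: "indep y1 y2" "T z z y1 = 0" "f y1 = 0" "T z z y2 = 0" "f y2 = 0"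
    using three_linf_indep[OF linf_T f(1) f(1)] by blast
  obtain s t where st: "s \<noteq> 0 \<or> t \<noteq> 0" "T z y1 y1 * s^2 + 2 * T z y1 y2 * s * t + T z y2 y2 * t^2 = 0"
    using binary_quadratic_root by blast
  define p where "p = s \<cdot> y1 + t \<cdot> y2"
  have p: "\<not> null p" "T z z p = 0" "f p = 0" "T z p p = 0"
  proof -
    show "\<not> null p" using y(1) st(1) unfolding indep_def p_def by blast
    show "T z z p = 0" "f p = 0" unfolding p_def using y by (simp_all add: T_lin linf_add[OF f(1)] linf_sc[OF f(1)])
    show "T z p p = 0"
      using st(2) unfolding p_def T_lin T_swap23[of z y2 y1] by algebra
  qed
  obtain p1 p2 where pp: "T p1 p2 p \<noteq> 0" using p(1) unfolding null_def by (metis T_swap12 T_swap23)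
  \<comment> \<open>Directions are taken in the kernel of \<open>T p1 p2\<close>, which is nonzero
    at \<open>p\<close>; this keeps every \<open>D\<close> independent of \<open>p\<close>.\<close>
  obtain d1 d2 where d: "indep d1 d2" "T z z d1 = 0" "f d1 = 0" "T p1 p2 d1 = 0" "T z z d2 = 0" "f d2 = 0" "T p1 p2 d2 = 0"
    using three_linf_indep[OF linf_T f(1) linf_T] by blast
  define D where "D = (\<lambda>s t. s \<cdot> d1 + t \<cdot> d2)"
  define q where "q = (\<lambda>s t. T z (D s t) (D s t))"
  define P where "P = (\<lambda>s t. 2 * T z p (D s t))"
  \<comment> \<open>On the line through \<open>p\<close> in direction \<open>D\<close>, the point
    \<open>\<lambda> p + \<mu> D\<close> lies on the conic again if
    \<open>2 \<lambda> T z p D + \<mu> T z D D = 0\<close>.\<close>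
  define \<phi> where "\<phi> = (\<lambda>s t. (- q s t) \<cdot> p + P s t \<cdot> D s t)"
  have scl: "D s 1 = s \<cdot> D 1 (1 / s)" if "s \<noteq> 0" for s
    using that by (simp add: D_def scale_right_distrib)
  have phis: "\<phi> s 1 = s^2 \<cdot> \<phi> 1 (1 / s)" if "s \<noteq> 0" for s
    unfolding \<phi>_def q_def P_def scl[OF that] T_lin
    by (simp add: scale_right_distrib scale_right_diff_distrib power2_eq_square mult_ac)
  have "\<exists>s t. (s \<noteq> 0 \<or> t \<noteq> 0) \<and> T (\<phi> s t) (\<phi> s t) (\<phi> s t) = 0"
  proof (rule homogeneous_root[where m = 6])
    show "T (\<phi> s 1) (\<phi> s 1) (\<phi> s 1) = s^6 * T (\<phi> 1 (1 / s)) (\<phi> 1 (1 / s)) (\<phi> 1 (1 / s))" if "s \<noteq> 0" for s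
      unfolding phis[OF that] T_lin by (simp add: numeral_eq_Suc)
    show "polyfun (\<lambda>t. T (\<phi> 1 t) (\<phi> 1 t) (\<phi> 1 t))" "polyfun (\<lambda>s. T (\<phi> s 1) (\<phi> s 1) (\<phi> s 1))"
      unfolding \<phi>_def q_def P_def D_def T_lin by (intro polyfun_intros)+
  qed simp
  then obtain s t where st: "s \<noteq> 0 \<or> t \<noteq> 0" and c: "T (\<phi> s t) (\<phi> s t) (\<phi> s t) = 0" by blast
  define e where "e = D s t"
  have e: "\<not> null e" "T z z e = 0" "f e = 0" "T p1 p2 e = 0"
    using d st unfolding e_def D_def indep_def by (auto simp: T_lin linf_add[OF f(1)] linf_sc[OF f(1)])
  define a b where "a = - T z e e" and "b = 2 * T z p e"
  have phi: "\<phi> s t = a \<cdot> p + b \<cdot> e" by (simp add: \<phi>_def q_def P_def e_def a_def b_def)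
  show ?thesis
  proof (cases "null (\<phi> s t)")
    case False
    have "T z (\<phi> s t) (\<phi> s t) = 0"
      unfolding phi T_lin T_swap23[of z e p] using p(4) unfolding a_def b_def by algebra
    moreover have "T z z (\<phi> s t) = 0" "f (\<phi> s t) = 0"
      unfolding phi using p e by (simp_all add: T_lin linf_add[OF f(1)] linf_sc[OF f(1)])
    ultimately show ?thesis
      using False z c unfolding line_def by (metis T_swap12 T_swap23)
  next
    \<comment> \<open>Both coefficients of \<open>\<phi>\<close> vanish, so the whole line joining
      \<open>p\<close> and \<open>e\<close> lies in the conic, and a zero of the cubic on this line
      is enough.\<close>
    case True
    have "a * T p1 p2 p = 0" using null_T3[OF True, of p1 p2] e(4) unfolding phi T_lin by simp
    then have a0: "a = 0" using pp by simp
    then have "null (b \<cdot> e)" using True unfolding phi by simp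
    then have b0: "b = 0" using e(1) null_sc by blast
    obtain s' t' where st': "s' \<noteq> 0 \<or> t' \<noteq> 0"
        "T p p p * s'^3 + 3 * T p p e * s'^2 * t' + 3 * T p e e * s' * t'^2 + T e e e * t'^3 = 0"
      using binary_cubic_root by blast
    define w where "w = s' \<cdot> p + t' \<cdot> e"
    have "indep p e"
      using pp e by (intro indepI[OF linf_T[of p1 p2]]) (auto simp: null_T3)
    then have "\<not> null w" using st'(1) unfolding w_def indep_def by blast
    moreover have "T z w w = 0"
      unfolding w_def T_lin T_swap23[of z e p] using a0 b0 p(4) unfolding a_def b_def by simp
    moreover have "T z z w = 0" "f w = 0"
      unfolding w_def using p e by (simp_all add: T_lin linf_add[OF f(1)] linf_sc[OF f(1)])
    moreover have "T w w w = 0"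
    proof -
      have perm: "T p e p = T p p e" "T e p p = T p p e" "T e p e = T p e e" "T e e p = T p e e"
        by (metis T_swap12 T_swap23)+
      show ?thesis using st'(2) unfolding w_def T_lin perm by algebra
    qed
    ultimately show ?thesis
      using z unfolding line_def by (metis T_swap12 T_swap23)
  qed
qed

text \<open>By \<open>eq\<close> the conic restricted to the span of \<open>x\<close> and
  \<open>w\<close> is a square up to a scalar. Where \<open>T w w y = 0\<close> on
  \<open>g = 0\<close>, this forces \<open>T w y y = 0\<close>, and polarization gives
  \<open>T w y x = 0\<close> for \<open>y\<close> in \<open>K\<close> and \<open>g x = 0\<close>.
  Expanding \<open>eq\<close> at such a \<open>y\<close> then yields \<open>T y y x = 0\<close>.
  Since \<open>K\<close> is cut out by three linear conditions, \<open>no_singular_pencil\<close>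
  applies to it.\<close>

lemma no_double_component:
  assumes g: "linf g" and i: "indep p w"
    and pp: "\<And>x. g x = 0 \<Longrightarrow> T p p x = 0" and pw: "\<And>x. g x = 0 \<Longrightarrow> T p w x = 0"
    and eq: "\<And>x. g x = 0 \<Longrightarrow> 4 * T x x x * T w w x = 3 * (T w x x)^2"
  shows False
proof (cases "\<forall>x. g x = 0 \<longrightarrow> T w w x = 0")
  case True
  then show False using no_singular_pencil[OF g i] pp pw by blast
next
  case False
  then obtain z0 where z0: "g z0 = 0" "T w w z0 \<noteq> 0" by blast
  note glin = linf_add[OF g] linf_sc[OF g]
  \<comment> \<open>The last condition supplies the direction \<open>z0\<close> that polarization
    inside the kernel of \<open>T w w\<close> cannot reach.\<close>
  define K where "K = (\<lambda>y. g y = 0 \<and> T w w y = 0 \<and> T w z0 y = 0)"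
  have wyy: "T w y y = 0" if "g y = 0" "T w w y = 0" for y
    using eq[OF that(1)] that(2) by simp
  have wyx: "T w y x = 0" if y: "K y" and x: "g x = 0" for x y
  proof -
    have *: "T w y x' = 0" if "g x' = 0" "T w w x' = 0" for x'
    proof -
      have "T w (y + x') (y + x') = 0"
        using y that unfolding K_def by (intro wyy) (auto simp: glin T_lin)
      then show ?thesis
        using wyy[OF that] wyy[of y] y T_swap23[of w x' y] unfolding K_def T_lin by simp
    qed
    let ?x = "x - (T w w x / T w w z0) \<cdot> z0"
    have "T w y ?x = 0"
      using x z0 by (intro *) (auto simp: linf_diff[OF g] glin T_diff T_lin)
    then show ?thesis using y T_swap23[of w y z0] unfolding K_def T_diff T_lin by simp
  qed
  have yyx: "T y y x = 0" if y: "K y" and x: "g x = 0" "T w w x \<noteq> 0" for x y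
  proof -
    have "4 * (T y y y + 3 * t * T y y x + 3 * t^2 * T y x x + t^3 * T x x x) * (t * T w w x)
        = 3 * (t^2 * T w x x)^2" for t
    proof -
      have "4 * T (y + t \<cdot> x) (y + t \<cdot> x) (y + t \<cdot> x) * T w w (y + t \<cdot> x) = 3 * (T w (y + t \<cdot> x) (y + t \<cdot> x))^2"
        using y x by (intro eq) (auto simp: K_def glin)
      moreover have z: "T w w y = 0" "T w y y = 0" "T w y x = 0" "T w x y = 0"
        using y wyy[of y] wyx[OF y x(1)] T_swap23[of w x y] unfolding K_def by simp_all
      moreover have perm: "T y x y = T y y x" "T x y y = T y y x" "T x x y = T y x x" "T x y x = T y x x"
        by (metis T_swap12 T_swap23)+
      ultimately have "4 * T (y + t \<cdot> x) (y + t \<cdot> x) (y + t \<cdot> x) * (t * T w w x) = 3 * (t * (t * T w x x))^2"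
        unfolding T_lin z by simp
      then show ?thesis unfolding T_lin perm by algebra
    qed
    then have "T y y x * T w w x = 0" by (rule linear_coeff_zero)
    then show ?thesis using x(2) by simp
  qed
  have yy: "T y y x = 0" if y: "K y" and x: "g x = 0" for x y
  proof (cases "T w w x = 0")
    case True
    then have "T y y (x + z0) = 0" using y x z0 by (intro yyx) (auto simp: glin T_lin)
    then show ?thesis using yyx[OF y z0] by (simp add: T_lin)
  qed (use yyx[OF y x] in blast)
  obtain u v where uv: "indep u v" "K u" "K v"
    using three_linf_indep[OF g linf_T[of w w] linf_T[of w z0]] unfolding K_def by blast
  have "T u v x = 0" if "g x = 0" for x
  proof -
    have "T (u + v) (u + v) x = 0"
      using uv that by (intro yy) (auto simp: K_def glin T_lin)
    then show ?thesis using yy[OF uv(2) that] yy[OF uv(3) that] T_swap12[of v u x] unfolding T_lin by simp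
  qed
  then show False
    using no_singular_pencil[OF g uv(1)] yy uv(2,3) by blast
qed

text \<open>Jacobi's formula for the derivative of a determinant: the coefficients are cofactors of
  the Gram matrix, up to constants.\<close>

definition disc_deriv :: "'v \<Rightarrow> 'v \<Rightarrow> 'v \<Rightarrow> 'v \<Rightarrow> complex" where
  "disc_deriv w z x y =
     12 * (T w w x * T z z x - (T w z x)^2) * T x x y
     - 12 * (T w x x * T z z x - T z x x * T w z x) * T w x y
     + 12 * (T w x x * T w z x - T z x x * T w w x) * T z x y
     + (4 * T x x x * T z z x - 3 * (T z x x)^2) * T w w y
     - 2 * (4 * T x x x * T w z x - 3 * T w x x * T z x x) * T w z y
     + (4 * T x x x * T w w x - 3 * (T w x x)^2) * T z z y"

lemma disc_DERIV: "((\<lambda>t. disc w z (x + t \<cdot> y)) has_field_derivative disc_deriv w z x y) (at 0)"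
proof -
  have perm: "T x y x = T x x y" "T y x x = T x x y" "T w y x = T w x y" "T z y x = T z x y"
    by (metis T_swap12 T_swap23)+
  have d: "((\<lambda>t. T (x + t \<cdot> y) (x + t \<cdot> y) (x + t \<cdot> y)) has_field_derivative 3 * T x x y) (at 0)"
    "((\<lambda>t. T w (x + t \<cdot> y) (x + t \<cdot> y)) has_field_derivative 2 * T w x y) (at 0)"
    "((\<lambda>t. T z (x + t \<cdot> y) (x + t \<cdot> y)) has_field_derivative 2 * T z x y) (at 0)"
    "((\<lambda>t. T a b (x + t \<cdot> y)) has_field_derivative T a b y) (at 0)" for a b
    unfolding T_lin perm by (auto intro!: derivative_eq_intros simp: T_lin perm)
  show ?thesis
    unfolding disc_def
    by (rule derivative_eq_intros d refl)+ (simp add: disc_deriv_def algebra_simps power2_eq_square)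
qed

text \<open>At a degenerate conic of rank two, with vertex \<open>p\<close>, the derivative of the discriminant in direction \<open>y\<close> is
  a nonzero multiple of \<open>T p p y\<close>; if it vanishes for all \<open>y\<close> then \<open>p\<close> is a singular point of the cubic.\<close>

lemma minors_vanish:
  assumes l: "line w z" and i: "indep w z" and d0: "disc w z x = 0" and dd: "\<And>y. disc_deriv w z x y = 0"
  shows "T w w x * T z z x = (T w z x)^2"
    and "4 * T x x x * T w w x = 3 * (T w x x)^2"
    and "4 * T x x x * T z z x = 3 * (T z x x)^2"
    and "4 * T x x x * T w z x = 3 * T w x x * T z x x"
proof -
  define F where "F = T x x x" define b where "b = T w x x" define e where "e = T z x x"
  define A where "A = T w w x" define B where "B = T w z x" define C where "C = T z z x"
  note defs = F_def b_def e_def A_def B_def C_def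
  \<comment> \<open>One third of the cofactors of the Gram matrix. With this factor the derivative
    of \<open>disc\<close> in direction \<open>y\<close> is exactly their contraction with the
    quadratic form \<open>T p p y\<close> in the coordinates of \<open>p\<close>.\<close>
  define c11 where "c11 = 12 * (A * C - B^2)" define c12 where "c12 = - 6 * (b * C - e * B)"
  define c13 where "c13 = 6 * (b * B - e * A)" define c22 where "c22 = 4 * F * C - 3 * e^2"
  define c23 where "c23 = - (4 * F * B - 3 * b * e)" define c33 where "c33 = 4 * F * A - 3 * b^2"
  note cdefs = c11_def c12_def c13_def c22_def c23_def c33_def
  have D: "4 * F * (A * C - B^2) - 3 * (b^2 * C - 2 * b * e * B + e^2 * A) = 0"
    using d0 unfolding disc_def defs by simp
  \<comment> \<open>The determinant vanishes, so the matrix of cofactors has rank at most one, and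
    its nonzero rows are multiples of the vertex.\<close>
  have rel: "c12^2 = c11 * c22" "c13^2 = c11 * c33" "c12 * c13 = c11 * c23"
      "c12 * c23 = c13 * c22" "c13 * c23 = c12 * c33" "c23^2 = c22 * c33"
    using D unfolding cdefs by algebra+
  have T2: "T (r \<cdot> x + s \<cdot> w + t \<cdot> z) (r \<cdot> x + s \<cdot> w + t \<cdot> z) y
      = r^2 * T x x y + 2 * r * s * T w x y + 2 * r * t * T z x y + s^2 * T w w y + 2 * s * t * T w z y + t^2 * T z z y" for r s t y
  proof -
    have perm: "T x w y = T w x y" "T x z y = T z x y" "T z w y = T w z y" by (metis T_swap12)+
    show ?thesis unfolding T_lin perm by (simp add: algebra_simps power2_eq_square)
  qed
  have dd': "c11 * f + 2 * c12 * b' + 2 * c13 * e' + c22 * A' + 2 * c23 * B' + c33 * C' = 0"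
    if "f = T x x y" "b' = T w x y" "e' = T z x y" "A' = T w w y" "B' = T w z y" "C' = T z z y" for f b' e' A' B' C' y
    using dd[of y] unfolding disc_deriv_def defs[symmetric] that[symmetric] cdefs by algebra
  \<comment> \<open>If the products of the coordinates of \<open>p\<close> are a common multiple of
    the cofactors, then \<open>T p p y\<close> is that multiple of the derivative of
    \<open>disc\<close>, hence 0 for all \<open>y\<close>.\<close>
  have null: "null (r \<cdot> x + s \<cdot> w + t \<cdot> z)"
    if "r^2 = c * c11" "r * s = c * c12" "r * t = c * c13" "s^2 = c * c22" "s * t = c * c23" "t^2 = c * c33" for r s t c
  proof (rule smooth)
    fix y
    have "T (r \<cdot> x + s \<cdot> w + t \<cdot> z) (r \<cdot> x + s \<cdot> w + t \<cdot> z) y = c * (c11 * T x x y + 2 * c12 * T w x y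
        + 2 * c13 * T z x y + c22 * T w w y + 2 * c23 * T w z y + c33 * T z z y)"
      unfolding T2 using that by algebra
    then show "T (r \<cdot> x + s \<cdot> w + t \<cdot> z) (r \<cdot> x + s \<cdot> w + t \<cdot> z) y = 0"
      using dd'[OF refl refl refl refl refl refl, of y] by simp
  qed
  have "c11 = 0"
  proof (rule ccontr)
    \<comment> \<open>Pairing the null vector with the line sees only its coordinate
      \<open>c11\<close> along \<open>x\<close>. Hence \<open>A = B = C = 0\<close>, and the minor
      \<open>c11\<close> vanishes after all.\<close>
    assume ne: "c11 \<noteq> 0"
    have n: "null (c11 \<cdot> x + c12 \<cdot> w + c13 \<cdot> z)"
      by (rule null[of _ c11]) (use rel in \<open>simp_all add: power2_eq_square mult_ac\<close>)
    have z: "T w w w = 0" "T w w z = 0" "T w z w = 0" "T w z z = 0" "T z z w = 0" "T z z z = 0"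
      using l unfolding line_def by (metis T_swap12 T_swap23)+
    have "c11 * A = 0" "c11 * B = 0" "c11 * C = 0"
      using null_T3[OF n, of w w] null_T3[OF n, of w z] null_T3[OF n, of z z]
      unfolding T_lin z defs by simp_all
    then have "A = 0" "B = 0" "C = 0" using ne by simp_all
    then show False using ne by (simp add: c11_def)
  qed
  then have c1: "c12 = 0" "c13 = 0" using rel(1,2) by simp_all
  have c2: "c22 = 0" "c33 = 0"
  proof -
    have "null (0 \<cdot> x + c22 \<cdot> w + c23 \<cdot> z)"
      by (rule null[of _ c22]) (use rel \<open>c11 = 0\<close> c1 in \<open>simp_all add: power2_eq_square mult_ac\<close>)
    then show "c22 = 0" using i unfolding indep_def by simp
    have "null (0 \<cdot> x + c23 \<cdot> w + c33 \<cdot> z)"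
      by (rule null[of _ c33]) (use rel \<open>c11 = 0\<close> c1 in \<open>simp_all add: power2_eq_square mult_ac\<close>)
    then show "c33 = 0" using i unfolding indep_def by simp
  qed
  then have "c23 = 0" using rel(6) by simp
  then show "A * C = B^2" "4 * F * A = 3 * b^2" "4 * F * C = 3 * e^2" "4 * F * B = 3 * b * e"
    using \<open>c11 = 0\<close> c2 unfolding cdefs by simp_all
qed

text \<open>By the first minor, on \<open>g = 0\<close> the forms \<open>T w z\<close> and
  \<open>T z z\<close> are \<open>k\<close> and \<open>k^2\<close> times \<open>T w w\<close> unless
  \<open>T w w\<close> is zero there. So \<open>p = z - k \<cdot> w\<close> satisfies
  \<open>T p p = T p w = 0\<close> on \<open>g = 0\<close>. If \<open>T w w\<close> is zero there,
  \<open>w\<close> takes the role of \<open>p\<close> and \<open>z\<close> that of \<open>w\<close>.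
  Either way \<open>no_double_component\<close> applies.\<close>

lemma no_vanishing_minors:
  assumes g: "linf g" and l: "line w z" and i: "indep w z"
    and m: "\<And>x. g x = 0 \<Longrightarrow> T w w x * T z z x = (T w z x)^2"
      "\<And>x. g x = 0 \<Longrightarrow> 4 * T x x x * T w w x = 3 * (T w x x)^2"
      "\<And>x. g x = 0 \<Longrightarrow> 4 * T x x x * T z z x = 3 * (T z x x)^2"
  shows False
proof (cases "\<forall>x. g x = 0 \<longrightarrow> T w w x = 0")
  case True
  show False
    by (rule no_double_component[OF g i]) (use True m in auto)
next
  case False
  then obtain x0 where x0: "g x0 = 0" "T w w x0 \<noteq> 0" by blast
  define k where "k = T w z x0 / T w w x0"
  note glin = linf_add[OF g] linf_sc[OF g] linf_diff[OF g]
  have B: "T w z x = k * T w w x" if x: "g x = 0" for x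
  proof -
    let ?y = "x - (T w w x / T w w x0) \<cdot> x0"
    have "g ?y = 0" "T w w ?y = 0" using x x0 by (auto simp: glin T_diff T_lin)
    then have "T w z ?y = 0" using m(1) by fastforce
    then show ?thesis by (simp add: T_diff T_lin k_def)
  qed
  have C: "T z z x = k^2 * T w w x" if x: "g x = 0" for x
  proof -
    have *: "T z z x = k^2 * T w w x" if "g x = 0" "T w w x \<noteq> 0" for x
      using m(1)[OF that(1)] that(2) unfolding B[OF that(1)] by (simp add: power2_eq_square)
    show ?thesis
    proof (cases "T w w x = 0")
      case True
      then have "T z z (x + x0) = k^2 * T w w (x + x0)" using x x0 by (intro *) (auto simp: glin T_lin)
      then show ?thesis using *[OF x0] True by (simp add: T_lin)
    qed (use * x in blast)
  qed
  have perm: "T z w x = T w z x" for x by (rule T_swap12)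
  have i': "indep (z - k \<cdot> w) w"
    unfolding indep_def
  proof (intro allI impI)
    fix s t assume "null (s \<cdot> (z - k \<cdot> w) + t \<cdot> w)"
    moreover have "s \<cdot> (z - k \<cdot> w) + t \<cdot> w = (t - s * k) \<cdot> w + s \<cdot> z"
      by (simp add: scale_right_diff_distrib scale_left_diff_distrib)
    ultimately have "t - s * k = 0 \<and> s = 0" using i unfolding indep_def by metis
    then show "s = 0 \<and> t = 0" by auto
  qed
  show False
  proof (rule no_double_component[OF g i'])
    fix x assume x: "g x = 0"
    show "T (z - k \<cdot> w) (z - k \<cdot> w) x = 0" "T (z - k \<cdot> w) w x = 0" 
      unfolding T_diff T_lin perm B[OF x] C[OF x] by (simp_all add: power2_eq_square)
    show "4 * T x x x * T w w x = 3 * (T w x x)^2" by (rule m(2)[OF x])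
  qed
qed

text \<open>The inequality says that no nonzero combination of \<open>u\<close> and \<open>v\<close>
  lies in the common kernel \<open>W\<close> of \<open>\<alpha>\<close> and \<open>\<beta>\<close>;
  in particular \<open>u\<close> and \<open>v\<close> are independent.\<close>

theorem exists_line_off_codim_2:
  assumes a: "linf \<alpha>" "\<And>x. null x \<Longrightarrow> \<alpha> x = 0" and b: "linf \<beta>" "\<And>x. null x \<Longrightarrow> \<beta> x = 0"
    and ind: "\<And>s t. (\<And>x. s * \<alpha> x + t * \<beta> x = 0) \<Longrightarrow> s = 0 \<and> t = 0"
  shows "\<exists>u v. line u v \<and> \<alpha> u * \<beta> v \<noteq> \<alpha> v * \<beta> u"
proof (rule ccontr)
  assume "\<not> ?thesis"
  then have meets: "\<alpha> u * \<beta> v = \<alpha> v * \<beta> u" if "line u v" for u v using that by blast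
  have alin: "\<alpha> (x + y) = \<alpha> x + \<alpha> y" "\<alpha> (c \<cdot> x) = c * \<alpha> x" "\<beta> (x + y) = \<beta> x + \<beta> y" "\<beta> (c \<cdot> x) = c * \<beta> x" for x y c
    using a(1) b(1) by (simp_all add: linf_def)
  obtain x where x: "\<alpha> x \<noteq> 0" using ind[of 1 0] by auto
  obtain y where y: "\<alpha> x * \<beta> y - \<beta> x * \<alpha> y \<noteq> 0" using ind[of "- \<beta> x" "\<alpha> x"] x by (auto simp: algebra_simps)
  \<comment> \<open>\<open>(\<alpha>, \<beta>)\<close> is injective on the span of \<open>x\<close>
    and \<open>y\<close>, so a point of the cubic on the line joining them lies off
    \<open>W\<close>.\<close>
  obtain s t where st: "s \<noteq> 0 \<or> t \<noteq> 0"
      "T x x x * s^3 + 3 * T x x y * s^2 * t + 3 * T x y y * s * t^2 + T y y y * t^3 = 0"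
    using binary_cubic_root by blast
  define z where "z = s \<cdot> x + t \<cdot> y"
  have z: "T z z z = 0"
  proof -
    have perm: "T x y x = T x x y" "T y x x = T x x y" "T y x y = T x y y" "T y y x = T x y y"
      by (metis T_swap12 T_swap23)+
    show ?thesis using st(2) unfolding z_def T_lin perm by algebra
  qed
  have ab: "\<alpha> z \<noteq> 0 \<or> \<beta> z \<noteq> 0"
  proof (rule ccontr)
    assume "\<not> ?thesis"
    then have "s * \<alpha> x + t * \<alpha> y = 0" "s * \<beta> x + t * \<beta> y = 0" unfolding z_def alin by simp_all
    then have "s * (\<alpha> x * \<beta> y - \<beta> x * \<alpha> y) = 0" "t * (\<alpha> x * \<beta> y - \<beta> x * \<alpha> y) = 0" by algebra+
    then show False using y st(1) by simp
  qed
  \<comment> \<open>\<open>line_through\<close> arranges the vanishing at \<open>w\<close> of one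
    functional that is nonzero at \<open>z\<close>. As the line meets \<open>W\<close>, the other
    one vanishes at \<open>w\<close> too.\<close>
  obtain w where w: "\<not> null w" "\<alpha> w = 0" "\<beta> w = 0" "line w z"
  proof (cases "\<alpha> z = 0")
    case False
    then obtain w where "\<not> null w" "\<alpha> w = 0" "line w z" using line_through[OF z a(1)] by blast
    then show ?thesis using that[of w] meets[of w z] False by auto
  next
    case True
    then obtain w where "\<not> null w" "\<beta> w = 0" "line w z" using line_through[OF z b(1)] ab by blast
    then show ?thesis using that[of w] meets[of w z] True ab by auto
  qed
  have i: "indep w z"
    unfolding indep_def
  proof (intro allI impI)
    fix s t assume n: "null (s \<cdot> w + t \<cdot> z)"
    then have "t * \<alpha> z = 0" "t * \<beta> z = 0" using a(2)[OF n] b(2)[OF n] w unfolding alin by simp_all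
    then have "t = 0" using ab by auto
    then show "s = 0 \<and> t = 0" using n null_sc[of s w] w(1) by auto
  qed
  \<comment> \<open>The equation of the hyperplane spanned by the line and \<open>W\<close>: it
    kills \<open>w\<close>, \<open>z\<close> and all of \<open>W\<close>.\<close>
  define h where "h = (\<lambda>x. \<alpha> z * \<beta> x + (- \<beta> z) * \<alpha> x)"
  have lh: "linf h" unfolding h_def by (intro linf_comb a b)
  have "\<not> (\<forall>x. h x = 0)" using ind[of "- \<beta> z" "\<alpha> z"] ab unfolding h_def by (auto simp: add.commute)
  then obtain q where q: "h q \<noteq> 0" by blast
  obtain p where p: "T w w p \<noteq> 0" using w(1) smooth by blast
  have key: "T w w x = 0" if hx: "h x \<noteq> 0" and d: "disc w z x = 0" for x
  proof (rule ccontr)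
    assume "T w w x \<noteq> 0"
    then obtain r s t r' s' t' where r: "r * t' - r' * t \<noteq> 0"
      and l: "line (r \<cdot> x + s \<cdot> w + t \<cdot> z) (r' \<cdot> x + s' \<cdot> w + t' \<cdot> z)"
      using residual_line[OF w(4) d] by blast
    \<comment> \<open>The residual line must meet \<open>W\<close> as well, but for
      \<open>h x \<noteq> 0\<close> the plane meets \<open>W\<close> only in \<open>w\<close>, which
      this line avoids.\<close>
    have "(r * t' - r' * t) * h x = 0"
      using meets[OF l] w unfolding alin h_def by simp algebra
    then show False using r hx by simp
  qed
  obtain g R where gR: "g = T w w \<or> g = h" "\<And>x. disc w z x = g x ^ 2 * R x" "\<And>x y. polyfun (\<lambda>t. R (x + t \<cdot> y))"
    using quintic_factor[of "disc w z" "T w w" h p q, OF disc_polyfun disc_scale linf_T lh p q key] by blast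
  have lg: "linf g" using gR(1) lh by auto
  have dd: "disc_deriv w z x y = 0" if x: "g x = 0" for x y
  proof -
    have "(\<lambda>t. R (x + t \<cdot> y)) field_differentiable at 0" by (rule polyfun_differentiable[OF gR(3)])
    then obtain D where D: "((\<lambda>t. R (x + t \<cdot> y)) has_field_derivative D) (at 0)" unfolding field_differentiable_def by blast
    have "((\<lambda>t. (t * g y)^2 * R (x + t \<cdot> y)) has_field_derivative 0) (at 0)"
      by (rule derivative_eq_intros D refl)+ simp
    then have "((\<lambda>t. disc w z (x + t \<cdot> y)) has_field_derivative 0) (at 0)"
      unfolding gR(2) linf_add[OF lg] linf_sc[OF lg] x by simp
    then show ?thesis using DERIV_unique disc_DERIV by blast
  qed
  have d0: "disc w z x = 0" if "g x = 0" for x using gR(2) that by simp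
  show False
    by (rule no_vanishing_minors[OF lg w(4) i]) (rule minors_vanish[OF w(4) i d0 dd]; assumption)+
qed

end

section \<open>Linear algebra and cubic forms\<close>

lemma underdetermined_system:
  fixes a :: "'i \<Rightarrow> 'j \<Rightarrow> complex"
  assumes "finite I" "finite J" "card I < card J"
  shows "\<exists>x. (\<exists>j\<in>J. x j \<noteq> 0) \<and> (\<forall>i\<in>I. (\<Sum>j\<in>J. a i j * x j) = 0)"
  using assms
proof (induction I arbitrary: J a rule: finite_induct)
  case empty
  then obtain j where "j \<in> J" by fastforce
  then show ?case by (intro exI[of _ "\<lambda>_. 1"]) auto
next
  case (insert i0 I)
  show ?case
  proof (cases "\<forall>j\<in>J. a i0 j = 0")
    case True
    then show ?thesis using insert.IH[of J a] insert.prems insert.hyps by auto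
  next
    case False
    then obtain j0 where j0: "j0 \<in> J" "a i0 j0 \<noteq> 0" by blast
    define b where "b = (\<lambda>i j. a i j - a i j0 / a i0 j0 * a i0 j)"
    obtain x where x: "\<exists>j\<in>J - {j0}. x j \<noteq> 0" "\<forall>i\<in>I. (\<Sum>j\<in>J - {j0}. b i j * x j) = 0"
    proof -
      have "card I < card (J - {j0})" using insert.prems insert.hyps j0 by simp
      then show ?thesis using that insert.IH[of "J - {j0}" b] insert.prems by blast
    qed
    define y where "y = x(j0 := - (\<Sum>j\<in>J - {j0}. a i0 j * x j) / a i0 j0)"
    have s: "(\<Sum>j\<in>J. a i j * y j) = a i j0 * y j0 + (\<Sum>j\<in>J - {j0}. a i j * x j)" for i
      using j0 insert.prems by (simp add: sum.remove[of J j0] y_def)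
    have "(\<Sum>j\<in>J. a i j * y j) = 0" if "i \<in> insert i0 I" for i
    proof (cases "i = i0")
      case True
      then show ?thesis unfolding s using j0 by (simp add: y_def)
    next
      case False
      then have "(\<Sum>j\<in>J - {j0}. b i j * x j) = 0" using x(2) that by blast
      then have "(\<Sum>j\<in>J - {j0}. a i j * x j) = a i j0 / a i0 j0 * (\<Sum>j\<in>J - {j0}. a i0 j * x j)"
        unfolding b_def by (simp add: left_diff_distrib sum_subtractf sum_distrib_left mult.assoc)
      then show ?thesis unfolding s using j0 by (simp add: y_def)
    qed
    moreover have "\<exists>j\<in>J. y j \<noteq> 0" using x(1) by (auto simp: y_def)
    ultimately show ?thesis by blast
  qed
qed

text \<open>Finite-dimensional duality in coordinates, by eliminating one coordinate with a pivot.
  It allows domination to be checked on covectors.\<close>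

lemma span_if_no_annihilator:
  fixes V :: "'j \<Rightarrow> 'i \<Rightarrow> complex"
  assumes "finite I" "finite J"
    and "\<And>c. (\<And>j. j \<in> J \<Longrightarrow> (\<Sum>i\<in>I. c i * V j i) = 0) \<Longrightarrow> \<forall>i\<in>I. c i = 0"
  shows "\<exists>e. \<forall>i\<in>I. (\<Sum>j\<in>J. e j * V j i) = y i"
  using assms(1,3)
proof (induction I arbitrary: V y rule: finite_induct)
  case empty
  then show ?case by simp
next
  case (insert i0 I)
  have sins: "(\<Sum>i\<in>insert i0 I. f i) = f i0 + (\<Sum>i\<in>I. f i)" for f :: "'i \<Rightarrow> complex"
    using insert.hyps by simp
  have "\<exists>j\<in>J. V j i0 \<noteq> 0"
  proof (rule ccontr)
    assume "\<not> ?thesis"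
    then have "\<forall>i\<in>insert i0 I. (if i = i0 then 1 else 0::complex) = 0"
      by (intro insert.prems) (use insert.hyps in \<open>auto simp: sins intro!: sum.neutral\<close>)
    then show False by simp
  qed
  then obtain j0 where j0: "j0 \<in> J" "V j0 i0 \<noteq> 0" by blast
  define W where "W = (\<lambda>j i. V j i - V j i0 / V j0 i0 * V j0 i)"
  have "\<forall>i\<in>I. c i = 0" if c: "\<And>j. j \<in> J \<Longrightarrow> (\<Sum>i\<in>I. c i * W j i) = 0" for c
  proof -
    define d where "d = c(i0 := - (\<Sum>i\<in>I. c i * V j0 i) / V j0 i0)"
    have d: "(\<Sum>i\<in>I. d i * f i) = (\<Sum>i\<in>I. c i * f i)" for f
      using insert.hyps by (intro sum.cong) (auto simp: d_def)
    have "\<forall>i\<in>insert i0 I. d i = 0"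
    proof (rule insert.prems)
      fix j assume "j \<in> J"
      then have "(\<Sum>i\<in>I. c i * V j i) = V j i0 / V j0 i0 * (\<Sum>i\<in>I. c i * V j0 i)"
        using c[of j] by (simp add: W_def right_diff_distrib sum_subtractf sum_distrib_left mult_ac)
      then show "(\<Sum>i\<in>insert i0 I. d i * V j i) = 0"
        unfolding sins d using j0 by (simp add: d_def)
    qed
    then show ?thesis using insert.hyps unfolding d_def by (metis fun_upd_other insertCI)
  qed
  then obtain e where e: "\<forall>i\<in>I. (\<Sum>j\<in>J. e j * W j i) = y i - y i0 / V j0 i0 * V j0 i"
    using insert.IH[of W "\<lambda>i. y i - y i0 / V j0 i0 * V j0 i"] by blast
  define E where "E = (\<Sum>j\<in>J. e j * (V j i0 / V j0 i0))"
  define f where "f = (\<lambda>j. e j + (if j = j0 then y i0 / V j0 i0 - E else 0))"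
  have f: "(\<Sum>j\<in>J. f j * V j i) = (\<Sum>j\<in>J. e j * V j i) + (y i0 / V j0 i0 - E) * V j0 i" for i
    unfolding f_def using assms(2) j0
    by (simp add: distrib_right sum.distrib if_distrib[of "\<lambda>x. x * _"] sum.delta cong: if_cong)
  have "(\<Sum>j\<in>J. f j * V j i) = y i" if "i \<in> insert i0 I" for i
  proof (cases "i = i0")
    case True
    have "(\<Sum>j\<in>J. e j * V j i0) = E * V j0 i0"
      unfolding E_def sum_distrib_right using j0 by (intro sum.cong) auto
    then show ?thesis unfolding True f using j0 by (simp add: left_diff_distrib)
  next
    case False
    then have "(\<Sum>j\<in>J. e j * W j i) = y i - y i0 / V j0 i0 * V j0 i" using e that by blast
    moreover have "(\<Sum>j\<in>J. e j * W j i) = (\<Sum>j\<in>J. e j * V j i) - E * V j0 i"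
      unfolding W_def E_def sum_distrib_right right_diff_distrib sum_subtractf by (simp add: mult_ac)
    ultimately show ?thesis unfolding f by (simp add: algebra_simps)
  qed
  then show ?case by blast
qed

text \<open>Some finite subfamily has the same span, phrased through annihilators; this is what
  reduces all lines to finitely many. Each coordinate that is not identically zero contributes a
  pivot \<open>p0\<close> to \<open>Q\<close>.\<close>

lemma finite_annihilating_subset:
  fixes V :: "'p \<Rightarrow> 'i \<Rightarrow> complex"
  assumes "finite I"
  shows "\<exists>Q\<subseteq>P. finite Q \<and> (\<forall>c. (\<forall>p\<in>Q. (\<Sum>i\<in>I. c i * V p i) = 0) \<longrightarrow> (\<forall>p\<in>P. (\<Sum>i\<in>I. c i * V p i) = 0))"
  using assms
proof (induction I arbitrary: V rule: finite_induct)
  case empty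
  then show ?case by (intro exI[of _ "{}"]) auto
next
  case (insert i0 I)
  have sins: "(\<Sum>i\<in>insert i0 I. f i) = f i0 + (\<Sum>i\<in>I. f i)" for f :: "'i \<Rightarrow> complex"
    using insert.hyps by simp
  show ?case
  proof (cases "\<forall>p\<in>P. V p i0 = 0")
    case True
    obtain Q where Q: "Q \<subseteq> P" "finite Q" "\<And>c. (\<forall>p\<in>Q. (\<Sum>i\<in>I. c i * V p i) = 0) \<Longrightarrow> \<forall>p\<in>P. (\<Sum>i\<in>I. c i * V p i) = 0"
      using insert.IH[of V] by blast
    have "\<forall>p\<in>P. (\<Sum>i\<in>insert i0 I. c i * V p i) = 0" if "\<forall>p\<in>Q. (\<Sum>i\<in>insert i0 I. c i * V p i) = 0" for c
    proof -
      have "\<forall>p\<in>Q. (\<Sum>i\<in>I. c i * V p i) = 0" using that Q(1) True unfolding sins by (metis add_0 mult_zero_right subset_iff)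
      from Q(3)[OF this] True show ?thesis unfolding sins by simp
    qed
    then show ?thesis using Q(1,2) by blast
  next
    case False
    then obtain p0 where p0: "p0 \<in> P" "V p0 i0 \<noteq> 0" by blast
    define W where "W = (\<lambda>p i. V p i - V p i0 / V p0 i0 * V p0 i)"
    obtain Q where Q: "Q \<subseteq> P" "finite Q" "\<And>c. (\<forall>p\<in>Q. (\<Sum>i\<in>I. c i * W p i) = 0) \<Longrightarrow> \<forall>p\<in>P. (\<Sum>i\<in>I. c i * W p i) = 0"
      using insert.IH[of W] by blast
    have W: "(\<Sum>i\<in>I. c i * W p i) = (\<Sum>i\<in>insert i0 I. c i * V p i) - V p i0 / V p0 i0 * (\<Sum>i\<in>insert i0 I. c i * V p0 i)" for c p
      unfolding sins W_def using p0
      by (simp add: right_diff_distrib sum_subtractf sum_distrib_left distrib_left mult_ac)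
    have "\<forall>p\<in>P. (\<Sum>i\<in>insert i0 I. c i * V p i) = 0" if c: "\<forall>p\<in>insert p0 Q. (\<Sum>i\<in>insert i0 I. c i * V p i) = 0" for c
    proof -
      have c0: "(\<Sum>i\<in>insert i0 I. c i * V p0 i) = 0" using c by blast
      have "\<forall>p\<in>Q. (\<Sum>i\<in>I. c i * W p i) = 0" unfolding W c0 using c by simp
      from Q(3)[OF this] show ?thesis unfolding W c0 by simp
    qed
    moreover have "insert p0 Q \<subseteq> P" "finite (insert p0 Q)" using Q p0 by auto
    ultimately show ?thesis by blast
  qed
qed

section \<open>Cubic forms in coordinates and their polarization\<close>

definition cvec :: "complex \<Rightarrow> (nat \<Rightarrow> complex) \<Rightarrow> nat \<Rightarrow> complex" where
  "cvec c x = (\<lambda>i. c * x i)"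

definition unit_vec :: "nat \<Rightarrow> nat \<Rightarrow> complex" where
  "unit_vec j = (\<lambda>i. if i = j then 1 else 0)"

lemma cvec_apply [simp]: "cvec c x i = c * x i"
  by (simp add: cvec_def)

lemma vector_space_cvec: "vector_space cvec"
  by unfold_locales (auto simp: fun_eq_iff algebra_simps)

lemma monomial_Suc:
  assumes "\<alpha> \<in> multi_indices k (Suc d)"
  shows "\<exists>p<k. \<exists>\<beta>\<in>multi_indices k d. \<forall>z::nat \<Rightarrow> complex. (\<Prod>i<k. z i ^ \<alpha> i) = z p * (\<Prod>i<k. z i ^ \<beta> i)"
proof -
  have sum: "(\<Sum>i<k. \<alpha> i) = Suc d" using assms by (simp add: multi_indices_def)
  then obtain p where p: "p < k" "\<alpha> p > 0" by (metis Zero_not_Suc gr0I lessThan_iff sum.neutral)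
  define \<beta> where "\<beta> = \<alpha>(p := \<alpha> p - 1)"
  have "(\<Sum>i<k. \<alpha> i) = \<alpha> p + (\<Sum>i\<in>{..<k} - {p}. \<alpha> i)" "(\<Sum>i<k. \<beta> i) = \<beta> p + (\<Sum>i\<in>{..<k} - {p}. \<beta> i)"
    using p by (simp_all add: sum.remove)
  moreover have "(\<Sum>i\<in>{..<k} - {p}. \<alpha> i) = (\<Sum>i\<in>{..<k} - {p}. \<beta> i)" by (simp add: \<beta>_def)
  moreover have "\<beta> p = \<alpha> p - 1" by (simp add: \<beta>_def)
  ultimately have "(\<Sum>i<k. \<beta> i) = d" using sum p(2) by linarith
  moreover have "\<forall>i\<ge>k. \<beta> i = 0" using assms p(1) by (auto simp: multi_indices_def \<beta>_def)
  ultimately have "\<beta> \<in> multi_indices k d" unfolding multi_indices_def by blast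
  moreover have "(\<Prod>i<k. z i ^ \<alpha> i) = z p * (\<Prod>i<k. z i ^ \<beta> i)" for z :: "nat \<Rightarrow> complex"
  proof -
    have "(\<Prod>i<k. z i ^ \<alpha> i) = z p ^ \<alpha> p * (\<Prod>i\<in>{..<k} - {p}. z i ^ \<alpha> i)"
      "(\<Prod>i<k. z i ^ \<beta> i) = z p ^ \<beta> p * (\<Prod>i\<in>{..<k} - {p}. z i ^ \<beta> i)"
      using p by (simp_all add: prod.remove)
    moreover have "(\<Prod>i\<in>{..<k} - {p}. z i ^ \<alpha> i) = (\<Prod>i\<in>{..<k} - {p}. z i ^ \<beta> i)" by (simp add: \<beta>_def)
    moreover have "z p ^ \<alpha> p = z p * z p ^ \<beta> p" using p(2) by (simp add: \<beta>_def flip: power_Suc)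
    ultimately show ?thesis by simp
  qed
  ultimately show ?thesis using p(1) by blast
qed

lemma monomial_3:
  assumes "\<alpha> \<in> multi_indices k 3"
  shows "\<exists>p q r. p < k \<and> q < k \<and> r < k \<and> (\<forall>z::nat \<Rightarrow> complex. (\<Prod>i<k. z i ^ \<alpha> i) = z p * z q * z r)"
proof -
  obtain p \<beta> where p: "p < k" "\<beta> \<in> multi_indices k 2" "\<And>z::nat \<Rightarrow> complex. (\<Prod>i<k. z i ^ \<alpha> i) = z p * (\<Prod>i<k. z i ^ \<beta> i)"
    using monomial_Suc[of \<alpha> k 2] assms by auto
  obtain q \<gamma> where q: "q < k" "\<gamma> \<in> multi_indices k 1" "\<And>z::nat \<Rightarrow> complex. (\<Prod>i<k. z i ^ \<beta> i) = z q * (\<Prod>i<k. z i ^ \<gamma> i)"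
    using monomial_Suc[of \<beta> k 1] p by (auto simp: numeral_2_eq_2)
  obtain r \<epsilon> where r: "r < k" "\<epsilon> \<in> multi_indices k 0" "\<And>z::nat \<Rightarrow> complex. (\<Prod>i<k. z i ^ \<gamma> i) = z r * (\<Prod>i<k. z i ^ \<epsilon> i)"
    using monomial_Suc[of \<gamma> k 0] q by auto
  have "(\<Prod>i<k. z i ^ \<epsilon> i) = 1" for z :: "nat \<Rightarrow> complex"
    using r(2) by (intro prod.neutral) (auto simp: multi_indices_def)
  then have "(\<Prod>i<k. z i ^ \<alpha> i) = z p * z q * z r" for z :: "nat \<Rightarrow> complex"
    unfolding p(3) q(3) r(3) by (simp only: mult.assoc mult_1_right)
  then show ?thesis using p(1) q(1) r(1) by blast
qed

text \<open>An arbitrary ordering of the three factors of a cubic monomial. \<open>polar\<close>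
  symmetrizes over all six permutations, so the choice has no effect there.\<close>

definition mono_idx :: "nat \<Rightarrow> (nat \<Rightarrow> nat) \<Rightarrow> nat \<times> nat \<times> nat" where
  "mono_idx k \<alpha> = (SOME (p, q, r). p < k \<and> q < k \<and> r < k \<and> (\<forall>z::nat \<Rightarrow> complex. (\<Prod>i<k. z i ^ \<alpha> i) = z p * z q * z r))"

lemma mono_idx:
  assumes "\<alpha> \<in> multi_indices k 3" "mono_idx k \<alpha> = (p, q, r)"
  shows "p < k" "q < k" "r < k" "(\<Prod>i<k. z i ^ \<alpha> i) = z p * z q * (z r :: complex)"
proof -
  have "case mono_idx k \<alpha> of (p, q, r) \<Rightarrow> p < k \<and> q < k \<and> r < k \<and> (\<forall>z::nat \<Rightarrow> complex. (\<Prod>i<k. z i ^ \<alpha> i) = z p * z q * z r)"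
    unfolding mono_idx_def by (rule someI_ex) (use monomial_3[OF assms(1)] in auto)
  then show "p < k" "q < k" "r < k" "(\<Prod>i<k. z i ^ \<alpha> i) = z p * z q * z r" using assms(2) by auto
qed

definition polar :: "nat \<Rightarrow> ((nat \<Rightarrow> nat) \<Rightarrow> complex) \<Rightarrow> (nat \<Rightarrow> complex) \<Rightarrow> (nat \<Rightarrow> complex) \<Rightarrow> (nat \<Rightarrow> complex) \<Rightarrow> complex" where
  "polar k c x y z = (\<Sum>\<alpha>\<in>multi_indices k 3. case mono_idx k \<alpha> of (p, q, r) \<Rightarrow>
     c \<alpha> / 6 * (x p * y q * z r + x p * y r * z q + x q * y p * z r + x q * y r * z p + x r * y p * z q + x r * y q * z p))"

lemma polar_cubic: "cubic cvec (polar k c)"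
proof (intro cubic.intro cubic_axioms.intro vector_space_cvec)
  fix x y z u v :: "nat \<Rightarrow> complex" and d :: complex
  show "polar k c (x + y) u v = polar k c x u v + polar k c y u v"
    unfolding polar_def sum.distrib[symmetric] by (intro sum.cong) (auto simp: algebra_simps split: prod.split)
  show "polar k c (cvec d x) u v = d * polar k c x u v"
    unfolding polar_def sum_distrib_left by (intro sum.cong) (auto simp: algebra_simps split: prod.split)
  show "polar k c x y z = polar k c y x z" "polar k c x y z = polar k c x z y"
    unfolding polar_def by (intro sum.cong; auto simp: algebra_simps split: prod.split)+
qed

lemma polar_form: "polar k c z z z = form k 3 c z"
  unfolding polar_def form_def
  by (intro sum.cong refl) (auto simp: mono_idx(4) algebra_simps split: prod.split)

lemma polar_cong:
  assumes "\<And>i. i < k \<Longrightarrow> x i = x' i"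
  shows "polar k c x y z = polar k c x' y z"
  unfolding polar_def using assms by (intro sum.cong refl) (auto simp: mono_idx(1-3) split: prod.split)

lemma partial_deriv_form: "partial_deriv i (form k 3 c) z = 3 * polar k c z z (unit_vec i)"
proof -
  interpret cubic cvec "polar k c" by (rule polar_cubic)
  have upd: "z(i := t) = z + cvec (t - z i) (unit_vec i)" for t by (auto simp: unit_vec_def)
  have perm: "polar k c z (unit_vec i) z = polar k c z z (unit_vec i)" "polar k c (unit_vec i) z z = polar k c z z (unit_vec i)"
    by (metis T_swap12 T_swap23)+
  have "((\<lambda>t. form k 3 c (z(i := t))) has_field_derivative 3 * polar k c z z (unit_vec i)) (at (z i))"
    unfolding polar_form[symmetric] upd T_lin perm by (auto intro!: derivative_eq_intros)
  then show ?thesis unfolding partial_deriv_def by (rule DERIV_imp_deriv)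
qed

section \<open>Sprays along the residual conics of a line\<close>

text \<open>For \<open>w = u^2\<close> nonzero, \<open>sinhc w\<close> and \<open>coshc w\<close>
  are \<open>sinh u / u\<close> and \<open>(cosh u - 1) / u^2\<close>. As power series in
  \<open>w\<close> they are entire, so no square root of the eigenvalue parameter has to be
  chosen.\<close>

definition sinhc :: "complex \<Rightarrow> complex" where "sinhc w = (\<Sum>k. 1 / fact (2 * k + 1) * w ^ k)"
definition coshc :: "complex \<Rightarrow> complex" where "coshc w = (\<Sum>k. 1 / fact (2 * k + 2) * w ^ k)"

lemma summable_fact_power:
  assumes "\<And>k. j k \<ge> k"
  shows "summable (\<lambda>k. 1 / fact (j k) * w ^ k :: complex)"
proof (rule summable_comparison_test'[where N = 0])
  show "summable (\<lambda>k. inverse (fact k) * norm w ^ k)" by (rule summable_exp)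
  fix k :: nat
  have "fact k \<le> (fact (j k) :: real)" by (intro fact_mono assms)
  then have "1 / fact (j k) \<le> inverse (fact k :: real)" by (simp add: field_simps)
  then have "1 / fact (j k) * norm w ^ k \<le> inverse (fact k) * norm w ^ k"
    by (intro mult_right_mono) auto
  then show "norm (1 / fact (j k) * w ^ k) \<le> inverse (fact k) * norm w ^ k"
    by (simp add: norm_mult norm_divide norm_power)
qed

lemma power_series_differentiable:
  fixes c :: "nat \<Rightarrow> complex"
  assumes "\<And>w. summable (\<lambda>k. c k * w ^ k)"
  shows "(\<lambda>w. \<Sum>k. c k * w ^ k) field_differentiable (at w)"
  using termdiffs_strong_converges_everywhere[OF assms] unfolding field_differentiable_def by blast

lemma sinhc_differentiable: "sinhc field_differentiable (at w)"
  unfolding sinhc_def[abs_def] by (intro power_series_differentiable summable_fact_power) simp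

lemma coshc_differentiable: "coshc field_differentiable (at w)"
  unfolding coshc_def[abs_def] by (intro power_series_differentiable summable_fact_power) simp

lemma sinhc_square: "u * sinhc (u^2) = sinh u"
proof -
  have sm: "strict_mono (\<lambda>k::nat. 2 * k + 1)" by (auto simp: strict_mono_def)
  have r: "n \<notin> range (\<lambda>k. 2 * k + 1) \<Longrightarrow> even n" for n :: nat by (metis oddE rangeI)
  have "(\<lambda>k. (if even (2 * k + 1) then 0 else u ^ (2 * k + 1) /\<^sub>R fact (2 * k + 1))) sums sinh u"
    using sums_mono_reindex[OF sm, of "\<lambda>n. if even n then 0 else u ^ n /\<^sub>R fact n"] sinh_converges[of u] r by auto
  moreover have "(if even (2 * k + 1) then 0 else u ^ (2 * k + 1) /\<^sub>R fact (2 * k + 1)) = u * (1 / fact (2 * k + 1) * (u^2) ^ k)" for k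
    by (simp add: scaleR_conv_of_real power_mult divide_inverse del: fact_Suc)
  ultimately have "(\<lambda>k. u * (1 / fact (2 * k + 1) * (u^2) ^ k)) sums sinh u" by simp
  moreover have "(\<lambda>k. u * (1 / fact (2 * k + 1) * (u^2) ^ k)) sums (u * sinhc (u^2))"
    unfolding sinhc_def by (intro sums_mult summable_sums summable_fact_power) simp
  ultimately show ?thesis by (rule sums_unique2[symmetric])
qed

lemma coshc_square: "u^2 * coshc (u^2) = cosh u - 1"
proof -
  have sm: "strict_mono (\<lambda>k::nat. 2 * k)" by (auto simp: strict_mono_def)
  have r: "n \<notin> range (\<lambda>k. 2 * k) \<Longrightarrow> odd n" for n :: nat by (metis evenE rangeI)
  have "(\<lambda>k. (if even (2 * k) then u ^ (2 * k) /\<^sub>R fact (2 * k) else 0)) sums cosh u"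
    using sums_mono_reindex[OF sm, of "\<lambda>n. if even n then u ^ n /\<^sub>R fact n else 0"] cosh_converges[of u] r by auto
  then have "(\<lambda>k. u ^ (2 * k) /\<^sub>R fact (2 * k)) sums cosh u" by simp
  then have "(\<lambda>k. u ^ (2 * Suc k) /\<^sub>R fact (2 * Suc k)) sums (cosh u - 1)"
    by (subst sums_Suc_iff) (simp del: fact_Suc)
  moreover have "u ^ (2 * Suc k) /\<^sub>R fact (2 * Suc k) = u^2 * (1 / fact (2 * k + 2) * (u^2) ^ k)" for k
    by (simp add: scaleR_conv_of_real power_mult divide_inverse power2_eq_square power_mult_distrib del: fact_Suc)
  ultimately have "(\<lambda>k. u^2 * (1 / fact (2 * k + 2) * (u^2) ^ k)) sums (cosh u - 1)" by simp
  moreover have "(\<lambda>k. u^2 * (1 / fact (2 * k + 2) * (u^2) ^ k)) sums (u^2 * coshc (u^2))"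
    unfolding coshc_def by (intro sums_mult summable_sums summable_fact_power) simp
  ultimately show ?thesis by (rule sums_unique2[symmetric])
qed

lemma sinhc_0 [simp]: "sinhc 0 = 1" and coshc_0 [simp]: "coshc 0 = 1 / 2"
  unfolding sinhc_def coshc_def by (subst powser_zero; simp)+

text \<open>For \<open>w = u^2\<close> nonzero this is \<open>(cosh u)^2 - 1 = (sinh u)^2\<close>
  divided by \<open>w\<close>. It is the relation between the two coefficients of the exponential
  that makes the flow preserve the conic.\<close>

lemma sinhc_coshc: "(sinhc w)^2 = 2 * coshc w + w * (coshc w)^2"
proof (cases "w = 0")
  case False
  define u where "u = csqrt w"
  have w: "w = u^2" by (simp add: u_def)
  have "(cosh u)^2 = (sinh u)^2 + 1" by (rule cosh_square_eq)
  then have "w * ((sinhc w)^2 - (2 * coshc w + w * (coshc w)^2)) = 0"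
    using sinhc_square[of u] coshc_square[of u] unfolding w[symmetric] using w by algebra
  then show ?thesis using False by simp
qed (simp add: power2_eq_square)

text \<open>The Hamiltonian flow of the conic \<open>q\<close> with respect to the linear form \<open>(\<alpha>, \<beta>, \<gamma>)\<close> is
  \<open>exp (t M)\<close> with \<open>M y = (\<alpha>, \<beta>, \<gamma>) \<times> Q y\<close>, and \<open>M\<^sup>3 = \<delta> M\<close>.\<close>

lemma conic_flow:
  fixes F b e A B C \<alpha> \<beta> \<gamma> s \<kappa> :: complex
  defines "m0 \<equiv> \<beta> * (3 * e) - \<gamma> * (3 * b)" and "m1 \<equiv> \<gamma> * (2 * F) - \<alpha> * (3 * e)" and "m2 \<equiv> \<alpha> * (3 * b) - \<beta> * (2 * F)"
  defines "h0 \<equiv> 2 * F * m0 + 3 * b * m1 + 3 * e * m2" and "h1 \<equiv> 3 * b * m0 + 6 * A * m1 + 6 * B * m2"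
    and "h2 \<equiv> 3 * e * m0 + 6 * B * m1 + 6 * C * m2"
  defines "k0 \<equiv> \<beta> * h2 - \<gamma> * h1" and "k1 \<equiv> \<gamma> * h0 - \<alpha> * h2" and "k2 \<equiv> \<alpha> * h1 - \<beta> * h0"
  defines "\<delta> \<equiv> - (\<alpha>^2 * (36 * (A * C - B^2)) - 2 * \<alpha> * \<beta> * (18 * (b * C - e * B)) + 2 * \<alpha> * \<gamma> * (18 * (b * B - e * A))
     + \<beta>^2 * (12 * F * C - 9 * e^2) - 2 * \<beta> * \<gamma> * (12 * F * B - 9 * b * e) + \<gamma>^2 * (12 * F * A - 9 * b^2))"
  assumes s: "s^2 = 2 * \<kappa> + \<delta> * \<kappa>^2"
  defines "y0 \<equiv> 1 + s * m0 + \<kappa> * k0" and "y1 \<equiv> s * m1 + \<kappa> * k1" and "y2 \<equiv> s * m2 + \<kappa> * k2"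
  shows "F * y0^2 + 3 * b * y0 * y1 + 3 * e * y0 * y2 + 3 * A * y1^2 + 6 * B * y1 * y2 + 3 * C * y2^2 = F"
    and "\<alpha> * y0 + \<beta> * y1 + \<gamma> * y2 = \<alpha>"
proof -
  \<comment> \<open>In the basis \<open>x\<close>, \<open>u\<close>, \<open>v\<close> the vectors
    \<open>m\<close> and \<open>k\<close> are \<open>M x\<close> and \<open>M^2 x\<close>;
    \<open>h\<close> and \<open>l\<close> are their images under the Gram matrix.\<close>
  define l0 where "l0 = 2 * F * k0 + 3 * b * k1 + 3 * e * k2"
  define l1 where "l1 = 3 * b * k0 + 6 * A * k1 + 6 * B * k2"
  define l2 where "l2 = 3 * e * k0 + 6 * B * k1 + 6 * C * k2"
  \<comment> \<open>A cross product is orthogonal to its factors, so \<open>M\<close> is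
    infinitesimally orthogonal for the conic. This gives \<open>gm\<close>, \<open>hk\<close> and
    \<open>gk\<close>.\<close>
  have gm: "2 * F * m0 + 3 * b * m1 + 3 * e * m2 = 0" unfolding m0_def m1_def m2_def by (simp add: algebra_simps)
  have hk: "h0 * k0 + h1 * k1 + h2 * k2 = 0" unfolding k0_def k1_def k2_def by (simp add: algebra_simps)
  have gk: "2 * F * k0 + 3 * b * k1 + 3 * e * k2 = - (h0 * m0 + h1 * m1 + h2 * m2)"
    unfolding k0_def k1_def k2_def m0_def m1_def m2_def by (simp add: algebra_simps)
  \<comment> \<open>\<open>M^3 = \<delta> M\<close> applied to \<open>x\<close>: \<open>M\<close> is
    the product of a skew and a symmetric matrix, so its trace and determinant vanish and
    Cayley-Hamilton leaves only these two terms.\<close>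
  have cayley: "\<beta> * l2 - \<gamma> * l1 = \<delta> * m0" "\<gamma> * l0 - \<alpha> * l2 = \<delta> * m1" "\<alpha> * l1 - \<beta> * l0 = \<delta> * m2"
    unfolding l0_def l1_def l2_def k0_def k1_def k2_def h0_def h1_def h2_def \<delta>_def
    unfolding m0_def m1_def m2_def by (simp_all add: algebra_simps power2_eq_square)
  have kl: "k0 * l0 + k1 * l1 + k2 * l2 = - \<delta> * (h0 * m0 + h1 * m1 + h2 * m2)"
  proof -
    have "k0 * l0 + k1 * l1 + k2 * l2 = - (h0 * (\<beta> * l2 - \<gamma> * l1) + h1 * (\<gamma> * l0 - \<alpha> * l2) + h2 * (\<alpha> * l1 - \<beta> * l0))"
      unfolding k0_def k1_def k2_def by (simp add: algebra_simps)
    then show ?thesis unfolding cayley by (simp add: algebra_simps)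
  qed
  have "2 * (F * y0^2 + 3 * b * y0 * y1 + 3 * e * y0 * y2 + 3 * A * y1^2 + 6 * B * y1 * y2 + 3 * C * y2^2)
    = 2 * F + 2 * s * (2 * F * m0 + 3 * b * m1 + 3 * e * m2) + 2 * \<kappa> * (2 * F * k0 + 3 * b * k1 + 3 * e * k2)
      + s^2 * (h0 * m0 + h1 * m1 + h2 * m2) + 2 * s * \<kappa> * (h0 * k0 + h1 * k1 + h2 * k2)
      + \<kappa>^2 * (k0 * l0 + k1 * l1 + k2 * l2)"
    unfolding y0_def y1_def y2_def h0_def h1_def h2_def l0_def l1_def l2_def
    by (simp add: algebra_simps power2_eq_square)
  \<comment> \<open>What remains is \<open>h0 * m0 + h1 * m1 + h2 * m2\<close> times
    \<open>s^2 - 2 * \<kappa> - \<delta> * \<kappa>^2\<close>, zero by the assumption on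
    \<open>s\<close>.\<close>
  also have "\<dots> = 2 * F" unfolding gm gk hk kl s by (simp add: algebra_simps)
  finally show "F * y0^2 + 3 * b * y0 * y1 + 3 * e * y0 * y2 + 3 * A * y1^2 + 6 * B * y1 * y2 + 3 * C * y2^2 = F"
    by (rule mult_left_cancel[THEN iffD1, rotated]) simp
  have "\<alpha> * m0 + \<beta> * m1 + \<gamma> * m2 = 0" "\<alpha> * k0 + \<beta> * k1 + \<gamma> * k2 = 0"
    unfolding m0_def m1_def m2_def k0_def k1_def k2_def by (simp_all add: algebra_simps)
  then show "\<alpha> * y0 + \<beta> * y1 + \<gamma> * y2 = \<alpha>" unfolding y0_def y1_def y2_def by algebra
qed

declare add_2_eq_Suc' [simp del]

section \<open>The cone over the hypersurface and its affine slice\<close>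

locale affine_cubic =
  fixes n :: nat and c :: "(nat \<Rightarrow> nat) \<Rightarrow> complex" and a :: "nat \<Rightarrow> complex"
  assumes n3: "n \<ge> 3" and a: "a \<in> punctured_cspace (n + 2)"
    and jacobi: "\<And>z. z \<in> punctured_cspace (n + 2) \<Longrightarrow> form (n + 2) 3 c z = 0 \<Longrightarrow>
      \<exists>i<n + 2. partial_deriv i (form (n + 2) 3 c) z \<noteq> 0"
begin

abbreviation "K \<equiv> n + 2"
abbreviation "T \<equiv> polar K c"

definition dot :: "(nat \<Rightarrow> complex) \<Rightarrow> complex" where "dot z = (\<Sum>i<K. a i * z i)"

text \<open>Each point of the hypersurface off the hyperplane has exactly one representative with
  \<open>dot = 1\<close>, so \<open>X\<close> is the complement in affine coordinates.\<close>

definition X :: "(nat \<Rightarrow> complex) set" where "X = {z \<in> cspace K. T z z z = 0 \<and> dot z = 1}"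

sublocale cubic cvec T by (rule polar_cubic)

lemma linf_coord: "linf (\<lambda>x. \<Sum>i<K. w i * x i)"
  by (auto simp: linf_def sum_distrib_left distrib_left sum.distrib mult_ac)

lemma linf_sum: 
  assumes "linf f"
  shows "f (\<lambda>i. \<Sum>j\<in>J. s j * e j i) = (\<Sum>j\<in>J. s j * f (e j))"
proof (cases "finite J")
  case True
  have 0: "f (\<lambda>i. 0) = 0" using linf_sc[OF assms, of 0 "\<lambda>i. 0"] by (simp add: cvec_def)
  show ?thesis using True
  proof (induction J rule: finite_induct)
    case (insert j J)
    have "(\<lambda>i. \<Sum>j\<in>insert j J. s j * e j i) = cvec (s j) (e j) + (\<lambda>i. \<Sum>j\<in>J. s j * e j i)"
      using insert.hyps by (auto simp: fun_eq_iff)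
    then show ?case using insert by (simp add: linf_add[OF assms] linf_sc[OF assms])
  qed (simp add: 0)
next
  case False
  then show ?thesis using linf_sc[OF assms, of 0 "\<lambda>i. 0"] by (simp add: cvec_def)
qed

lemma truncate: "T x y z = T (\<lambda>i. if i < K then x i else 0) y z"
  by (rule polar_cong) simp

text \<open>Truncating \<open>p\<close> to its first \<open>K\<close> coordinates does not affect
  \<open>T\<close>, and the Jacobian criterion excludes a nonzero truncation.\<close>

lemma regular: "(\<And>z. T p p z = 0) \<Longrightarrow> i < K \<Longrightarrow> p i = 0"
proof (rule ccontr)
  assume z: "\<And>z. T p p z = 0" and i: "i < K" "p i \<noteq> 0"
  define q where "q = (\<lambda>i. if i < K then p i else 0)"
  have q: "T q q z = 0" for z
    using z[of z] truncate[of p p z] truncate[of p q z] T_swap12 unfolding q_def by metis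
  have "q \<in> punctured_cspace K" using i by (auto simp: punctured_cspace_def cspace_def q_def fun_eq_iff)
  from jacobi[OF this] show False unfolding partial_deriv_form polar_form[symmetric] using q by auto
qed

lemma null_iff: "null x \<longleftrightarrow> (\<forall>i<K. x i = 0)"
proof
  assume "\<forall>i<K. x i = 0"
  then have "T x y z = T 0 y z" for y z by (intro polar_cong) simp
  moreover have "T 0 y z = 0" for y z using T_sc1[of 0 0 y z] by (simp add: cvec_def zero_fun_def)
  ultimately show "null x" by (simp add: null_def)
qed (use regular in \<open>auto simp: null_def\<close>)

sublocale smooth_cubic cvec T
proof unfold_locales
  show "null p" if "\<And>z. T p p z = 0" for p using regular[OF that] null_iff by blast
  fix f1 f2 f3 f4 assume f: "linf f1" "linf f2" "linf f3" "linf f4"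
  define f where "f = (\<lambda>i::nat. if i = 0 then f1 else if i = 1 then f2 else if i = 2 then f3 else f4)"
  have lf: "linf (f i)" for i using f by (simp add: f_def)
  \<comment> \<open>Four equations on the span of five unit vectors; \<open>n \<ge> 3\<close> places
    these among the first \<open>K\<close> coordinates, where a nonzero entry is not null.\<close>
  obtain x where x: "\<exists>j\<in>{..<5}. x j \<noteq> 0" "\<forall>i\<in>{..<4}. (\<Sum>j\<in>{..<5}. f i (unit_vec j) * x j) = 0"
    using underdetermined_system[of "{..<4::nat}" "{..<5::nat}" "\<lambda>i j. f i (unit_vec j)"] by auto
  define y where "y = (\<lambda>i. \<Sum>j<5. x j * unit_vec j i)"
  have "f i y = 0" if "i < 4" for i
    unfolding y_def linf_sum[OF lf] using x(2) that by (simp add: mult.commute)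
  from this[of 0] this[of 1] this[of 2] this[of 3] have "f1 y = 0" "f2 y = 0" "f3 y = 0" "f4 y = 0"
    by (simp_all add: f_def)
  moreover have "y j = x j" if "j < 5" for j
    using that unfolding y_def unit_vec_def by (simp add: if_distrib[of "\<lambda>t. _ * t"] cong: if_cong)
  then have "\<not> null y" using x(1) n3 unfolding null_iff by force
  ultimately show "\<exists>x. f1 x = 0 \<and> f2 x = 0 \<and> f3 x = 0 \<and> f4 x = 0 \<and> \<not> null x" by blast
qed

lemma linf_expand: "linf f \<Longrightarrow> (\<And>x. null x \<Longrightarrow> f x = 0) \<Longrightarrow> f x = (\<Sum>i<K. f (unit_vec i) * x i)"
proof -
  assume f: "linf f" and n: "\<And>x. null x \<Longrightarrow> f x = 0"
  let ?y = "\<lambda>i. \<Sum>j<K. x j * unit_vec j i"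
  have "?y i = x i" if "i < K" for i
    using that unfolding unit_vec_def by (simp add: if_distrib[of "\<lambda>t. _ * t"] cong: if_cong)
  then have "null (x - ?y)" unfolding null_iff by simp
  then have "f x = f ?y" using n linf_diff[OF f, of x ?y] by simp
  also have "\<dots> = (\<Sum>j<K. x j * f (unit_vec j))" by (rule linf_sum[OF f])
  finally show ?thesis by (simp add: mult.commute)
qed

lemma dot_linf: "linf dot" unfolding dot_def[abs_def] by (rule linf_coord)
lemmas dot_add = linf_add[OF dot_linf] and dot_cvec = linf_sc[OF dot_linf]

lemma dot_null: "null x \<Longrightarrow> dot x = 0" by (simp add: dot_def null_iff)

text \<open>\<open>M x = fm0 x + fm1 u + fm2 v\<close> and \<open>M\<^sup>2 x = fk0 x + fk1 u + fk2 v\<close> for the field \<open>M\<close> of \<open>conic_flow\<close>,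
  and \<open>exp (t M) x = x + fs M x + f\<kappa> M\<^sup>2 x\<close>.\<close>

definition fm0 where "fm0 u v x = dot u * (3 * T v x x) - dot v * (3 * T u x x)"
definition fm1 where "fm1 u v x = dot v * (2 * T x x x) - dot x * (3 * T v x x)"
definition fm2 where "fm2 u v x = dot x * (3 * T u x x) - dot u * (2 * T x x x)"
definition fh0 where "fh0 u v x = 2 * T x x x * fm0 u v x + 3 * T u x x * fm1 u v x + 3 * T v x x * fm2 u v x"
definition fh1 where "fh1 u v x = 3 * T u x x * fm0 u v x + 6 * T u u x * fm1 u v x + 6 * T u v x * fm2 u v x"
definition fh2 where "fh2 u v x = 3 * T v x x * fm0 u v x + 6 * T u v x * fm1 u v x + 6 * T v v x * fm2 u v x"
definition fk0 where "fk0 u v x = dot u * fh2 u v x - dot v * fh1 u v x"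
definition fk1 where "fk1 u v x = dot v * fh0 u v x - dot x * fh2 u v x"
definition fk2 where "fk2 u v x = dot x * fh1 u v x - dot u * fh0 u v x"
definition f\<delta> where
  "f\<delta> u v x = - ((dot x)^2 * (36 * (T u u x * T v v x - (T u v x)^2)) - 2 * dot x * dot u * (18 * (T u x x * T v v x - T v x x * T u v x))
     + 2 * dot x * dot v * (18 * (T u x x * T u v x - T v x x * T u u x))
     + (dot u)^2 * (12 * T x x x * T v v x - 9 * (T v x x)^2) - 2 * dot u * dot v * (12 * T x x x * T u v x - 9 * T u x x * T v x x)
     + (dot v)^2 * (12 * T x x x * T u u x - 9 * (T u x x)^2))"
definition fs where "fs u v x t = t * sinhc (f\<delta> u v x * t^2)"
definition f\<kappa> where "f\<kappa> u v x t = t^2 * coshc (f\<delta> u v x * t^2)"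

definition conic_spray :: "(nat \<Rightarrow> complex) \<Rightarrow> (nat \<Rightarrow> complex) \<Rightarrow> (nat \<Rightarrow> complex) \<Rightarrow> complex \<Rightarrow> nat \<Rightarrow> complex" where
  "conic_spray u v x t = (\<lambda>i. (1 + fs u v x t * fm0 u v x + f\<kappa> u v x t * fk0 u v x) * x i
     + (fs u v x t * fm1 u v x + f\<kappa> u v x t * fk1 u v x) * u i
     + (fs u v x t * fm2 u v x + f\<kappa> u v x t * fk2 u v x) * v i)"

definition velocity :: "(nat \<Rightarrow> complex) \<Rightarrow> (nat \<Rightarrow> complex) \<Rightarrow> (nat \<Rightarrow> complex) \<Rightarrow> nat \<Rightarrow> complex" where
  "velocity u v x = (\<lambda>i. fm0 u v x * x i + fm1 u v x * u i + fm2 u v x * v i)"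

lemma conic_spray_0: "conic_spray u v x 0 = x"
  by (simp add: conic_spray_def fs_def f\<kappa>_def)

lemma fs_f\<kappa>: "(fs u v x t)^2 = 2 * f\<kappa> u v x t + f\<delta> u v x * (f\<kappa> u v x t)^2"
  unfolding fs_def f\<kappa>_def using sinhc_coshc[of "f\<delta> u v x * t^2"] by algebra

lemmas fdefs = fm0_def fm1_def fm2_def fh0_def fh1_def fh2_def fk0_def fk1_def fk2_def f\<delta>_def

lemma conic_spray_eq: "conic_spray u v x t = cvec (1 + fs u v x t * fm0 u v x + f\<kappa> u v x t * fk0 u v x) x
     + cvec (fs u v x t * fm1 u v x + f\<kappa> u v x t * fk1 u v x) u
     + cvec (fs u v x t * fm2 u v x + f\<kappa> u v x t * fk2 u v x) v"
  by (simp add: conic_spray_def fun_eq_iff)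

lemma dot_conic_spray: "dot (conic_spray u v x t) = dot x"
  using conic_flow(2)[OF fs_f\<kappa>[unfolded f\<delta>_def, of u v x t]]
  unfolding conic_spray_eq dot_add dot_cvec fdefs by (simp add: mult.commute)

text \<open>The conic keeps its initial value \<open>T x x x = 0\<close> along the flow, and the
  cubic is the conic times a linear factor.\<close>

lemma form_conic_spray:
  assumes l: "line u v" and "T x x x = 0"
  shows "T (conic_spray u v x t) (conic_spray u v x t) (conic_spray u v x t) = 0"
proof -
  have "T (cvec r x + cvec s u + cvec t v) (cvec r x + cvec s u + cvec t v) (cvec r x + cvec s u + cvec t v)
    = r * (T x x x * r^2 + 3 * T u x x * r * s + 3 * T v x x * r * t + 3 * T u u x * s^2 + 6 * T u v x * s * t + 3 * T v v x * t^2)" for r s t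
    unfolding line_T[OF l] by (simp add: algebra_simps power2_eq_square)
  then show ?thesis
    unfolding conic_spray_eq using conic_flow(1)[OF fs_f\<kappa>[unfolded f\<delta>_def, of u v x t]] assms(2)
    unfolding fdefs by simp
qed

lemma conic_spray_X:
  assumes "line u v" "u \<in> cspace K" "v \<in> cspace K" "x \<in> X"
  shows "conic_spray u v x t \<in> X"
  using assms form_conic_spray[OF assms(1)] unfolding X_def
  by (auto simp: dot_conic_spray) (auto simp: cspace_def conic_spray_def)

text \<open>Modulo \<open>x\<close> the velocity is linear in the bivector of the line, so it suffices to take finitely many lines
  whose bivectors span those of all lines.\<close>

lemma finite_dominating_lines:
  "\<exists>Q. finite Q \<and> (\<forall>(u, v)\<in>Q. line u v \<and> u \<in> cspace K \<and> v \<in> cspace K) \<and>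
    (\<forall>x\<in>X. \<forall>w. (\<forall>(u, v)\<in>Q. (\<Sum>i<K. w i * velocity u v x i) = 0) \<longrightarrow>
       (\<forall>y. T x x y = 0 \<longrightarrow> dot y = 0 \<longrightarrow> (\<Sum>i<K. w i * y i) = 0))"
proof -
  define P where "P = {(u, v). line u v \<and> u \<in> cspace K \<and> v \<in> cspace K}"
  define V :: "(nat \<Rightarrow> complex) \<times> (nat \<Rightarrow> complex) \<Rightarrow> nat \<times> nat \<Rightarrow> complex" where "V = (\<lambda>(u, v) (i, j). u i * v j)"
  obtain Q where Q: "Q \<subseteq> P" "finite Q"
    "\<And>c. (\<forall>p\<in>Q. (\<Sum>ij\<in>{..<K} \<times> {..<K}. c ij * V p ij) = 0) \<Longrightarrow> (\<forall>p\<in>P. (\<Sum>ij\<in>{..<K} \<times> {..<K}. c ij * V p ij) = 0)"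
    using finite_annihilating_subset[of "{..<K} \<times> {..<K}" P V] by auto
  have "(\<Sum>i<K. w i * y i) = 0"
    if x: "x \<in> X" and w: "\<forall>(u, v)\<in>Q. (\<Sum>i<K. w i * velocity u v x i) = 0" and y: "T x x y = 0" "dot y = 0" for x w y
  proof -
    define \<alpha> where "\<alpha> = T x x"
    define \<beta> where "\<beta> = (\<lambda>y. \<Sum>i<K. w i * y i)"
    \<comment> \<open>Adjusted to vanish at \<open>x\<close>, where \<open>dot\<close> is 1. This
      accounts for the component of the velocity along \<open>x\<close>.\<close>
    define \<beta>' where "\<beta>' = (\<lambda>y. 1 * \<beta> y + (- \<beta> x) * dot y)"
    have l: "linf \<alpha>" "linf \<beta>" unfolding \<alpha>_def \<beta>_def by (rule linf_T, rule linf_coord)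
    have l3: "linf \<beta>'" unfolding \<beta>'_def by (rule linf_comb[OF l(2) dot_linf])
    have nul: "\<alpha> y = 0" "\<beta>' y = 0" if "null y" for y
      using that unfolding \<alpha>_def \<beta>_def \<beta>'_def by (auto simp: null_T3 dot_null null_iff)
    \<comment> \<open>The coefficients of the two-form \<open>\<alpha> \<and> \<beta>'\<close>, to
      be paired with the tensor product of \<open>u\<close> and \<open>v\<close> stored in
      \<open>V\<close>.\<close>
    define d where "d = (\<lambda>(i, j). \<alpha> (unit_vec i) * \<beta>' (unit_vec j) - \<alpha> (unit_vec j) * \<beta>' (unit_vec i))"
    have d: "(\<Sum>ij\<in>{..<K} \<times> {..<K}. d ij * V (u, v) ij) = \<alpha> u * \<beta>' v - \<alpha> v * \<beta>' u" for u v
    proof -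
      have "(\<Sum>ij\<in>{..<K} \<times> {..<K}. d ij * V (u, v) ij) = (\<Sum>i<K. \<Sum>j<K. d (i, j) * V (u, v) (i, j))"
        by (simp add: sum.cartesian_product split_def)
      also have "\<dots> = (\<Sum>i<K. \<alpha> (unit_vec i) * u i) * (\<Sum>j<K. \<beta>' (unit_vec j) * v j)
          - (\<Sum>i<K. \<beta>' (unit_vec i) * u i) * (\<Sum>j<K. \<alpha> (unit_vec j) * v j)"
        unfolding sum_product by (simp add: d_def V_def right_diff_distrib sum_subtractf mult_ac)
      also have "\<dots> = \<alpha> u * \<beta>' v - \<beta>' u * \<alpha> v"
        by (simp only: linf_expand[OF l(1) nul(1), of u] linf_expand[OF l(1) nul(1), of v]
            linf_expand[OF l3 nul(2), of u] linf_expand[OF l3 nul(2), of v])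
      finally show ?thesis by (simp only: mult.commute)
    qed
    have xx: "T x x x = 0" "dot x = 1" using x by (auto simp: X_def)
    have vel: "(\<Sum>i<K. w i * velocity u v x i) = 3 * (\<alpha> u * \<beta>' v - \<alpha> v * \<beta>' u)" for u v
    proof -
      have "velocity u v x = cvec (fm0 u v x) x + cvec (fm1 u v x) u + cvec (fm2 u v x) v"
        by (auto simp: velocity_def)
      then have "\<beta> (velocity u v x) = fm0 u v x * \<beta> x + fm1 u v x * \<beta> u + fm2 u v x * \<beta> v"
        by (simp add: linf_add[OF l(2)] linf_sc[OF l(2)])
      moreover have "T u x x = \<alpha> u" "T v x x = \<alpha> v" unfolding \<alpha>_def by (metis T_swap12 T_swap23)+
      ultimately have "\<beta> (velocity u v x) = 3 * (\<alpha> u * \<beta>' v - \<alpha> v * \<beta>' u)"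
        unfolding fm0_def fm1_def fm2_def xx \<beta>'_def by (simp add: algebra_simps)
      then show ?thesis by (simp add: \<beta>_def)
    qed
    have "\<forall>p\<in>Q. (\<Sum>ij\<in>{..<K} \<times> {..<K}. d ij * V p ij) = 0"
      using w d vel by auto
    from Q(3)[OF this] have P: "\<alpha> u * \<beta>' v - \<alpha> v * \<beta>' u = 0" if "line u v" "u \<in> cspace K" "v \<in> cspace K" for u v
      using that d[of u v] by (auto simp: P_def)
    \<comment> \<open>\<open>P\<close> covers only vectors in \<open>cspace K\<close>, whereas
      \<open>exists_line_off_codim_2\<close> ranges over all sequences; truncation bridges the
      gap.\<close>
    have "\<alpha> u * \<beta>' v = \<alpha> v * \<beta>' u" if uv: "line u v" for u v
    proof -
      define tr where "tr = (\<lambda>x :: nat \<Rightarrow> complex. \<lambda>i. if i < K then x i else 0)"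
      have t: "T (tr x) y z = T x y z" "T y (tr x) z = T y x z" "T y z (tr x) = T y z x" for x y z
        using truncate T_swap12 T_swap23 unfolding tr_def by metis+
      have "line (tr u) (tr v)" using uv unfolding line_def t .
      moreover have "tr u \<in> cspace K" "tr v \<in> cspace K" by (auto simp: tr_def cspace_def)
      ultimately have "\<alpha> (tr u) * \<beta>' (tr v) - \<alpha> (tr v) * \<beta>' (tr u) = 0" by (rule P)
      moreover have "f (tr u) = f u" if "linf f" "\<And>y. null y \<Longrightarrow> f y = 0" for f u
      proof -
        have "null (tr u - u)" by (simp add: null_iff tr_def)
        then show ?thesis using that(2) linf_diff[OF that(1), of "tr u" u] by simp
      qed
      from this[OF l(1) nul(1)] this[OF l3 nul(2)] have "\<alpha> (tr u) = \<alpha> u" "\<beta>' (tr u) = \<beta>' u" for u by auto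
      ultimately show ?thesis by simp
    qed
    \<comment> \<open>Every line meets the common kernel, so it cannot have codimension two:
      \<open>\<alpha>\<close> and \<open>\<beta>'\<close> are dependent. As \<open>\<alpha>\<close>
      is nonzero, \<open>\<beta>'\<close> is a multiple of it and vanishes on tangent
      vectors.\<close>
    then obtain s t where st: "\<And>x. s * \<alpha> x + t * \<beta>' x = 0" "s \<noteq> 0 \<or> t \<noteq> 0"
      using exists_line_off_codim_2[OF l(1) nul(1) l3 nul(2)] by blast
    have "\<exists>p. \<alpha> p \<noteq> 0"
    proof (rule ccontr)
      assume "\<not> ?thesis"
      then have "null x" using smooth unfolding \<alpha>_def by auto
      then show False using xx dot_null by simp
    qed
    then have "t \<noteq> 0" using st by (metis add.right_neutral mult_eq_0_iff)
    then have "\<beta>' y = 0" using st(1)[of y] y unfolding \<alpha>_def by simp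
    then show "(\<Sum>i<K. w i * y i) = 0" using y unfolding \<beta>'_def \<beta>_def by simp
  qed
  then show ?thesis using Q(1,2) unfolding P_def by (intro exI[of _ Q]) blast
qed

end

section \<open>Holomorphic functions on coordinate spaces\<close>

lemma tendsto_funI:
  fixes F :: "'a \<Rightarrow> 'i \<Rightarrow> 'b::topological_space"
  assumes "\<And>i. ((\<lambda>w. F w i) \<longlongrightarrow> l i) net"
  shows "(F \<longlongrightarrow> l) net"
  using assms limitin_componentwise[of "\<lambda>i. euclidean" UNIV F l net]
  unfolding euclidean_product_topology by simp

text \<open>Caratheodory's form of differentiability, for which the chain rule is algebraic.\<close>

definition hdiff :: "nat \<Rightarrow> (nat \<Rightarrow> complex) set \<Rightarrow> ((nat \<Rightarrow> complex) \<Rightarrow> complex) \<Rightarrow> (nat \<Rightarrow> complex) \<Rightarrow> bool" where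
  "hdiff k U f z \<longleftrightarrow> (\<exists>g. (\<forall>w\<in>U. f w - f z = (\<Sum>i<k. g i w * (w i - z i))) \<and> (\<forall>i<k. (g i \<longlongrightarrow> g i z) (at z within U)))"

lemma coord_tendsto: "((\<lambda>w. w i) \<longlongrightarrow> z i) (at (z :: 'i \<Rightarrow> 'b::topological_space) within U)"
proof -
  have "continuous_on UNIV (\<lambda>w :: 'i \<Rightarrow> 'b. w i)" by simp
  then have "((\<lambda>w. w i) \<longlongrightarrow> z i) (at z within UNIV)"
    unfolding continuous_on_def by blast
  then show ?thesis by (rule tendsto_within_subset) simp
qed

lemma hdiffI:
  assumes "\<And>w. w \<in> U \<Longrightarrow> f w - f z = (\<Sum>i<k. g i w * (w i - z i))" "\<And>i. i < k \<Longrightarrow> (g i \<longlongrightarrow> g i z) (at z within U)"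
  shows "hdiff k U f z"
  using assms unfolding hdiff_def by blast

lemma hdiffE:
  assumes "hdiff k U f z"
  obtains g where "\<And>w. w \<in> U \<Longrightarrow> f w - f z = (\<Sum>i<k. g i w * (w i - z i))"
    "\<And>i. i < k \<Longrightarrow> (g i \<longlongrightarrow> g i z) (at z within U)"
  using assms unfolding hdiff_def by blast

lemma hdiff_tendsto:
  assumes "hdiff k U f z"
  shows "(f \<longlongrightarrow> f z) (at z within U)"
proof -
  obtain g where g: "\<And>w. w \<in> U \<Longrightarrow> f w - f z = (\<Sum>i<k. g i w * (w i - z i))" "\<And>i. i < k \<Longrightarrow> (g i \<longlongrightarrow> g i z) (at z within U)"
    using assms unfolding hdiff_def by blast
  have "((\<lambda>w. f z + (\<Sum>i<k. g i w * (w i - z i))) \<longlongrightarrow> f z + (\<Sum>i<k. g i z * (z i - z i))) (at z within U)"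
    by (intro tendsto_intros g(2) coord_tendsto) simp_all
  moreover have "eventually (\<lambda>w. f z + (\<Sum>i<k. g i w * (w i - z i)) = f w) (at z within U)"
    unfolding eventually_at_topological by (intro exI[of _ UNIV]) (simp flip: g(1))
  ultimately show ?thesis by (simp add: Lim_transform_eventually)
qed

text \<open>Forward, the increments of the \<open>g i\<close> bound the quotient. Backward, the
  remainder is distributed over the coordinates with weights \<open>cnj (w i - z i) / L^2\<close>,
  whose products with \<open>w i - z i\<close> add up to 1 for \<open>w \<noteq> z\<close>.\<close>

lemma hdiff_lim_iff:
  assumes U: "U \<subseteq> cspace k" and z: "z \<in> U"
  shows "hdiff k U f z \<longleftrightarrow> (\<exists>a :: nat \<Rightarrow> complex.
        ((\<lambda>w. (f w - f z - (\<Sum>i<k. a i * (w i - z i)))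
              / complex_of_real (L2_set (\<lambda>i. cmod (w i - z i)) {..<k})) \<longlongrightarrow> 0) (at z within U))"
    (is "?L \<longleftrightarrow> ?R")
proof
  assume ?L
  then obtain g where g: "\<And>w. w \<in> U \<Longrightarrow> f w - f z = (\<Sum>i<k. g i w * (w i - z i))" "\<And>i. i < k \<Longrightarrow> (g i \<longlongrightarrow> g i z) (at z within U)"
    unfolding hdiff_def by blast
  have "((\<lambda>w. (f w - f z - (\<Sum>i<k. g i z * (w i - z i)))
              / complex_of_real (L2_set (\<lambda>i. cmod (w i - z i)) {..<k})) \<longlongrightarrow> 0) (at z within U)"
  proof (rule Lim_null_comparison)
    have "((\<lambda>w. \<Sum>i<k. cmod (g i w - g i z)) \<longlongrightarrow> (\<Sum>i<k. cmod (g i z - g i z))) (at z within U)"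
      by (intro tendsto_intros g(2)) simp
    then show "((\<lambda>w. \<Sum>i<k. cmod (g i w - g i z)) \<longlongrightarrow> 0) (at z within U)" by simp
    have "norm ((f w - f z - (\<Sum>i<k. g i z * (w i - z i))) / complex_of_real (L2_set (\<lambda>i. cmod (w i - z i)) {..<k}))
        \<le> (\<Sum>i<k. cmod (g i w - g i z))" if w: "w \<in> U" for w
    proof -
      define L where "L = L2_set (\<lambda>i. cmod (w i - z i)) {..<k}"
      have L0: "L \<ge> 0" unfolding L_def by (rule L2_set_nonneg)
      have "f w - f z - (\<Sum>i<k. g i z * (w i - z i)) = (\<Sum>i<k. (g i w - g i z) * (w i - z i))"
        unfolding g(1)[OF w] by (simp add: left_diff_distrib sum_subtractf)
      also have "norm \<dots> \<le> (\<Sum>i<k. cmod (g i w - g i z) * L)"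
      proof (rule sum_norm_le)
        fix i assume "i \<in> {..<k}"
        then have "cmod (w i - z i) \<le> L" unfolding L_def by (intro member_le_L2_set) auto
        then show "norm ((g i w - g i z) * (w i - z i)) \<le> cmod (g i w - g i z) * L"
          unfolding norm_mult by (intro mult_left_mono) auto
      qed
      finally have "norm (f w - f z - (\<Sum>i<k. g i z * (w i - z i))) \<le> (\<Sum>i<k. cmod (g i w - g i z)) * L"
        by (simp add: sum_distrib_right)
      then show ?thesis
        unfolding L_def[symmetric] using L0
        by (cases "L = 0") (auto simp: norm_divide divide_simps intro!: sum_nonneg)
    qed
    then show "\<forall>\<^sub>F w in at z within U. norm ((f w - f z - (\<Sum>i<k. g i z * (w i - z i))) / complex_of_real (L2_set (\<lambda>i. cmod (w i - z i)) {..<k}))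
        \<le> (\<Sum>i<k. cmod (g i w - g i z))"
      unfolding eventually_at_topological by (intro exI[of _ UNIV]) simp
  qed
  then show ?R by (rule exI[of _ "\<lambda>i. g i z"])
next
  assume ?R
  then obtain a where a: "((\<lambda>w. (f w - f z - (\<Sum>i<k. a i * (w i - z i)))
              / complex_of_real (L2_set (\<lambda>i. cmod (w i - z i)) {..<k})) \<longlongrightarrow> 0) (at z within U)" by blast
  define R where "R = (\<lambda>w. f w - f z - (\<Sum>i<k. a i * (w i - z i)))"
  define L where "L = (\<lambda>w. L2_set (\<lambda>i. cmod (w i - z i)) {..<k})"
  define g where "g = (\<lambda>i w. a i + R w * cnj (w i - z i) / complex_of_real ((L w)^2))"
  have Rz: "R z = 0" by (simp add: R_def)
  show ?L
  proof (rule hdiffI[where g = g])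
    fix w assume w: "w \<in> U"
    have "(\<Sum>i<k. g i w * (w i - z i)) = (\<Sum>i<k. a i * (w i - z i)) + R w * (\<Sum>i<k. (w i - z i) * cnj (w i - z i)) / complex_of_real ((L w)^2)"
      unfolding g_def distrib_right sum.distrib sum_distrib_left sum_divide_distrib by (simp add: mult_ac)
    also have "(\<Sum>i<k. (w i - z i) * cnj (w i - z i)) = complex_of_real ((L w)^2)"
    proof -
      have "(L w)^2 = (\<Sum>i<k. (cmod (w i - z i))^2)" unfolding L_def L2_set_def by (simp add: sum_nonneg)
      then show ?thesis unfolding of_real_sum by (simp only: complex_norm_square of_real_sum)
    qed
    also have "R w * complex_of_real ((L w)^2) / complex_of_real ((L w)^2) = R w"
    \<comment> \<open>Division by zero yields 0, the correct value here: inside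
      \<open>cspace k\<close>, \<open>L w = 0\<close> forces \<open>w = z\<close>, where the
      remainder vanishes.\<close>
    proof (cases "L w = 0")
      case True
      then have "\<forall>i<k. w i = z i" unfolding L_def by (subst (asm) L2_set_eq_0_iff) auto
      then have "w = z" using w z U by (auto simp: cspace_def fun_eq_iff subset_iff) (metis not_le)
      then show ?thesis by (simp add: Rz)
    qed simp
    finally show "f w - f z = (\<Sum>i<k. g i w * (w i - z i))" by (simp add: R_def)
  next
    fix i assume i: "i < k"
    have "((\<lambda>w. g i w - a i) \<longlongrightarrow> 0) (at z within U)"
    proof (rule Lim_null_comparison)
      show "((\<lambda>w. norm (R w / complex_of_real (L w))) \<longlongrightarrow> 0) (at z within U)"
        using tendsto_norm_zero[OF a] by (simp only: R_def L_def)
      have "norm (g i w - a i) \<le> norm (R w / complex_of_real (L w))" for w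
      proof (cases "L w = 0")
        case False
        have L0: "L w > 0" using False L2_set_nonneg unfolding L_def by (metis order_le_less)
        have "cmod (w i - z i) \<le> L w" unfolding L_def using i by (intro member_le_L2_set) auto
        then have "cmod (R w) * cmod (w i - z i) / (L w)^2 \<le> cmod (R w) * L w / (L w)^2"
          using L0 by (intro divide_right_mono mult_left_mono) auto
        then show ?thesis unfolding g_def using L0
          by (simp add: norm_divide norm_mult norm_power power2_eq_square complex_mod_cnj del: complex_cnj_diff)
      qed (simp add: g_def)
      then show "\<forall>\<^sub>F w in at z within U. norm (g i w - a i) \<le> norm (R w / complex_of_real (L w))" by simp
    qed
    then have "(g i \<longlongrightarrow> a i) (at z within U)" by (simp add: LIM_zero_iff)
    then show "(g i \<longlongrightarrow> g i z) (at z within U)" by (simp add: g_def Rz)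
  qed
qed

lemma holomorphic_fun_iff_hdiff:
  "U \<subseteq> cspace k \<Longrightarrow> holomorphic_fun k U f \<longleftrightarrow> (\<forall>z\<in>U. hdiff k U f z)"
  unfolding holomorphic_fun_def by (intro ball_cong refl hdiff_lim_iff[symmetric])

text \<open>Passing through the limit form avoids having to extend the functions \<open>g\<close>
  from \<open>V\<close> to \<open>U\<close>.\<close>

lemma hdiff_local:
  assumes h: "hdiff k V f z" and W: "open W" "z \<in> W" "U \<inter> W \<subseteq> V" and z: "z \<in> U"
    and U: "U \<subseteq> cspace k" and V: "V \<subseteq> cspace k" and eq: "\<And>w. w \<in> U \<inter> W \<Longrightarrow> f' w = f w"
  shows "hdiff k U f' z"
proof -
  have zV: "z \<in> V" using W z by blast
  obtain a where a: "((\<lambda>w. (f w - f z - (\<Sum>i<k. a i * (w i - z i)))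
              / complex_of_real (L2_set (\<lambda>i. cmod (w i - z i)) {..<k})) \<longlongrightarrow> 0) (at z within V)"
    using h unfolding hdiff_lim_iff[OF V zV] by blast
  have "at z within U = at z within (U \<inter> W)"
    by (rule at_within_nhd[OF W(2,1)]) auto
  moreover have "((\<lambda>w. (f' w - f' z - (\<Sum>i<k. a i * (w i - z i)))
              / complex_of_real (L2_set (\<lambda>i. cmod (w i - z i)) {..<k})) \<longlongrightarrow> 0) (at z within (U \<inter> W))"
  proof (rule Lim_transform_eventually[OF tendsto_within_subset[OF a W(3)]])
    show "\<forall>\<^sub>F w in at z within U \<inter> W. (f w - f z - (\<Sum>i<k. a i * (w i - z i)))
              / complex_of_real (L2_set (\<lambda>i. cmod (w i - z i)) {..<k}) = (f' w - f' z - (\<Sum>i<k. a i * (w i - z i)))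
              / complex_of_real (L2_set (\<lambda>i. cmod (w i - z i)) {..<k})"
      unfolding eventually_at_topological using eq W z by (intro exI[of _ UNIV]) auto
  qed
  ultimately show ?thesis unfolding hdiff_lim_iff[OF U z] by auto
qed

lemma hdiff_subset: "hdiff k V f z \<Longrightarrow> U \<subseteq> V \<Longrightarrow> hdiff k U f z"
  unfolding hdiff_def by (meson subset_iff tendsto_within_subset)

lemma hdiff_cong: "(\<And>w. w \<in> U \<Longrightarrow> f w = f' w) \<Longrightarrow> f z = f' z \<Longrightarrow> hdiff k U f z = hdiff k U f' z"
  unfolding hdiff_def by simp

lemma hdiff_const: "hdiff k U (\<lambda>w. c) z"
  by (rule hdiffI[where g = "\<lambda>_ _. 0"]) auto

lemma hdiff_coord: "j < k \<Longrightarrow> hdiff k U (\<lambda>w. w j) z"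
proof (rule hdiffI[where g = "\<lambda>i w. if i = j then 1 else 0"])
  show "w j - z j = (\<Sum>i<k. (if i = j then 1 else 0) * (w i - z i))" if "j < k" for w
    using that by (simp add: if_distrib[of "\<lambda>t. t * _"] cong: if_cong)
qed auto

lemma hdiff_add:
  assumes "hdiff k U f z" "hdiff k U h z"
  shows "hdiff k U (\<lambda>w. f w + h w) z"
proof -
  obtain g where g: "\<And>w. w \<in> U \<Longrightarrow> f w - f z = (\<Sum>i<k. g i w * (w i - z i))" "\<And>i. i < k \<Longrightarrow> (g i \<longlongrightarrow> g i z) (at z within U)"
    using assms(1) by (rule hdiffE) blast
  obtain g' where g': "\<And>w. w \<in> U \<Longrightarrow> h w - h z = (\<Sum>i<k. g' i w * (w i - z i))" "\<And>i. i < k \<Longrightarrow> (g' i \<longlongrightarrow> g' i z) (at z within U)"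
    using assms(2) by (rule hdiffE) blast
  show ?thesis
  proof (rule hdiffI[where g = "\<lambda>i w. g i w + g' i w"])
    show "f w + h w - (f z + h z) = (\<Sum>i<k. (g i w + g' i w) * (w i - z i))" if "w \<in> U" for w
      unfolding distrib_right sum.distrib g(1)[OF that, symmetric] g'(1)[OF that, symmetric] by simp
  qed (intro tendsto_add g g')
qed

lemma hdiff_mult:
  assumes "hdiff k U f z" "hdiff k U h z"
  shows "hdiff k U (\<lambda>w. f w * h w) z"
proof -
  obtain g where g: "\<And>w. w \<in> U \<Longrightarrow> f w - f z = (\<Sum>i<k. g i w * (w i - z i))" "\<And>i. i < k \<Longrightarrow> (g i \<longlongrightarrow> g i z) (at z within U)"
    using assms(1) by (rule hdiffE) blast
  obtain g' where g': "\<And>w. w \<in> U \<Longrightarrow> h w - h z = (\<Sum>i<k. g' i w * (w i - z i))" "\<And>i. i < k \<Longrightarrow> (g' i \<longlongrightarrow> g' i z) (at z within U)"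
    using assms(2) by (rule hdiffE) blast
  show ?thesis
  proof (rule hdiffI[where g = "\<lambda>i w. g i w * h w + f z * g' i w"])
    show "f w * h w - f z * h z = (\<Sum>i<k. (g i w * h w + f z * g' i w) * (w i - z i))" if "w \<in> U" for w
    proof -
      have "f w * h w - f z * h z = (f w - f z) * h w + f z * (h w - h z)" by (simp add: algebra_simps)
      then show ?thesis unfolding g(1)[OF that] g'(1)[OF that]
        unfolding distrib_right sum.distrib sum_distrib_left sum_distrib_right by (simp add: mult_ac)
    qed
  qed (intro tendsto_intros g g' hdiff_tendsto[OF assms(2)])
qed

lemma hdiff_cmult: "hdiff k U f z \<Longrightarrow> hdiff k U (\<lambda>w. c * f w) z"
  by (intro hdiff_mult hdiff_const)

lemma hdiff_uminus: "hdiff k U f z \<Longrightarrow> hdiff k U (\<lambda>w. - f w) z"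
  using hdiff_cmult[of k U f z "-1"] by simp

lemma hdiff_diff: "hdiff k U f z \<Longrightarrow> hdiff k U h z \<Longrightarrow> hdiff k U (\<lambda>w. f w - h w) z"
  using hdiff_add[OF _ hdiff_uminus] by fastforce

lemma hdiff_sum: "(\<And>j. j \<in> J \<Longrightarrow> hdiff k U (f j) z) \<Longrightarrow> hdiff k U (\<lambda>w. \<Sum>j\<in>J. f j w) z"
  by (induction J rule: infinite_finite_induct) (auto intro: hdiff_const hdiff_add)

lemma hdiff_power: "hdiff k U f z \<Longrightarrow> hdiff k U (\<lambda>w. f w ^ m) z"
  by (induction m) (auto intro: hdiff_const hdiff_mult)

lemma hdiff_comp1:
  assumes f: "hdiff k U f z" and h: "h field_differentiable (at (f z))"
  shows "hdiff k U (\<lambda>w. h (f w)) z"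
proof -
  obtain g where g: "\<And>w. w \<in> U \<Longrightarrow> f w - f z = (\<Sum>i<k. g i w * (w i - z i))" "\<And>i. i < k \<Longrightarrow> (g i \<longlongrightarrow> g i z) (at z within U)"
    using f by (rule hdiffE) blast
  obtain G where G: "\<And>y. h y - h (f z) = G y * (y - f z)" "isCont G (f z)"
    using h unfolding field_differentiable_def CARAT_DERIV by blast
  show ?thesis
  proof (rule hdiffI[where g = "\<lambda>i w. G (f w) * g i w"])
    show "h (f w) - h (f z) = (\<Sum>i<k. G (f w) * g i w * (w i - z i))" if "w \<in> U" for w
      unfolding G(1) g(1)[OF that] by (simp add: sum_distrib_left mult_ac)
  qed (intro tendsto_mult g isCont_tendsto_compose[OF G(2) hdiff_tendsto[OF f]])
qed

lemma hdiff_inverse: "hdiff k U f z \<Longrightarrow> f z \<noteq> 0 \<Longrightarrow> hdiff k U (\<lambda>w. inverse (f w)) z"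
  by (rule hdiff_comp1) (auto intro!: derivative_eq_intros simp: field_differentiable_def)

lemma hdiff_divide: "hdiff k U f z \<Longrightarrow> hdiff k U h z \<Longrightarrow> h z \<noteq> 0 \<Longrightarrow> hdiff k U (\<lambda>w. f w / h w) z"
  unfolding divide_inverse by (intro hdiff_mult hdiff_inverse)

lemma cspace_map_tendsto:
  assumes "\<And>j. j < l \<Longrightarrow> ((\<lambda>w. F w j) \<longlongrightarrow> F z j) (at z within U)" "F ` U \<subseteq> cspace l" "z \<in> U"
  shows "(F \<longlongrightarrow> F z) (at z within U)"
proof (rule tendsto_funI)
  fix j show "((\<lambda>w. F w j) \<longlongrightarrow> F z j) (at z within U)"
  proof (cases "j < l")
    case False
    then have "F w j = 0" if "w \<in> U" for w using assms(2) that by (auto simp: cspace_def)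
    then have "eventually (\<lambda>w. F z j = F w j) (at z within U)"
      unfolding eventually_at_topological using assms(3) by (intro exI[of _ UNIV]) auto
    then show ?thesis by (rule Lim_transform_eventually[OF tendsto_const])
  qed (use assms(1) in blast)
qed

text \<open>\<open>F\<close> may take the value \<open>y\<close> itself near \<open>z\<close>; hence
  the limit of \<open>G\<close> is required to be \<open>G y\<close>.\<close>

lemma tendsto_within_compose:
  assumes G: "(G \<longlongrightarrow> G y) (at y within V)" and F: "(F \<longlongrightarrow> y) (at z within U)" and FV: "\<forall>\<^sub>F w in at z within U. F w \<in> V"
  shows "((\<lambda>w. G (F w)) \<longlongrightarrow> G y) (at z within U)"
  unfolding tendsto_def
proof (intro allI impI)
  fix S assume S: "open S" "G y \<in> S"
  then obtain N where N: "open N" "y \<in> N" "\<And>v. v \<in> N \<Longrightarrow> v \<noteq> y \<Longrightarrow> v \<in> V \<Longrightarrow> G v \<in> S"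
    using G unfolding tendsto_def eventually_at_topological by meson
  have "\<forall>\<^sub>F w in at z within U. F w \<in> N" using F N(1,2) unfolding tendsto_def by blast
  then show "\<forall>\<^sub>F w in at z within U. G (F w) \<in> S"
    using FV by eventually_elim (use N(3) S(2) in metis)
qed

lemma hdiff_compose:
  assumes h: "hdiff l V h (F z)" and F: "\<And>j. j < l \<Longrightarrow> hdiff k U (\<lambda>w. F w j) z"
    and FV: "F ` U \<subseteq> V" and V: "V \<subseteq> cspace l" and z: "z \<in> U"
  shows "hdiff k U (\<lambda>w. h (F w)) z"
proof -
  obtain G where G: "\<And>v. v \<in> V \<Longrightarrow> h v - h (F z) = (\<Sum>j<l. G j v * (v j - F z j))" "\<And>j. j < l \<Longrightarrow> (G j \<longlongrightarrow> G j (F z)) (at (F z) within V)"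
    using h by (rule hdiffE) blast
  have "\<forall>j. \<exists>g. j < l \<longrightarrow> (\<forall>w\<in>U. F w j - F z j = (\<Sum>i<k. g i w * (w i - z i))) \<and> (\<forall>i<k. (g i \<longlongrightarrow> g i z) (at z within U))"
    using F unfolding hdiff_def by blast
  then obtain g where g: "\<And>j w. j < l \<Longrightarrow> w \<in> U \<Longrightarrow> F w j - F z j = (\<Sum>i<k. g j i w * (w i - z i))"
      "\<And>i j. j < l \<Longrightarrow> i < k \<Longrightarrow> (g j i \<longlongrightarrow> g j i z) (at z within U)"
    by metis
  have Ft: "(F \<longlongrightarrow> F z) (at z within U)"
    using F FV V z by (intro cspace_map_tendsto[of l] hdiff_tendsto) auto
  have ev: "\<forall>\<^sub>F w in at z within U. F w \<in> V"
    unfolding eventually_at_topological using FV by (intro exI[of _ UNIV]) auto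
  show ?thesis
  proof (rule hdiffI[where g = "\<lambda>i w. \<Sum>j<l. G j (F w) * g j i w"])
    fix w assume w: "w \<in> U"
    have "h (F w) - h (F z) = (\<Sum>j<l. G j (F w) * (\<Sum>i<k. g j i w * (w i - z i)))"
      using G(1)[of "F w"] FV w g(1)[OF _ w] by auto
    also have "\<dots> = (\<Sum>i<k. (\<Sum>j<l. G j (F w) * g j i w) * (w i - z i))"
      unfolding sum_distrib_left sum_distrib_right by (subst sum.swap) (simp add: mult_ac)
    finally show "h (F w) - h (F z) = (\<Sum>i<k. (\<Sum>j<l. G j (F w) * g j i w) * (w i - z i))" .
  next
    fix i assume "i < k"
    then show "((\<lambda>w. \<Sum>j<l. G j (F w) * g j i w) \<longlongrightarrow> (\<Sum>j<l. G j (F z) * g j i z)) (at z within U)"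
      by (intro tendsto_sum tendsto_mult tendsto_within_compose[OF G(2) Ft ev] g(2)) auto
  qed
qed

text \<open>\<open>G\<close> is chosen before the curve, so one gradient serves all curves through
  \<open>z\<close>.\<close>

lemma hdiff_gradient:
  assumes "hdiff k V h z" and V: "V \<subseteq> cspace k" and z: "z \<in> V"
  shows "\<exists>G. \<forall>\<gamma> d. \<gamma> (0::complex) = z \<longrightarrow> (\<forall>\<^sub>F t in at 0. \<gamma> t \<in> V) \<longrightarrow>
     (\<forall>i<k. ((\<lambda>t. \<gamma> t i) has_field_derivative d i) (at 0)) \<longrightarrow>
     ((\<lambda>t. h (\<gamma> t)) has_field_derivative (\<Sum>i<k. G i * d i)) (at 0)"
proof -
  obtain g where g: "\<And>w. w \<in> V \<Longrightarrow> h w - h z = (\<Sum>i<k. g i w * (w i - z i))" "\<And>i. i < k \<Longrightarrow> (g i \<longlongrightarrow> g i z) (at z within V)"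
    using assms(1) by (rule hdiffE) blast
  have "((\<lambda>t. h (\<gamma> t)) has_field_derivative (\<Sum>i<k. g i z * d i)) (at 0)"
    if \<gamma>: "\<gamma> 0 = z" and ev: "\<forall>\<^sub>F t in at 0. \<gamma> t \<in> V" and d: "\<And>i. i < k \<Longrightarrow> ((\<lambda>t. \<gamma> t i) has_field_derivative d i) (at 0)" for \<gamma> d
  proof -
    obtain W where W: "open W" "0 \<in> W" "\<And>t. t \<in> W \<Longrightarrow> \<gamma> t \<in> V"
      using ev \<gamma> z unfolding eventually_at_topological by (metis UNIV_I)
    have "((\<lambda>t. \<gamma> t i) \<longlongrightarrow> \<gamma> 0 i) (at 0 within W)" if "i < k" for i
      using DERIV_isCont[OF d[OF that]] unfolding isCont_def by (rule tendsto_within_subset) simp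
    then have "(\<gamma> \<longlongrightarrow> \<gamma> 0) (at 0 within W)"
      using W V by (intro cspace_map_tendsto[of k]) auto
    then have \<gamma>t: "(\<gamma> \<longlongrightarrow> z) (at 0)" unfolding \<gamma> using at_within_open[OF W(2,1)] by simp
    have "((\<lambda>t. (\<gamma> t i - z i) / t) \<longlongrightarrow> d i) (at 0)" if "i < k" for i
      using d[OF that] unfolding has_field_derivative_iff \<gamma>[symmetric] by simp
    then have "((\<lambda>t. \<Sum>i<k. g i (\<gamma> t) * ((\<gamma> t i - z i) / t)) \<longlongrightarrow> (\<Sum>i<k. g i z * d i)) (at 0)"
      by (intro tendsto_sum tendsto_mult tendsto_within_compose[OF g(2) \<gamma>t ev]) auto
    moreover have "\<forall>\<^sub>F t in at 0. (\<Sum>i<k. g i (\<gamma> t) * ((\<gamma> t i - z i) / t)) = (h (\<gamma> t) - h (\<gamma> 0)) / (t - 0)"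
      using ev by eventually_elim (simp add: g(1) \<gamma> sum_divide_distrib)
    ultimately show ?thesis unfolding has_field_derivative_iff by (rule Lim_transform_eventually)
  qed
  then show ?thesis by (intro exI[of _ "\<lambda>i. g i z"]) blast
qed

section \<open>Charts, products and trivial bundles\<close>

lemma continuous_map_funI:
  fixes f :: "'a \<Rightarrow> nat \<Rightarrow> complex"
  shows "(\<And>i. continuous_map X euclidean (\<lambda>x. f x i)) \<Longrightarrow> continuous_map X euclidean f"
  using continuous_map_componentwise_UNIV[of X "\<lambda>i. euclidean" f] unfolding euclidean_product_topology by blast

lemma continuous_map_coord:
  fixes f :: "'a \<Rightarrow> nat \<Rightarrow> complex"
  shows "continuous_map X euclidean f \<Longrightarrow> continuous_map X euclidean (\<lambda>x. f x i)"
  using continuous_map_componentwise_UNIV[of X "\<lambda>i. euclidean" f] unfolding euclidean_product_topology by blast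

lemma second_countable_euclidean: "second_countable (euclidean :: 'a::second_countable_topology topology)"
  unfolding second_countable_def
proof -
  obtain B :: "'a set set" where "countable B" "\<And>C. C \<in> B \<Longrightarrow> open C" "\<And>S. open S \<Longrightarrow> \<exists>U. U \<subseteq> B \<and> S = \<Union>U"
    using univ_second_countable by blast
  then show "\<exists>\<B>. countable \<B> \<and> (\<forall>V\<in>\<B>. openin euclidean V) \<and>
    (\<forall>(U :: 'a set) x. openin euclidean U \<and> x \<in> U \<longrightarrow> (\<exists>V\<in>\<B>. x \<in> V \<and> V \<subseteq> U))"
    by (intro exI[of _ B]) (simp, blast)
qed

lemma second_countable_prod:
  assumes "second_countable X" "second_countable Y"
  shows "second_countable (prod_topology X Y)"
proof -
  obtain BX where BX: "countable BX" "\<forall>V\<in>BX. openin X V" "\<forall>U x. openin X U \<and> x \<in> U \<longrightarrow> (\<exists>V\<in>BX. x \<in> V \<and> V \<subseteq> U)"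
    using assms(1) unfolding second_countable_def by (elim exE conjE) (rule that)
  obtain BY where BY: "countable BY" "\<forall>V\<in>BY. openin Y V" "\<forall>U x. openin Y U \<and> x \<in> U \<longrightarrow> (\<exists>V\<in>BY. x \<in> V \<and> V \<subseteq> U)"
    using assms(2) unfolding second_countable_def by (elim exE conjE) (rule that)
  define B where "B = (\<lambda>(U, V). U \<times> V) ` (BX \<times> BY)"
  have "countable B" unfolding B_def using BX(1) BY(1) by blast
  moreover have "openin (prod_topology X Y) W" if "W \<in> B" for W
    using that BX(2) BY(2) unfolding B_def by (auto simp: openin_prod_Times_iff)
  moreover have "\<exists>V\<in>B. p \<in> V \<and> V \<subseteq> W" if W: "openin (prod_topology X Y) W" and p: "p \<in> W" for W p
  proof -
    obtain U V where UV: "openin X U" "openin Y V" "fst p \<in> U" "snd p \<in> V" "U \<times> V \<subseteq> W"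
      using W p unfolding openin_prod_topology_alt by (metis prod.collapse)
    obtain U' V' where "U' \<in> BX" "fst p \<in> U'" "U' \<subseteq> U" "V' \<in> BY" "snd p \<in> V'" "V' \<subseteq> V"
      using BX(3) BY(3) UV by meson
    then show ?thesis using UV(5) unfolding B_def by (intro bexI[of _ "U' \<times> V'"]) (auto simp: mem_Times_iff)
  qed
  ultimately show ?thesis unfolding second_countable_def by blast
qed

lemma second_countable_homeomorphic:
  assumes "second_countable X" "homeomorphic_map X Y f"
  shows "second_countable Y"
  using assms second_countable_open_map_image homeomorphic_imp_continuous_map homeomorphic_imp_open_map homeomorphic_imp_surjective_map by metis

lemma homeomorphic_maps_inv_into:
  assumes "homeomorphic_map A B f"
  shows "homeomorphic_maps A B f (inv_into (topspace A) f)"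
proof -
  obtain g where g: "homeomorphic_maps A B f g" using assms homeomorphic_map_maps by blast
  have "g y = inv_into (topspace A) f y" if "y \<in> topspace B" for y
  proof -
    have "g y \<in> topspace A" "f (g y) = y"
      using g that unfolding homeomorphic_maps_def continuous_map_def by auto
    then show ?thesis using homeomorphic_imp_injective_map[OF assms] by (metis inv_into_f_f)
  qed
  then show ?thesis using homeomorphic_maps_eq[OF g] by blast
qed

lemma is_chartD:
  assumes "is_chart X k (U, \<phi>)"
  shows "openin X U" "openin (cspace_top k) (\<phi> ` U)" "\<phi> ` U \<subseteq> cspace k" "inj_on \<phi> U" "U \<subseteq> topspace X"
    "continuous_map (subtopology X U) euclidean \<phi>"
    "continuous_map (top_of_set (\<phi> ` U)) X (inv_into U \<phi>)"
proof -
  note c = assms[unfolded is_chart_def, simplified]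
  show *: "openin X U" "openin (cspace_top k) (\<phi> ` U)" using c by auto
  show "\<phi> ` U \<subseteq> cspace k" using openin_subset[OF *(2)] by simp
  show U: "U \<subseteq> topspace X" using openin_subset[OF *(1)] .
  have h: "homeomorphic_map (subtopology X U) (top_of_set (\<phi> ` U)) \<phi>" using c by auto
  have ts: "topspace (subtopology X U) = U" using U by (simp add: inf.absorb2)
  show "inj_on \<phi> U" using homeomorphic_imp_injective_map[OF h] unfolding ts .
  show "continuous_map (subtopology X U) euclidean \<phi>"
    using homeomorphic_imp_continuous_map[OF h] by (simp add: continuous_map_in_subtopology)
  show "continuous_map (top_of_set (\<phi> ` U)) X (inv_into U \<phi>)"
    using homeomorphic_maps_inv_into[OF h] unfolding ts homeomorphic_maps_def by (simp add: continuous_map_in_subtopology)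
qed

lemma chart_open_image:
  assumes c: "is_chart X k (U, \<phi>)" and W: "openin X W" "W \<subseteq> U"
  shows "openin (cspace_top k) (\<phi> ` W)"
proof -
  have h: "homeomorphic_map (subtopology X U) (top_of_set (\<phi> ` U)) \<phi>" using c by (simp add: is_chart_def)
  have "openin (subtopology X U) W" using W by (simp add: openin_subtopology_alt) blast
  then have "openin (top_of_set (\<phi> ` U)) (\<phi> ` W)"
    using homeomorphic_imp_open_map[OF h] unfolding open_map_def by blast
  then show ?thesis using openin_trans is_chartD(2)[OF c] by blast
qed

lemma is_chartI:
  assumes U: "openin X U" and "openin (cspace_top k) (\<phi> ` U)" and c: "continuous_map (subtopology X U) euclidean \<phi>"
    and g: "continuous_map (top_of_set (\<phi> ` U)) X g" and gf: "\<And>x. x \<in> U \<Longrightarrow> g (\<phi> x) = x"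
  shows "is_chart X k (U, \<phi>)"
proof -
  have ts: "topspace (subtopology X U) = U" using openin_subset[OF U] by (simp add: inf.absorb2)
  have "homeomorphic_maps (subtopology X U) (top_of_set (\<phi> ` U)) \<phi> g"
    unfolding homeomorphic_maps_def ts using c g gf by (auto simp: continuous_map_in_subtopology ts)
  then show ?thesis using assms(1,2) homeomorphic_maps_imp_map unfolding is_chart_def by auto
qed

lemma holomorphic_betweenI:
  assumes "openin (cspace_top k) U" "f ` U \<subseteq> cspace l" "\<And>z j. z \<in> U \<Longrightarrow> j < l \<Longrightarrow> hdiff k U (\<lambda>z. f z j) z"
  shows "holomorphic_between k l U f"
proof -
  have "U \<subseteq> cspace k" using openin_subset[OF assms(1)] by simp
  from holomorphic_fun_iff_hdiff[OF this] show ?thesis using assms unfolding holomorphic_between_def by auto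
qed

lemma holomorphic_betweenD:
  assumes "holomorphic_between k l U f"
  shows "openin (cspace_top k) U" "U \<subseteq> cspace k" "f ` U \<subseteq> cspace l" "\<And>z j. z \<in> U \<Longrightarrow> j < l \<Longrightarrow> hdiff k U (\<lambda>z. f z j) z"
proof -
  show *: "openin (cspace_top k) U" "f ` U \<subseteq> cspace l" using assms by (auto simp: holomorphic_between_def)
  show U: "U \<subseteq> cspace k" using openin_subset[OF *(1)] by simp
  from holomorphic_fun_iff_hdiff[OF this] show "\<And>z j. z \<in> U \<Longrightarrow> j < l \<Longrightarrow> hdiff k U (\<lambda>z. f z j) z"
    using assms unfolding holomorphic_between_def by auto
qed

text \<open>Continuity makes the coordinate domains open, so that only differentiability at single
  points remains to be checked.\<close>

lemma holomorphic_mapI: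
  assumes M: "\<And>c. c \<in> atlas M \<Longrightarrow> is_chart (mtop M) (cdim M) c"
    and N: "\<And>c. c \<in> atlas N \<Longrightarrow> is_chart (mtop N) (cdim N) c"
    and cont: "continuous_map (mtop M) (mtop N) f"
    and loc: "\<And>U \<phi> V \<psi> x j. (U, \<phi>) \<in> atlas M \<Longrightarrow> (V, \<psi>) \<in> atlas N \<Longrightarrow> x \<in> U \<Longrightarrow> f x \<in> V \<Longrightarrow> j < cdim N \<Longrightarrow>
       hdiff (cdim M) (\<phi> ` {x\<in>U. f x \<in> V}) (\<lambda>\<xi>. \<psi> (f (inv_into U \<phi> \<xi>)) j) (\<phi> x)"
  shows "holomorphic_map M N f"
proof -
  have "holomorphic_between (cdim M) (cdim N) (\<phi> ` {x\<in>U. f x \<in> V}) (\<psi> \<circ> f \<circ> inv_into U \<phi>)"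
    if cc: "(U, \<phi>) \<in> atlas M" "(V, \<psi>) \<in> atlas N" for U \<phi> V \<psi>
  proof -
  note ch = M[OF cc(1)] N[OF cc(2)]
  have "openin (mtop M) {x \<in> topspace (mtop M). f x \<in> V}"
    by (rule openin_continuous_map_preimage[OF cont is_chartD(1)[OF ch(2)]])
  then have "openin (mtop M) (U \<inter> {x \<in> topspace (mtop M). f x \<in> V})" using is_chartD(1)[OF ch(1)] by blast
  moreover have "U \<inter> {x \<in> topspace (mtop M). f x \<in> V} = {x\<in>U. f x \<in> V}" using is_chartD(5)[OF ch(1)] by blast
  ultimately have op: "openin (mtop M) {x\<in>U. f x \<in> V}" by simp
  show "holomorphic_between (cdim M) (cdim N) (\<phi> ` {x\<in>U. f x \<in> V}) (\<psi> \<circ> f \<circ> inv_into U \<phi>)"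
  proof (rule holomorphic_betweenI)
    show "openin (cspace_top (cdim M)) (\<phi> ` {x\<in>U. f x \<in> V})"
      by (rule chart_open_image[OF ch(1) op]) blast
    show "(\<psi> \<circ> f \<circ> inv_into U \<phi>) ` \<phi> ` {x \<in> U. f x \<in> V} \<subseteq> cspace (cdim N)"
      using is_chartD(3)[OF ch(2)] is_chartD(4)[OF ch(1)] by (auto simp: image_subset_iff)
    show "hdiff (cdim M) (\<phi> ` {x\<in>U. f x \<in> V}) (\<lambda>z. (\<psi> \<circ> f \<circ> inv_into U \<phi>) z j) z"
      if "z \<in> \<phi> ` {x\<in>U. f x \<in> V}" "j < cdim N" for z j
      using that loc[OF cc] by (auto simp: o_def)
  qed
  qed
  then show ?thesis using cont unfolding holomorphic_map_def by blast
qed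

lemma complex_manifold_chart:
  assumes "complex_manifold M" "(U, \<phi>) \<in> atlas M"
  shows "is_chart (mtop M) (cdim M) (U, \<phi>)"
  using assms unfolding complex_manifold_def by blast

lemma complex_manifold_transition:
  assumes "complex_manifold M" "(U, \<phi>) \<in> atlas M" "(V, \<psi>) \<in> atlas M"
  shows "holomorphic_between (cdim M) (cdim M) (\<phi> ` (U \<inter> V)) (\<lambda>\<xi>. \<psi> (inv_into U \<phi> \<xi>))"
  using assms unfolding complex_manifold_def compatible_charts_def by (fastforce simp: o_def)

section \<open>Products with a coordinate space\<close>

definition ccat :: "nat \<Rightarrow> (nat \<Rightarrow> complex) \<Rightarrow> (nat \<Rightarrow> complex) \<Rightarrow> nat \<Rightarrow> complex" where
  "ccat k x v = (\<lambda>i. if i < k then x i else v (i - k))"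
definition ctake :: "nat \<Rightarrow> (nat \<Rightarrow> complex) \<Rightarrow> nat \<Rightarrow> complex" where
  "ctake k \<zeta> = (\<lambda>i. if i < k then \<zeta> i else 0)"
definition cdrop :: "nat \<Rightarrow> (nat \<Rightarrow> complex) \<Rightarrow> nat \<Rightarrow> complex" where
  "cdrop k \<zeta> = (\<lambda>i. \<zeta> (i + k))"

lemma ctake_ccat [simp]: "x \<in> cspace k \<Longrightarrow> ctake k (ccat k x v) = x"
  by (auto simp: ctake_def ccat_def cspace_def fun_eq_iff)
lemma cdrop_ccat [simp]: "cdrop k (ccat k x v) = v"
  by (auto simp: cdrop_def ccat_def)
lemma ccat_ctake_cdrop [simp]: "ccat k (ctake k \<zeta>) (cdrop k \<zeta>) = \<zeta>"
  by (auto simp: ctake_def ccat_def cdrop_def)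
lemma ccat_cspace: "x \<in> cspace k \<Longrightarrow> v \<in> cspace r \<Longrightarrow> ccat k x v \<in> cspace (k + r)"
  by (auto simp: ccat_def cspace_def)
lemma ctake_cspace [simp]: "ctake k \<zeta> \<in> cspace k"
  by (auto simp: ctake_def cspace_def)
lemma cdrop_cspace: "\<zeta> \<in> cspace (k + r) \<Longrightarrow> cdrop k \<zeta> \<in> cspace r"
  by (auto simp: cdrop_def cspace_def)

lemma continuous_map_ctake: "continuous_map (top_of_set S) euclidean (ctake k)"
  by (rule continuous_map_funI) (auto simp: ctake_def intro!: continuous_on_product_then_coordinatewise continuous_on_id)
lemma continuous_map_cdrop: "continuous_map (top_of_set S) euclidean (cdrop k)"
  by (rule continuous_map_funI) (auto simp: cdrop_def intro!: continuous_on_product_then_coordinatewise continuous_on_id)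

text \<open>The inverse chart acts separately on the two blocks of coordinates, which reduces
  transition maps of the product to those of the base.\<close>

lemma times_chart:
  assumes c: "is_chart X k (U, \<phi>)"
  shows "is_chart (prod_topology X (cspace_top r)) (k + r) (U \<times> cspace r, \<lambda>(x, v). ccat k (\<phi> x) v)"
    and "(\<lambda>(x, v). ccat k (\<phi> x) v) ` (U \<times> cspace r) = {\<zeta> \<in> cspace (k + r). ctake k \<zeta> \<in> \<phi> ` U}"
    and "\<zeta> \<in> cspace (k + r) \<Longrightarrow> ctake k \<zeta> \<in> \<phi> ` U \<Longrightarrow>
      inv_into (U \<times> cspace r) (\<lambda>(x, v). ccat k (\<phi> x) v) \<zeta> = (inv_into U \<phi> (ctake k \<zeta>), cdrop k \<zeta>)"
proof -
  let ?\<Phi> = "\<lambda>(x, v). ccat k (\<phi> x) v"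
  let ?g = "\<lambda>\<zeta>. (inv_into U \<phi> (ctake k \<zeta>), cdrop k \<zeta>)"
  note D = is_chartD[OF c]
  have gf: "?g (?\<Phi> p) = p" if "p \<in> U \<times> cspace r" for p
    using that D(3,4) by (auto simp: image_subset_iff split: prod.splits)
  show im: "?\<Phi> ` (U \<times> cspace r) = {\<zeta> \<in> cspace (k + r). ctake k \<zeta> \<in> \<phi> ` U}"
  proof (intro equalityI subsetI)
    fix \<zeta> assume "\<zeta> \<in> ?\<Phi> ` (U \<times> cspace r)"
    then show "\<zeta> \<in> {\<zeta> \<in> cspace (k + r). ctake k \<zeta> \<in> \<phi> ` U}" using D(3) by (auto simp: image_subset_iff ccat_cspace)
  next
    fix \<zeta> assume z: "\<zeta> \<in> {\<zeta> \<in> cspace (k + r). ctake k \<zeta> \<in> \<phi> ` U}"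
    then have "?g \<zeta> \<in> U \<times> cspace r" "?\<Phi> (?g \<zeta>) = \<zeta>"
      by (auto simp: inv_into_into cdrop_cspace f_inv_into_f)
    then show "\<zeta> \<in> ?\<Phi> ` (U \<times> cspace r)" by (metis (no_types, lifting) image_eqI)
  qed
  show "is_chart (prod_topology X (cspace_top r)) (k + r) (U \<times> cspace r, ?\<Phi>)"
  proof (rule is_chartI)
    show "openin (prod_topology X (cspace_top r)) (U \<times> cspace r)" using D(1) by (simp add: openin_prod_Times_iff)
    have "continuous_map (cspace_top (k + r)) (cspace_top k) (ctake k)"
      using continuous_map_ctake by (auto simp: continuous_map_in_subtopology)
    from openin_continuous_map_preimage[OF this D(2)]
    show "openin (cspace_top (k + r)) (?\<Phi> ` (U \<times> cspace r))" unfolding im by simp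
    show "continuous_map (subtopology (prod_topology X (cspace_top r)) (U \<times> cspace r)) euclidean ?\<Phi>"
    proof (rule continuous_map_funI)
      fix i
      have eq: "subtopology (prod_topology X (cspace_top r)) (U \<times> cspace r) = prod_topology (subtopology X U) (cspace_top r)"
        by (simp add: subtopology_Times subtopology_subtopology)
      have 1: "continuous_map (prod_topology (subtopology X U) (cspace_top r)) euclidean (\<lambda>p. \<phi> (fst p) i)"
        using continuous_map_compose[OF continuous_map_fst continuous_map_coord[OF D(6)]] by (simp add: o_def)
      have cv: "continuous_map (cspace_top r) euclidean (\<lambda>v. v (i - k))"
        by (intro continuous_map_coord) auto
      have 2: "continuous_map (prod_topology (subtopology X U) (cspace_top r)) euclidean (\<lambda>p. snd p (i - k))"
        using continuous_map_compose[OF continuous_map_snd cv] by (simp add: o_def)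
      show "continuous_map (subtopology (prod_topology X (cspace_top r)) (U \<times> cspace r)) euclidean (\<lambda>p. ?\<Phi> p i)"
        unfolding eq using 1 2 by (simp add: ccat_def split_def)
    qed
    show "continuous_map (top_of_set (?\<Phi> ` (U \<times> cspace r))) (prod_topology X (cspace_top r)) ?g"
      unfolding im
    proof (rule continuous_map_pairedI)
      have "continuous_map (top_of_set {\<zeta> \<in> cspace (k + r). ctake k \<zeta> \<in> \<phi> ` U}) (top_of_set (\<phi> ` U)) (ctake k)"
        using continuous_map_ctake by (auto simp: continuous_map_in_subtopology)
      from continuous_map_compose[OF this D(7)]
      show "continuous_map (top_of_set {\<zeta> \<in> cspace (k + r). ctake k \<zeta> \<in> \<phi> ` U}) X (\<lambda>\<zeta>. inv_into U \<phi> (ctake k \<zeta>))"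
        by (simp add: o_def)
      show "continuous_map (top_of_set {\<zeta> \<in> cspace (k + r). ctake k \<zeta> \<in> \<phi> ` U}) (cspace_top r) (cdrop k)"
        using continuous_map_cdrop by (auto simp: continuous_map_in_subtopology cdrop_cspace)
    qed
  qed (rule gf)
  show "inv_into (U \<times> cspace r) ?\<Phi> \<zeta> = ?g \<zeta>" if z: "\<zeta> \<in> cspace (k + r)" "ctake k \<zeta> \<in> \<phi> ` U"
  proof -
    have "inj_on ?\<Phi> (U \<times> cspace r)" by (rule inj_on_inverseI[of _ ?g]) (rule gf)
    moreover have "?g \<zeta> \<in> U \<times> cspace r" "?\<Phi> (?g \<zeta>) = \<zeta>"
      using z by (auto simp: inv_into_into cdrop_cspace f_inv_into_f)
    ultimately show ?thesis by (metis (no_types, lifting) inv_into_f_f)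
  qed
qed

lemma times_cspace_atlas:
  "atlas (times_cspace M r) = (\<lambda>(U, \<phi>). (U \<times> cspace r, \<lambda>(x, v). ccat (cdim M) (\<phi> x) v)) ` atlas M"
  unfolding times_cspace_def ccat_def by force

lemma times_cspace_simps [simp]:
  "mtop (times_cspace M r) = prod_topology (mtop M) (cspace_top r)" "cdim (times_cspace M r) = cdim M + r"
  by (simp_all add: times_cspace_def)

lemma hdiff_ctake:
  assumes "hdiff k V f (ctake k \<zeta>)" "ctake k ` U \<subseteq> V" "V \<subseteq> cspace k" "\<zeta> \<in> U"
  shows "hdiff (k + r) U (\<lambda>\<zeta>. f (ctake k \<zeta>)) \<zeta>"
proof (rule hdiff_compose[where h = f and F = "ctake k", OF assms(1)])
  show "hdiff (k + r) U (\<lambda>w. ctake k w j) \<zeta>" if "j < k" for j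
    using that hdiff_coord[of j "k + r"] by (simp add: ctake_def)
qed (use assms in auto)

lemma complex_manifold_times:
  assumes M: "complex_manifold M"
  shows "complex_manifold (times_cspace M r)"
  unfolding complex_manifold_def
proof (intro conjI ballI)
  show "Hausdorff_space (mtop (times_cspace M r))"
    using M by (simp add: complex_manifold_def Hausdorff_space_prod_topology Hausdorff_space_subtopology)
  show "second_countable (mtop (times_cspace M r))"
    using M by (simp add: complex_manifold_def second_countable_prod second_countable_subtopology second_countable_euclidean)
  show "is_chart (mtop (times_cspace M r)) (cdim (times_cspace M r)) c" if "c \<in> atlas (times_cspace M r)" for c
    using that times_chart(1)[OF complex_manifold_chart[OF M]] unfolding times_cspace_atlas by auto
  show "(\<Union>c\<in>atlas (times_cspace M r). fst c) = points (times_cspace M r)"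
  proof -
    have "(\<Union>c\<in>atlas (times_cspace M r). fst c) = (\<Union>c\<in>atlas M. fst c) \<times> cspace r"
      unfolding times_cspace_atlas by force
    then show ?thesis using M by (simp add: complex_manifold_def)
  qed
  fix c c' assume "c \<in> atlas (times_cspace M r)" "c' \<in> atlas (times_cspace M r)"
  then obtain U \<phi> V \<psi> where c: "(U, \<phi>) \<in> atlas M" "(V, \<psi>) \<in> atlas M"
    "c = (U \<times> cspace r, \<lambda>(x, v). ccat (cdim M) (\<phi> x) v)" "c' = (V \<times> cspace r, \<lambda>(x, v). ccat (cdim M) (\<psi> x) v)"
    unfolding times_cspace_atlas by auto
  let ?k = "cdim M"
  have *: "holomorphic_between (?k + r) (?k + r) ((\<lambda>(x, v). ccat ?k (\<phi> x) v) ` (U \<times> cspace r \<inter> V \<times> cspace r))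
      ((\<lambda>(x, v). ccat ?k (\<psi> x) v) \<circ> inv_into (U \<times> cspace r) (\<lambda>(x, v). ccat ?k (\<phi> x) v))"
    if c: "(U, \<phi>) \<in> atlas M" "(V, \<psi>) \<in> atlas M" for U \<phi> V \<psi>
  proof -
    note ch = complex_manifold_chart[OF M c(1)] complex_manifold_chart[OF M c(2)]
    have op: "openin (mtop M) (U \<inter> V)" using is_chartD(1)[OF ch(1)] is_chartD(1)[OF ch(2)] by blast
    have im: "(\<lambda>(x, v). ccat ?k (\<phi> x) v) ` (U \<times> cspace r \<inter> V \<times> cspace r) = {\<zeta> \<in> cspace (?k + r). ctake ?k \<zeta> \<in> \<phi> ` (U \<inter> V)}"
      (is "?I = ?R")
    proof -
      have sub: "is_chart (mtop M) ?k (U \<inter> V, \<phi>)"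
      proof (rule is_chartI[OF op])
        show "openin (cspace_top ?k) (\<phi> ` (U \<inter> V))" by (rule chart_open_image[OF ch(1) op]) blast
        show "continuous_map (subtopology (mtop M) (U \<inter> V)) euclidean \<phi>"
          using is_chartD(6)[OF ch(1)] continuous_map_from_subtopology_mono by blast
        show "continuous_map (top_of_set (\<phi> ` (U \<inter> V))) (mtop M) (inv_into U \<phi>)"
          using is_chartD(7)[OF ch(1)] by (rule continuous_map_from_subtopology_mono) blast
        show "inv_into U \<phi> (\<phi> x) = x" if "x \<in> U \<inter> V" for x using that is_chartD(4)[OF ch(1)] by simp
      qed
      have "U \<times> cspace r \<inter> V \<times> cspace r = (U \<inter> V) \<times> cspace r" by blast
      then show ?thesis using times_chart(2)[OF sub, of r] by simp
    qed
    note tr = holomorphic_betweenD[OF complex_manifold_transition[OF M c]]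
    have inv: "inv_into (U \<times> cspace r) (\<lambda>(x, v). ccat ?k (\<phi> x) v) \<zeta> = (inv_into U \<phi> (ctake ?k \<zeta>), cdrop ?k \<zeta>)" if "\<zeta> \<in> ?R" for \<zeta>
      using that by (intro times_chart(3)[OF ch(1)]) auto
    show ?thesis
    proof (rule holomorphic_betweenI)
      show "openin (cspace_top (?k + r)) ?I"
      proof -
        have "openin (prod_topology (mtop M) (cspace_top r)) ((U \<inter> V) \<times> cspace r)" using op by (simp add: openin_prod_Times_iff)
        moreover have "U \<times> cspace r \<inter> V \<times> cspace r = (U \<inter> V) \<times> cspace r" by blast
        ultimately show ?thesis by (intro chart_open_image[OF times_chart(1)[OF ch(1)]]) auto
      qed
      show "((\<lambda>(x, v). ccat ?k (\<psi> x) v) \<circ> inv_into (U \<times> cspace r) (\<lambda>(x, v). ccat ?k (\<phi> x) v)) ` ?I \<subseteq> cspace (?k + r)"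
        unfolding im using tr(3) by (auto simp: inv image_subset_iff intro!: ccat_cspace cdrop_cspace)
      fix \<zeta> j assume z: "\<zeta> \<in> ?I" and j: "j < ?k + r"
      then have z: "\<zeta> \<in> ?R" unfolding im by blast
      have "hdiff (?k + r) ?R (\<lambda>\<zeta>. ccat ?k (\<psi> (inv_into U \<phi> (ctake ?k \<zeta>))) (cdrop ?k \<zeta>) j) \<zeta>"
      proof (cases "j < ?k")
        case True
        have "hdiff (?k + r) ?R (\<lambda>\<zeta>. \<psi> (inv_into U \<phi> (ctake ?k \<zeta>)) j) \<zeta>"
          by (rule hdiff_ctake[OF tr(4)]) (use z True tr(2) in auto)
        then show ?thesis using True by (simp add: ccat_def)
      next
        case False
        then show ?thesis using j hdiff_coord[of j "?k + r" ?R \<zeta>] by (simp add: ccat_def cdrop_def)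
      qed
      then show "hdiff (?k + r) ?I (\<lambda>z. ((\<lambda>(x, v). ccat ?k (\<psi> x) v) \<circ> inv_into (U \<times> cspace r) (\<lambda>(x, v). ccat ?k (\<phi> x) v)) z j) \<zeta>"
        unfolding im by (subst hdiff_cong[where f' = "\<lambda>\<zeta>. ccat ?k (\<psi> (inv_into U \<phi> (ctake ?k \<zeta>))) (cdrop ?k \<zeta>) j"]) (use z inv in auto)
    qed
  qed
  have "compatible_charts (?k + r) c c'"
    using *[OF c(1,2)] *[OF c(2,1)] unfolding compatible_charts_def c by (simp add: Int_commute)
  then show "compatible_charts (cdim (times_cspace M r)) c c'" by simp
qed

text \<open>Asking for the identity on points only also covers \<open>inv_into\<close> of the
  identity, which is unspecified elsewhere.\<close>

lemma holomorphic_map_id: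
  assumes M: "complex_manifold M" and id: "\<And>x. x \<in> points M \<Longrightarrow> f x = x"
  shows "holomorphic_map M M f"
proof (rule holomorphic_mapI)
  show ch: "is_chart (mtop M) (cdim M) c" if "c \<in> atlas M" for c using M that unfolding complex_manifold_def by blast
  then show "is_chart (mtop M) (cdim M) c" if "c \<in> atlas M" for c using that .
  show "continuous_map (mtop M) (mtop M) f" by (rule continuous_map_eq[where f = id]) (use id in auto)
  fix U \<phi> V \<psi> x j assume c: "(U, \<phi>) \<in> atlas M" "(V, \<psi>) \<in> atlas M" and x: "x \<in> U" "f x \<in> V" and j: "j < cdim M"
  have Us: "U \<subseteq> points M" and inj: "inj_on \<phi> U" using is_chartD(5,4)[OF ch[OF c(1)]] by auto
  then have eq: "{x\<in>U. f x \<in> V} = U \<inter> V" using id by auto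
  have "hdiff (cdim M) (\<phi> ` (U \<inter> V)) (\<lambda>\<xi>. \<psi> (inv_into U \<phi> \<xi>) j) (\<phi> x)"
    using x id Us j by (intro holomorphic_betweenD(4)[OF complex_manifold_transition[OF M c]]) auto
  then show "hdiff (cdim M) (\<phi> ` {x\<in>U. f x \<in> V}) (\<lambda>\<xi>. \<psi> (f (inv_into U \<phi> \<xi>)) j) (\<phi> x)"
    unfolding eq by (subst hdiff_cong[where f' = "\<lambda>\<xi>. \<psi> (inv_into U \<phi> \<xi>) j"]) (use inj Us id x in auto)
qed

text \<open>An equality of records; it lets the identity serve as a local trivialization over the
  whole base.\<close>

lemma open_submanifold_points:
  assumes "complex_manifold M"
  shows "open_submanifold M (points M) = M"
proof -
  have "U \<inter> points M = U" if "(U, \<phi>) \<in> atlas M" for U \<phi>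
    using is_chartD(5)[OF complex_manifold_chart[OF assms that]] by blast
  then have "{(U \<inter> points M, \<phi>) |U \<phi>. (U, \<phi>) \<in> atlas M} = atlas M" by force
  then show ?thesis unfolding open_submanifold_def by simp
qed

section \<open>Trivial bundles\<close>

lemma fibre_trivial_bundle: "x \<in> points M \<Longrightarrow> fibre (trivial_bundle M r) x = {x} \<times> cspace r"
  by (auto simp: fibre_def trivial_bundle_def)

lemma holomorphic_vector_bundle_trivial:
  assumes M: "complex_manifold M"
  shows "holomorphic_vector_bundle M (trivial_bundle M r)"
proof -
  let ?E = "trivial_bundle M r"
  have tot: "total ?E = times_cspace M r" "proj ?E = fst" "vrank ?E = r" by (simp_all add: trivial_bundle_def)
  note fib = fibre_trivial_bundle[where M = M and r = r]
  have T: "complex_manifold (times_cspace M r)" by (rule complex_manifold_times[OF M])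
  have pr: "holomorphic_map (times_cspace M r) M fst"
  proof (rule holomorphic_mapI)
    show "is_chart (mtop (times_cspace M r)) (cdim (times_cspace M r)) c" if "c \<in> atlas (times_cspace M r)" for c
      using T that unfolding complex_manifold_def by blast
    show "is_chart (mtop M) (cdim M) c" if "c \<in> atlas M" for c using M that unfolding complex_manifold_def by blast
    show "continuous_map (mtop (times_cspace M r)) (mtop M) fst" by (simp add: continuous_map_fst)
    fix W \<Phi> V \<psi> p j assume c: "(W, \<Phi>) \<in> atlas (times_cspace M r)" "(V, \<psi>) \<in> atlas M" and p: "p \<in> W" "fst p \<in> V" and j: "j < cdim M"
    obtain U \<phi> where U: "(U, \<phi>) \<in> atlas M" "W = U \<times> cspace r" "\<Phi> = (\<lambda>(x, v). ccat (cdim M) (\<phi> x) v)"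
      using c(1) unfolding times_cspace_atlas by auto
    note ch = complex_manifold_chart[OF M U(1)]
    note tr = holomorphic_betweenD[OF complex_manifold_transition[OF M U(1) c(2)]]
    let ?R = "\<Phi> ` {x\<in>W. fst x \<in> V}"
    have R: "\<zeta> \<in> cspace (cdim M + r) \<and> ctake (cdim M) \<zeta> \<in> \<phi> ` (U \<inter> V)" if "\<zeta> \<in> ?R" for \<zeta>
      using that is_chartD(3)[OF ch] unfolding U by (auto simp: image_subset_iff ccat_cspace)
    have inv: "fst (inv_into W \<Phi> \<zeta>) = inv_into U \<phi> (ctake (cdim M) \<zeta>)" if "\<zeta> \<in> ?R" for \<zeta>
      using times_chart(3)[OF ch, of \<zeta> r] R[OF that] unfolding U by auto
    have "hdiff (cdim M + r) ?R (\<lambda>\<zeta>. \<psi> (inv_into U \<phi> (ctake (cdim M) \<zeta>)) j) (\<Phi> p)"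
      by (rule hdiff_ctake[OF tr(4)]) (use R p j tr(2) in auto)
    then show "hdiff (cdim (times_cspace M r)) ?R (\<lambda>\<xi>. \<psi> (fst (inv_into W \<Phi> \<xi>)) j) (\<Phi> p)"
      unfolding times_cspace_simps by (subst hdiff_cong[where f' = "\<lambda>\<zeta>. \<psi> (inv_into U \<phi> (ctake (cdim M) \<zeta>)) j"]) (use p inv in auto)
  qed
  have triv: "local_trivialization M ?E (points M) id"
  proof -
    have "{e \<in> points (times_cspace M r). fst e \<in> points M} = points (times_cspace M r)" by auto
    moreover have "biholomorphic_map (times_cspace M r) (times_cspace M r) id"
      unfolding biholomorphic_map_def by (auto intro!: holomorphic_map_id[OF T] simp: inv_into_f_eq)
    ultimately have "biholomorphic_map (open_submanifold (total ?E) {e \<in> points (total ?E). proj ?E e \<in> points M})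
       (times_cspace (open_submanifold M (points M)) (vrank ?E)) id"
      unfolding tot by (simp only: open_submanifold_points[OF M] open_submanifold_points[OF T])
    then show ?thesis unfolding local_trivialization_def
      using fib by (auto simp: trivial_bundle_def)
  qed
  show ?thesis unfolding holomorphic_vector_bundle_def
  proof (intro conjI ballI allI)
    show "complex_manifold M" "complex_manifold (total ?E)" "holomorphic_map (total ?E) M (proj ?E)"
      using M T pr by (simp_all add: tot)
    fix x assume x: "x \<in> points M"
    show "vzero ?E x \<in> fibre ?E x" unfolding fib[OF x] by (simp add: trivial_bundle_def cspace_def)
    show "\<exists>U \<theta>. x \<in> U \<and> local_trivialization M ?E U \<theta>" using triv x by blast
    fix e assume e: "e \<in> fibre ?E x"
    then show "vscale ?E t e \<in> fibre ?E x" for t unfolding fib[OF x] by (auto simp: trivial_bundle_def cspace_def)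
    fix e' assume "e' \<in> fibre ?E x"
    then show "vadd ?E e e' \<in> fibre ?E x" using e unfolding fib[OF x] by (auto simp: trivial_bundle_def cspace_def)
  qed
qed

section \<open>Charts of projective space in homogeneous coordinates\<close>

lemma mem_ppt: "z \<in> ppt z"
  unfolding ppt_def by (intro CollectI exI[of _ 1]) simp

lemma ppt_scale: "t \<noteq> 0 \<Longrightarrow> ppt (\<lambda>i. t * z i) = ppt z"
proof (intro equalityI subsetI)
  fix w assume t: "t \<noteq> 0"
  { assume "w \<in> ppt (\<lambda>i. t * z i)"
    then obtain s where "s \<noteq> 0" "w = (\<lambda>i. s * (t * z i))" unfolding ppt_def by blast
    then show "w \<in> ppt z" unfolding ppt_def using t by (intro CollectI exI[of _ "s * t"]) (auto simp: mult.assoc) }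
  { assume "w \<in> ppt z"
    then obtain s where "s \<noteq> 0" "w = (\<lambda>i. s * z i)" unfolding ppt_def by blast
    then show "w \<in> ppt (\<lambda>i. t * z i)" unfolding ppt_def using t by (intro CollectI exI[of _ "s / t"]) auto }
qed

lemma ppt_eqE:
  assumes "ppt z = ppt w"
  obtains t where "t \<noteq> 0" "w = (\<lambda>i. t * z i)"
  using assms mem_ppt[of w] unfolding ppt_def by blast

text \<open>Used for the affine charts, with \<open>l\<close> a coordinate, and for
  \<open>rep\<close>, with \<open>l = dot\<close>.\<close>

lemma the_normalized:
  assumes hom: "\<And>t. l (\<lambda>i. t * z i) = t * l z" and nz: "l z \<noteq> (0::complex)"
  shows "(THE w. w \<in> ppt z \<and> l w = 1) = (\<lambda>i. z i / l z)"
proof (rule the_equality)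
  have "l (\<lambda>i. (1 / l z) * z i) = 1" using nz unfolding hom by simp
  then show "(\<lambda>i. z i / l z) \<in> ppt z \<and> l (\<lambda>i. z i / l z) = 1"
    using nz unfolding ppt_def by (auto intro!: exI[of _ "1 / l z"])
next
  fix w assume w: "w \<in> ppt z \<and> l w = 1"
  then obtain t where t: "w = (\<lambda>i. t * z i)" unfolding ppt_def by blast
  then have "t * l z = 1" using w hom by simp
  then have "t = 1 / l z" using nz by (simp add: field_simps)
  then show "w = (\<lambda>i. z i / l z)" unfolding t by simp
qed

lemma open_coord_ne: "open {z :: nat \<Rightarrow> complex. z i \<noteq> 0}"
proof -
  have "continuous_on UNIV (\<lambda>z :: nat \<Rightarrow> complex. z i)" by simp
  then show ?thesis by (intro open_Collect_neq) auto
qed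

lemma continuous_on_coord: "continuous_on S (\<lambda>z :: nat \<Rightarrow> complex. z i)"
  by (rule continuous_on_subset[OF continuous_on_product_coordinates subset_UNIV])

lemma topspace_proj_top: "topspace (proj_top k) = proj_points k"
proof
  show "topspace (proj_top k) \<subseteq> proj_points k"
    using openin_topspace[of "proj_top k"] unfolding openin_proj_top by blast
  have "{z \<in> punctured_cspace (k + 1). ppt z \<in> proj_points k} = punctured_cspace (k + 1)"
    unfolding proj_points_def by blast
  then have "openin (proj_top k) (proj_points k)" unfolding openin_proj_top by simp
  then show "proj_points k \<subseteq> topspace (proj_top k)" by (rule openin_subset)
qed

lemma continuous_map_ppt: "continuous_map (top_of_set (punctured_cspace (k + 1))) (proj_top k) ppt"
  unfolding continuous_map_def topspace_proj_top by (auto simp: openin_proj_top proj_points_def)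

context affine_cubic begin

lemma Suc_Suc_K: "n + 1 + 1 = K" by simp

abbreviation "PS \<equiv> proj_space (n + 1)"

definition aset :: "nat \<Rightarrow> ppoint set" where "aset i = ppt ` {z \<in> punctured_cspace K. z i \<noteq> 0}"
definition aff :: "nat \<Rightarrow> ppoint \<Rightarrow> nat \<Rightarrow> complex" where "aff i = snd (affine_chart (n + 1) i)"
text \<open>Inverse to the affine chart: the homogeneous coordinates whose entry at \<open>i\<close>
  is 1.\<close>

definition ins :: "nat \<Rightarrow> (nat \<Rightarrow> complex) \<Rightarrow> nat \<Rightarrow> complex" where
  "ins i w = (\<lambda>j. if j < i then w j else if j = i then 1 else w (j - 1))"
definition rep :: "ppoint \<Rightarrow> nat \<Rightarrow> complex" where "rep p = (THE z. z \<in> p \<and> dot z = 1)"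
definition DD :: "(nat \<Rightarrow> complex) set" where "DD = {z \<in> cspace K. dot z \<noteq> 0}"

lemma affine_chart_eq: "affine_chart (n + 1) i = (aset i, aff i)"
  unfolding aff_def aset_def affine_chart_def Suc_Suc_K by simp

lemma dot_scale: "dot (\<lambda>i. t * z i) = t * dot z"
  using dot_cvec[of t z] by (simp add: cvec_def)

lemma dot_zero [simp]: "dot (\<lambda>i. 0) = 0" by (simp add: dot_def)

lemma DD_punctured: "DD \<subseteq> punctured_cspace K"
  by (auto simp: DD_def punctured_cspace_def)

lemma X_DD: "X \<subseteq> DD" by (auto simp: X_def DD_def)

lemma rep_ppt: "dot z \<noteq> 0 \<Longrightarrow> rep (ppt z) = (\<lambda>i. z i / dot z)"
  unfolding rep_def by (rule the_normalized) (rule dot_scale)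

lemma rep_ppt_X: "z \<in> X \<Longrightarrow> rep (ppt z) = z"
  using rep_ppt[of z] by (auto simp: X_def)

lemma ppt_rep: "z \<in> DD \<Longrightarrow> ppt (rep (ppt z)) = ppt z"
  using rep_ppt[of z] ppt_scale[of "1 / dot z" z] by (auto simp: DD_def)

lemma aff_ppt: "z i \<noteq> 0 \<Longrightarrow> aff i (ppt z) = (\<lambda>j. z (if j < i then j else Suc j) / z i)"
proof -
  assume "z i \<noteq> 0"
  then have "(THE w. w \<in> ppt z \<and> w i = 1) = (\<lambda>j. z j / z i)"
    by (intro the_normalized[of "\<lambda>z. z i"]) auto
  then show ?thesis unfolding aff_def affine_chart_def by (simp add: Let_def)
qed

lemma ins_aff: "z i \<noteq> 0 \<Longrightarrow> ins i (aff i (ppt z)) = (\<lambda>j. z j / z i)"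
  unfolding aff_ppt ins_def by (auto simp: fun_eq_iff)

lemma inj_aff: "inj_on (aff i) (aset i)"
proof (rule inj_onI)
  fix p q assume p: "p \<in> aset i" and q: "q \<in> aset i" and eq: "aff i p = aff i q"
  obtain z w where z: "z i \<noteq> 0" "p = ppt z" and w: "w i \<noteq> 0" "q = ppt w" using p q unfolding aset_def by blast
  have "(\<lambda>j. z j / z i) = (\<lambda>j. w j / w i)" using eq z w ins_aff by metis
  then have "ppt (\<lambda>j. (1 / z i) * z j) = ppt (\<lambda>j. (1 / w i) * w j)" by simp
  then show "p = q" using z w ppt_scale[of "1 / z i" z] ppt_scale[of "1 / w i" w] by simp
qed

lemma mem_aset: "z \<in> punctured_cspace K \<Longrightarrow> ppt z \<in> aset i \<longleftrightarrow> z i \<noteq> 0"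
proof
  assume "ppt z \<in> aset i"
  then obtain w where w: "w i \<noteq> 0" "ppt w = ppt z" unfolding aset_def by force
  from ppt_eqE[OF w(2)] show "z i \<noteq> 0" using w(1) by (metis mult_eq_0_iff)
qed (auto simp: aset_def)

lemma punctured_coord: "z \<in> punctured_cspace K \<Longrightarrow> \<exists>i\<le>n + 1. z i \<noteq> 0"
proof (rule ccontr)
  assume z: "z \<in> punctured_cspace K" and "\<not> ?thesis"
  then have "z i = 0" for i by (cases "i < K") (auto simp: punctured_cspace_def cspace_def)
  then show False using z by (auto simp: punctured_cspace_def fun_eq_iff)
qed

lemma PS_simps: "mtop PS = proj_top (n + 1)" "cdim PS = n + 1"
  by (simp_all add: proj_space_def)

lemma maximal_chartD:
  assumes "(U, \<phi>) \<in> maximal_atlas PS"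
  shows "is_chart (proj_top (n + 1)) (n + 1) (U, \<phi>)"
    and "i \<le> n + 1 \<Longrightarrow> holomorphic_between (n + 1) (n + 1) (\<phi> ` (U \<inter> aset i)) (aff i \<circ> inv_into U \<phi>)"
    and "i \<le> n + 1 \<Longrightarrow> holomorphic_between (n + 1) (n + 1) (aff i ` (U \<inter> aset i)) (\<phi> \<circ> inv_into (aset i) (aff i))"
proof -
  show "is_chart (proj_top (n + 1)) (n + 1) (U, \<phi>)"
    using assms unfolding maximal_atlas_def PS_simps by simp
  assume i: "i \<le> n + 1"
  then have "affine_chart (n + 1) i \<in> affine_chart (n + 1) ` {..n + 1}" by blast
  then have "(aset i, aff i) \<in> atlas PS"
    unfolding affine_chart_eq[of i] by (simp only: proj_space_def cmanifold.simps)
  then have "compatible_charts (n + 1) (U, \<phi>) (aset i, aff i)"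
    using assms unfolding maximal_atlas_def PS_simps by blast
  then show "holomorphic_between (n + 1) (n + 1) (\<phi> ` (U \<inter> aset i)) (aff i \<circ> inv_into U \<phi>)"
    "holomorphic_between (n + 1) (n + 1) (aff i ` (U \<inter> aset i)) (\<phi> \<circ> inv_into (aset i) (aff i))"
    unfolding compatible_charts_def by auto
qed

text \<open>On the cone \<open>aff i\<close> is a quotient of coordinates, and the chart is
  compatible with it; locality removes the condition \<open>z i \<noteq> 0\<close>. Together with
  \<open>rep_chart_hdiff\<close> this lets arbitrary charts be handled in homogeneous
  coordinates.\<close>

lemma chart_ppt_hdiff:
  assumes max: "(U, \<phi>) \<in> maximal_atlas PS" and z: "z \<in> punctured_cspace K" "ppt z \<in> U" and j: "j < n + 1"
  shows "hdiff K {z \<in> punctured_cspace K. ppt z \<in> U} (\<lambda>z. \<phi> (ppt z) j) z"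
proof -
  let ?\<Omega> = "{z \<in> punctured_cspace K. ppt z \<in> U}"
  obtain i where i: "i \<le> n + 1" "z i \<noteq> 0" using punctured_coord[OF z(1)] by blast
  note h = holomorphic_betweenD[OF maximal_chartD(3)[OF max i(1)]]
  define V where "V = ?\<Omega> \<inter> {z. z i \<noteq> 0}"
  have zV: "z \<in> V" using z i by (simp add: V_def)
  have aV: "ppt w \<in> U \<inter> aset i" if "w \<in> V" for w using that by (auto simp: V_def aset_def)
  have F: "hdiff K V (\<lambda>w. aff i (ppt w) j') z" if "j' < n + 1" for j'
  proof -
    have "hdiff K V (\<lambda>w. w (if j' < i then j' else Suc j') / w i) z"
      using that i by (intro hdiff_divide hdiff_coord) auto
    then show ?thesis
      by (subst hdiff_cong[where f' = "\<lambda>w. w (if j' < i then j' else Suc j') / w i"]) (use zV in \<open>auto simp: V_def aff_ppt\<close>)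
  qed
  have "hdiff K V (\<lambda>w. (\<phi> \<circ> inv_into (aset i) (aff i)) (aff i (ppt w)) j) z"
    by (rule hdiff_compose[where F = "\<lambda>w. aff i (ppt w)" and h = "\<lambda>v. (\<phi> \<circ> inv_into (aset i) (aff i)) v j", OF h(4)[OF _ j] F])
      (use aV zV h(2) in auto)
  then have "hdiff K V (\<lambda>w. \<phi> (ppt w) j) z"
    by (subst hdiff_cong[where f' = "\<lambda>w. (\<phi> \<circ> inv_into (aset i) (aff i)) (aff i (ppt w)) j"])
      (use aV zV inj_aff[of i] in auto)
  then show ?thesis
    by (rule hdiff_local[OF _ open_coord_ne[of i]]) (use z i in \<open>auto simp: V_def punctured_cspace_def\<close>)
qed

lemma rep_affine:
  assumes "z \<in> DD" "z i \<noteq> 0"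
  shows "rep (ppt z) = (\<lambda>j. ins i (aff i (ppt z)) j / dot (ins i (aff i (ppt z))))"
  using assms unfolding ins_aff[of z i, OF assms(2)] rep_ppt[of z] DD_def
  using dot_scale[of "1 / z i" z] by (auto simp: rep_ppt)

text \<open>Seen from an affine chart, the normalized representative is \<open>ins\<close> divided
  by its value of \<open>dot\<close>, and the given chart is compatible with the affine one.\<close>

lemma rep_chart_hdiff:
  assumes max: "(U, \<phi>) \<in> maximal_atlas PS" and p: "p \<in> U" "p \<in> ppt ` DD" and j: "j < K"
  shows "hdiff (n + 1) (\<phi> ` (U \<inter> ppt ` DD)) (\<lambda>\<xi>. rep (inv_into U \<phi> \<xi>) j) (\<phi> p)"
proof -
  obtain z where z: "z \<in> DD" "p = ppt z" using p by blast
  obtain i where i: "i \<le> n + 1" "z i \<noteq> 0" using punctured_coord z DD_punctured by blast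
  note h = holomorphic_betweenD[OF maximal_chartD(2)[OF max i(1)]]
  note ch = is_chartD[OF maximal_chartD(1)[OF max]]
  have inv: "inv_into U \<phi> (\<phi> q) = q" if "q \<in> U" for q using that ch(4) by simp
  let ?V = "\<phi> ` (U \<inter> aset i)"
  have pi: "p \<in> aset i" using z i DD_punctured by (auto simp: aset_def)
  have pV: "\<phi> p \<in> ?V" using p pi by blast
  let ?F = "\<lambda>\<xi>. ins i (aff i (inv_into U \<phi> \<xi>))"
  have ih: "hdiff (n + 1) ?V (\<lambda>\<xi>. ?F \<xi> j') (\<phi> p)" if "j' < K" for j'
  proof -
    consider "j' < i" | "j' = i" | "j' > i" by linarith
    then show ?thesis
    proof cases
      case 1
      then show ?thesis using h(4)[OF pV, of j'] i unfolding ins_def by (simp add: o_def)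
    next
      case 2
      then show ?thesis unfolding ins_def by (simp add: hdiff_const)
    next
      case 3
      then show ?thesis using h(4)[OF pV, of "j' - 1"] that unfolding ins_def by (simp add: o_def)
    qed
  qed
  have dotF: "hdiff (n + 1) ?V (\<lambda>\<xi>. dot (?F \<xi>)) (\<phi> p)"
    unfolding dot_def by (intro hdiff_sum hdiff_cmult ih) auto
  have "dot (?F (\<phi> p)) = dot z / z i"
    unfolding inv[OF p(1)] unfolding z(2) ins_aff[of z i, OF i(2)] using dot_scale[of "1 / z i" z] by simp
  then have "dot (?F (\<phi> p)) \<noteq> 0" using z i by (simp add: DD_def)
  then have main: "hdiff (n + 1) ?V (\<lambda>\<xi>. ?F \<xi> j / dot (?F \<xi>)) (\<phi> p)"
    by (intro hdiff_divide ih j dotF)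
  obtain N where N: "open N" "?V = cspace (n + 1) \<inter> N"
    using h(1) unfolding openin_open by blast
  show ?thesis
  proof (rule hdiff_local[OF main N(1)])
    show "\<phi> p \<in> N" using pV N by blast
    show "\<phi> ` (U \<inter> ppt ` DD) \<inter> N \<subseteq> ?V" using N ch(3) by blast
    show "\<phi> p \<in> \<phi> ` (U \<inter> ppt ` DD)" using p by blast
    show "\<phi> ` (U \<inter> ppt ` DD) \<subseteq> cspace (n + 1)" using ch(3) by blast
    show "?V \<subseteq> cspace (n + 1)" using h(2) .
    fix \<xi> assume x: "\<xi> \<in> \<phi> ` (U \<inter> ppt ` DD) \<inter> N"
    then have "\<xi> \<in> ?V" using N ch(3) by blast
    then obtain q where q: "q \<in> U" "q \<in> aset i" "\<xi> = \<phi> q" by blast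
    obtain q' where "q' \<in> U" "q' \<in> ppt ` DD" "\<xi> = \<phi> q'" using x by blast
    then have "q \<in> ppt ` DD" using ch(4) q by (metis inj_onD)
    then obtain w where w: "w \<in> DD" "q = ppt w" by blast
    then have wi: "w i \<noteq> 0" using q(2) mem_aset DD_punctured by blast
    have e: "inv_into U \<phi> \<xi> = ppt w" using inv[OF q(1)] q(3) w(2) by simp
    show "rep (inv_into U \<phi> \<xi>) j = ?F \<xi> j / dot (?F \<xi>)"
      unfolding e by (subst rep_affine[OF w(1) wi]) simp
  qed
qed

lemma continuous_map_dot: "continuous_map (top_of_set S) euclidean dot"
proof -
  have "continuous_on S (\<lambda>z. \<Sum>i<K. a i * z i)"
    by (intro continuous_on_sum continuous_on_mult continuous_on_const continuous_on_coord)
  then show ?thesis by (simp add: dot_def[abs_def])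
qed

lemma open_DD: "\<exists>N. open N \<and> DD = punctured_cspace K \<inter> N"
proof -
  have "continuous_on UNIV dot" using continuous_map_dot[of UNIV] by simp
  then have "open {z. dot z \<noteq> 0}" by (intro open_Collect_neq) auto
  moreover have "DD = punctured_cspace K \<inter> {z. dot z \<noteq> 0}" by (auto simp: DD_def punctured_cspace_def)
  ultimately show ?thesis by blast
qed

lemma ppt_DD_subset: "ppt ` DD \<subseteq> proj_points (n + 1)"
  unfolding proj_points_def Suc_Suc_K using DD_punctured by blast

lemma openin_DD: "openin (top_of_set (punctured_cspace K)) DD"
  using open_DD unfolding openin_open by blast

lemma ppt_image_DD: "z \<in> punctured_cspace K \<Longrightarrow> ppt z \<in> ppt ` DD \<longleftrightarrow> z \<in> DD"
proof
  assume z: "z \<in> punctured_cspace K" and "ppt z \<in> ppt ` DD"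
  then obtain w where w: "w \<in> DD" "ppt w = ppt z" by force
  then obtain t where "t \<noteq> 0" "z = (\<lambda>i. t * w i)" using ppt_eqE by blast
  then show "z \<in> DD" using w z dot_scale by (auto simp: DD_def punctured_cspace_def)
qed blast

lemma openin_ppt_DD: "openin (proj_top (n + 1)) (ppt ` DD)"
proof -
  have "{z \<in> punctured_cspace K. ppt z \<in> ppt ` DD} = DD" using ppt_image_DD DD_punctured by blast
  moreover note openin_DD
  ultimately show ?thesis
    unfolding openin_proj_top Suc_Suc_K proj_points_def using DD_punctured by auto
qed

text \<open>In the quotient topology it suffices to look at preimages in the cone, where
  \<open>rep\<close> becomes division by \<open>dot z\<close>.\<close>

lemma continuous_map_rep: "continuous_map (subtopology (proj_top (n + 1)) (ppt ` DD)) euclidean rep"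
  unfolding continuous_map_def
proof (intro conjI allI impI)
  fix W :: "(nat \<Rightarrow> complex) set" assume "openin euclidean W"
  then have W: "open W" by simp
  have ts: "topspace (subtopology (proj_top (n + 1)) (ppt ` DD)) = ppt ` DD"
    using openin_subset[OF openin_ppt_DD] by (simp add: inf.absorb2)
  let ?S = "{p \<in> ppt ` DD. rep p \<in> W}"
  have eq: "{z \<in> punctured_cspace K. ppt z \<in> ?S} = DD \<inter> (\<lambda>z i. z i / dot z) -` W"
  proof -
    have "z \<in> DD \<Longrightarrow> rep (ppt z) = (\<lambda>i. z i / dot z)" for z by (simp add: DD_def rep_ppt)
    then have "ppt z \<in> ?S \<longleftrightarrow> z \<in> DD \<inter> (\<lambda>z i. z i / dot z) -` W" if "z \<in> punctured_cspace K" for z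
      unfolding mem_Collect_eq ppt_image_DD[OF that] by auto
    then show ?thesis using DD_punctured by blast
  qed
  have "continuous_on DD (\<lambda>z i. z i / dot z)"
  proof (intro continuous_on_coordinatewise_then_product continuous_on_divide)
    show "continuous_on DD dot" using continuous_map_dot[of DD] by simp
  qed (auto simp: DD_def intro: continuous_on_coord)
  from continuous_openin_preimage_gen[OF this W]
  have "openin (top_of_set DD) (DD \<inter> (\<lambda>z i. z i / dot z) -` W)" .
  then have "openin (top_of_set (punctured_cspace K)) (DD \<inter> (\<lambda>z i. z i / dot z) -` W)"
    by (rule openin_trans[OF _ openin_DD])
  then have "openin (proj_top (n + 1)) ?S"
    unfolding openin_proj_top Suc_Suc_K eq using ppt_DD_subset by blast
  then show "openin (subtopology (proj_top (n + 1)) (ppt ` DD)) {x \<in> topspace (subtopology (proj_top (n + 1)) (ppt ` DD)). rep x \<in> W}"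
    unfolding ts openin_subtopology by (intro exI[of _ ?S]) auto
qed simp

section \<open>Flattening charts\<close>

lemma tendsto_T:
  assumes "\<And>i. i < K \<Longrightarrow> ((\<lambda>w. x w i) \<longlongrightarrow> x' i) F" "\<And>i. i < K \<Longrightarrow> ((\<lambda>w. y w i) \<longlongrightarrow> y' i) F" "\<And>i. i < K \<Longrightarrow> ((\<lambda>w. z w i) \<longlongrightarrow> z' i) F"
  shows "((\<lambda>w. T (x w) (y w) (z w)) \<longlongrightarrow> T x' y' z') F"
  unfolding polar_def
proof (rule tendsto_sum)
  fix \<alpha> assume "\<alpha> \<in> multi_indices K 3"
  moreover obtain p q r where "mono_idx K \<alpha> = (p, q, r)" by (metis prod.exhaust)
  ultimately show "((\<lambda>w. case mono_idx K \<alpha> of (p, q, r) \<Rightarrow> c \<alpha> / 6 * (x w p * y w q * z w r + x w p * y w r * z w q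
      + x w q * y w p * z w r + x w q * y w r * z w p + x w r * y w p * z w q + x w r * y w q * z w p)) \<longlongrightarrow>
    (case mono_idx K \<alpha> of (p, q, r) \<Rightarrow> c \<alpha> / 6 * (x' p * y' q * z' r + x' p * y' r * z' q
      + x' q * y' p * z' r + x' q * y' r * z' p + x' r * y' p * z' q + x' r * y' q * z' p))) F"
    using mono_idx(1-3)[of \<alpha> K p q r] by (simp only: prod.case) (intro tendsto_intros assms; simp)
qed

lemma hdiff_T:
  assumes "\<And>i. i < K \<Longrightarrow> hdiff k U (\<lambda>w. x w i) p" "\<And>i. i < K \<Longrightarrow> hdiff k U (\<lambda>w. y w i) p" "\<And>i. i < K \<Longrightarrow> hdiff k U (\<lambda>w. z w i) p"
  shows "hdiff k U (\<lambda>w. T (x w) (y w) (z w)) p"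
  unfolding polar_def
proof (rule hdiff_sum)
  fix \<alpha> assume "\<alpha> \<in> multi_indices K 3"
  moreover obtain p1 q r where "mono_idx K \<alpha> = (p1, q, r)" by (metis prod.exhaust)
  ultimately show "hdiff k U (\<lambda>w. case mono_idx K \<alpha> of (p, q, r) \<Rightarrow> c \<alpha> / 6 * (x w p * y w q * z w r + x w p * y w r * z w q
      + x w q * y w p * z w r + x w q * y w r * z w p + x w r * y w p * z w q + x w r * y w q * z w p)) p"
    using mono_idx(1-3)[of \<alpha> K p1 q r] by (simp only: prod.case) (intro hdiff_cmult hdiff_add hdiff_mult assms; simp)
qed

lemma hdiff_dot: "(\<And>i. i < K \<Longrightarrow> hdiff k U (\<lambda>w. x w i) p) \<Longrightarrow> hdiff k U (\<lambda>w. dot (x w)) p"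
  unfolding dot_def by (intro hdiff_sum hdiff_cmult) auto

lemma continuous_on_T: "continuous_on S (\<lambda>\<zeta>. T \<zeta> \<zeta> \<zeta>)"
  unfolding continuous_on_def by (intro ballI tendsto_T coord_tendsto)

text \<open>With \<open>k\<close> fixed, these vectors span the kernel of \<open>dot\<close> within
  the first \<open>K\<close> coordinates. If \<open>T z z\<close> killed them all, it would be a
  multiple of \<open>dot\<close>; evaluation at \<open>z\<close>, where the cubic is 0 and
  \<open>dot z = 1\<close>, shows that the factor is 0, and \<open>z\<close> would be
  singular.\<close>

lemma exists_transversal:
  assumes "z \<in> X"
  shows "\<exists>k l. k < K \<and> l < K \<and> k \<noteq> l \<and> a k \<noteq> 0 \<and> T z z (unit_vec l - cvec (a l / a k) (unit_vec k)) \<noteq> 0"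
proof -
  have z: "T z z z = 0" "dot z = 1" using assms by (auto simp: X_def)
  then obtain k where k: "k < K" "a k \<noteq> 0" unfolding dot_def by (metis (no_types, lifting) lessThan_iff mult_zero_left sum.neutral zero_neq_one)
  have "\<exists>l<K. T z z (unit_vec l - cvec (a l / a k) (unit_vec k)) \<noteq> 0"
  proof (rule ccontr)
    assume "\<not> ?thesis"
    then have e: "T z z (unit_vec l) = a l / a k * T z z (unit_vec k)" if "l < K" for l
      using that by (auto simp: T_diff T_lin)
    have "T z z x = T z z (unit_vec k) / a k * dot x" for x
    proof -
      have "T z z x = (\<Sum>i<K. T z z (unit_vec i) * x i)" by (rule linf_expand) (auto simp: null_T3)
      also have "\<dots> = (\<Sum>i<K. T z z (unit_vec k) / a k * (a i * x i))" by (intro sum.cong) (auto simp: e)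
      finally show ?thesis by (simp add: dot_def sum_distrib_left)
    qed
    note all = this
    from all[of z] have zero: "T z z (unit_vec k) = 0" using z k by simp
    have "T z z x = 0" for x unfolding all[of x] zero by simp
    then have "null z" by (rule smooth)
    then show False using dot_null z by simp
  qed
  then obtain l where l: "l < K" "T z z (unit_vec l - cvec (a l / a k) (unit_vec k)) \<noteq> 0" by blast
  have "k \<noteq> l"
  proof
    assume "k = l"
    then show False using l k by (simp add: T_diff T_lin)
  qed
  then show ?thesis using k l by blast
qed

lemma openin_aset: "openin (proj_top (n + 1)) (aset i)"
proof -
  have "{z \<in> punctured_cspace K. ppt z \<in> aset i} = punctured_cspace K \<inter> {z. z i \<noteq> 0}" using mem_aset by blast
  then have "openin (top_of_set (punctured_cspace K)) {z \<in> punctured_cspace K. ppt z \<in> aset i}"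
    using open_coord_ne[of i] by (simp add: openin_open_Int)
  moreover have "aset i \<subseteq> proj_points (n + 1)" unfolding proj_points_def Suc_Suc_K aset_def by blast
  ultimately show ?thesis unfolding openin_proj_top Suc_Suc_K by blast
qed

lemma ins_cspace:
  assumes "w \<in> cspace (n + 1)" "i \<le> n + 1"
  shows "ins i w \<in> punctured_cspace K" "ins i w i \<noteq> 0" "aff i (ppt (ins i w)) = w"
proof -
  show 1: "ins i w i \<noteq> 0" by (simp add: ins_def)
  show "ins i w \<in> punctured_cspace K"
    using assms 1 by (auto simp: punctured_cspace_def cspace_def ins_def fun_eq_iff)
  show "aff i (ppt (ins i w)) = w"
    unfolding aff_ppt[of "ins i w" i, OF 1] by (auto simp: ins_def fun_eq_iff)
qed

lemma aff_cspace: "z \<in> punctured_cspace K \<Longrightarrow> z i \<noteq> 0 \<Longrightarrow> i \<le> n + 1 \<Longrightarrow> aff i (ppt z) \<in> cspace (n + 1)"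
  unfolding aff_ppt by (auto simp: cspace_def punctured_cspace_def)

lemma ppt_ins_aff: "z i \<noteq> 0 \<Longrightarrow> ppt (ins i (aff i (ppt z))) = ppt z"
  unfolding ins_aff using ppt_scale[of "1 / z i" z] by simp

lemma inv_aff:
  assumes "z \<in> punctured_cspace K" "z i \<noteq> 0"
  shows "inv_into (aset i) (aff i) (aff i (ppt z)) = ppt z"
  using assms inj_aff[of i] by (intro inv_into_f_f) (auto simp: aset_def)

lemma continuous_map_ppt_ins:
  assumes "i \<le> n + 1"
  shows "continuous_map (cspace_top (n + 1)) (proj_top (n + 1)) (\<lambda>w. ppt (ins i w))"
proof -
  have "continuous_on (cspace (n + 1)) (\<lambda>w. ins i w j)" for j
  proof -
    consider "j < i" | "j = i" | "j > i" by linarith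
    then show ?thesis by cases (simp_all add: ins_def continuous_on_coord)
  qed
  then have "continuous_on (cspace (n + 1)) (ins i)"
    by (rule continuous_on_coordinatewise_then_product)
  then have "continuous_map (cspace_top (n + 1)) (top_of_set (punctured_cspace K)) (ins i)"
    using ins_cspace(1)[OF _ assms] by (auto simp: continuous_map_in_subtopology)
  from continuous_map_compose[OF this continuous_map_ppt[of "n + 1", unfolded Suc_Suc_K]]
  show ?thesis by (simp add: o_def)
qed

end

text \<open>Near \<open>z0\<close> the coordinate \<open>k0\<close> is eliminated by \<open>dot = 1\<close>, and \<open>F\<close> replaces the coordinate \<open>l0\<close>. The
  inverse chart solves \<open>F = s\<close> for the coordinate \<open>l0\<close> by a contraction.\<close>

locale flat_point = affine_cubic +
  fixes z0 :: "nat \<Rightarrow> complex" and k0 l0 :: nat and \<pi> :: "nat \<Rightarrow> nat"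
  assumes z0: "z0 \<in> X" and k0: "k0 < K" "a k0 \<noteq> 0" and l0: "l0 < K" "k0 \<noteq> l0"
    and trans: "T z0 z0 (unit_vec l0 - cvec (a l0 / a k0) (unit_vec k0)) \<noteq> 0"
    and \<pi>: "bij_betw \<pi> {..<n} ({..<K} - {k0, l0})"
begin

text \<open>The direction that raises coordinate \<open>l0\<close> at unit speed and compensates in
  coordinate \<open>k0\<close> to keep \<open>dot\<close> constant.\<close>

definition dv :: "nat \<Rightarrow> complex" where "dv = unit_vec l0 - cvec (a l0 / a k0) (unit_vec k0)"
definition Zm :: "(nat \<Rightarrow> complex) \<Rightarrow> complex \<Rightarrow> nat \<Rightarrow> complex" where
  "Zm y t = (\<lambda>j. if j = l0 then t else if j = k0 then (1 - (\<Sum>i<n. a (\<pi> i) * y i) - a l0 * t) / a k0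
     else if j < K then y (inv_into {..<n} \<pi> j) else 0)"
definition fz :: "(nat \<Rightarrow> complex) \<Rightarrow> complex \<Rightarrow> complex" where "fz y t = T (Zm y t) (Zm y t) (Zm y t)"
text \<open>The difference quotient of the cubic from \<open>\<zeta>\<close> in direction
  \<open>dv\<close> with step \<open>h\<close>. \<open>D0\<close> is its value at \<open>z0\<close>
  for \<open>h = 0\<close>.\<close>

definition Gq :: "(nat \<Rightarrow> complex) \<Rightarrow> complex \<Rightarrow> complex" where
  "Gq \<zeta> h = 3 * T \<zeta> \<zeta> dv + 3 * h * T \<zeta> dv dv + h^2 * T dv dv dv"
definition "D0 = 3 * T z0 z0 dv"
definition "Bd = cmod (3 * T z0 dv dv) + 1"
text \<open>For \<open>cmod h < 2 * \<rho>\<close> the two terms of \<open>Gq\<close> that contain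
  \<open>h\<close> contribute at most \<open>cmod D0 / 4\<close>. The cap at 1 bounds the quadratic
  term by a linear one.\<close>

definition "\<rho> = min 1 (cmod D0 / (16 * (Bd + cmod (T dv dv dv))))"
definition WW :: "(nat \<Rightarrow> complex) set" where
  "WW = {\<zeta>. cmod (3 * T \<zeta> \<zeta> dv - D0) < cmod D0 / 8 \<and> cmod (3 * T \<zeta> dv dv) < Bd \<and> cmod (\<zeta> l0 - z0 l0) < \<rho>}"
definition NN :: "(nat \<Rightarrow> complex) set" where "NN = {\<zeta> \<in> cspace K. dot \<zeta> = 1} \<inter> WW"
definition \<Phi> :: "(nat \<Rightarrow> complex) \<Rightarrow> nat \<Rightarrow> complex" where
  "\<Phi> \<zeta> = (\<lambda>i. if i < n then \<zeta> (\<pi> i) else if i = n then T \<zeta> \<zeta> \<zeta> else 0)"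

lemma D0: "D0 \<noteq> 0" using trans unfolding D0_def dv_def by simp
lemma Bd: "Bd > 0" unfolding Bd_def by (simp add: add_nonneg_pos)
lemma \<rho>: "\<rho> > 0" "\<rho> \<le> 1" "16 * \<rho> * (Bd + cmod (T dv dv dv)) \<le> cmod D0"
proof -
  have p: "Bd + cmod (T dv dv dv) > 0" using Bd by (simp add: add_pos_nonneg)
  then show "\<rho> > 0" "\<rho> \<le> 1" unfolding \<rho>_def using D0 by auto
  have "\<rho> \<le> cmod D0 / (16 * (Bd + cmod (T dv dv dv)))" unfolding \<rho>_def by simp
  then show "16 * \<rho> * (Bd + cmod (T dv dv dv)) \<le> cmod D0" using p by (simp add: field_simps)
qed

text \<open>The radius \<open>2 * \<rho>\<close> allows for the difference of two
  \<open>l0\<close>-coordinates, each within \<open>\<rho>\<close> of that of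
  \<open>z0\<close>.\<close>

lemma Gq_bound:
  assumes "\<zeta> \<in> WW" "cmod h < 2 * \<rho>"
  shows "cmod (Gq \<zeta> h - D0) \<le> cmod D0 / 2" "Gq \<zeta> h \<noteq> 0" "cmod (Gq \<zeta> h) \<ge> cmod D0 / 2"
proof -
  have w: "cmod (3 * T \<zeta> \<zeta> dv - D0) < cmod D0 / 8" "cmod (3 * T \<zeta> dv dv) < Bd" using assms(1) by (auto simp: WW_def)
  have "cmod (Gq \<zeta> h - D0) = cmod ((3 * T \<zeta> \<zeta> dv - D0) + h * (3 * T \<zeta> dv dv) + h^2 * T dv dv dv)"
    by (rule arg_cong[where f = cmod]) (simp add: Gq_def algebra_simps)
  also have "\<dots> \<le> cmod (3 * T \<zeta> \<zeta> dv - D0) + cmod h * cmod (3 * T \<zeta> dv dv) + (cmod h)^2 * cmod (T dv dv dv)"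
    unfolding norm_mult[of h, symmetric] norm_power[symmetric] norm_mult[of "h^2", symmetric]
    by (intro norm_triangle_mono order_refl)
  also have "\<dots> \<le> cmod D0 / 8 + (2 * \<rho>) * Bd + (4 * \<rho>) * cmod (T dv dv dv)"
  proof -
    have "(cmod h)^2 \<le> (2 * \<rho>)^2" using assms(2) by (intro power_mono) auto
    also have "\<dots> = 4 * (\<rho> * \<rho>)" by (simp add: power2_eq_square)
    also have "\<dots> \<le> 4 * \<rho>" using \<rho>(1,2) by (simp add: mult_left_le)
    finally have "(cmod h)^2 * cmod (T dv dv dv) \<le> (4 * \<rho>) * cmod (T dv dv dv)"
      by (rule mult_right_mono) (rule norm_ge_zero)
    moreover have "cmod h * cmod (3 * T \<zeta> dv dv) \<le> (2 * \<rho>) * Bd"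
      by (rule mult_mono[OF less_imp_le[OF assms(2)] less_imp_le[OF w(2)] _ norm_ge_zero]) (use \<rho>(1) in linarith)
    ultimately show ?thesis using w(1) by linarith
  qed
  also have "\<dots> \<le> cmod D0 / 8 + 4 * \<rho> * (Bd + cmod (T dv dv dv))"
    using \<rho>(1) Bd by (simp add: algebra_simps)
  also have "\<dots> \<le> cmod D0 / 2" using \<rho>(3) norm_ge_zero[of D0] unfolding mult.assoc by linarith
  finally show *: "cmod (Gq \<zeta> h - D0) \<le> cmod D0 / 2" .
  have "cmod D0 \<le> cmod (Gq \<zeta> h) + cmod (Gq \<zeta> h - D0)"
    using norm_triangle_ineq4[of "Gq \<zeta> h" "Gq \<zeta> h - D0"] by simp
  then show "cmod (Gq \<zeta> h) \<ge> cmod D0 / 2" using * by linarith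
  then show "Gq \<zeta> h \<noteq> 0" using D0 by auto
qed

lemma dot_split: "dot \<zeta> = (\<Sum>i<n. a (\<pi> i) * \<zeta> (\<pi> i)) + a k0 * \<zeta> k0 + a l0 * \<zeta> l0"
proof -
  have "dot \<zeta> = (\<Sum>i\<in>{..<K} - {k0, l0}. a i * \<zeta> i) + (\<Sum>i\<in>{k0, l0}. a i * \<zeta> i)"
    unfolding dot_def using k0 l0 by (subst sum.subset_diff[of "{k0, l0}"]) auto
  also have "(\<Sum>i\<in>{..<K} - {k0, l0}. a i * \<zeta> i) = (\<Sum>i<n. a (\<pi> i) * \<zeta> (\<pi> i))"
    by (rule sum.reindex_bij_betw[OF \<pi>, symmetric])
  finally show ?thesis using l0 by (simp add: add.assoc)
qed

lemma \<pi>_facts: "i < n \<Longrightarrow> \<pi> i < K \<and> \<pi> i \<noteq> k0 \<and> \<pi> i \<noteq> l0 \<and> inv_into {..<n} \<pi> (\<pi> i) = i"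
  using \<pi> unfolding bij_betw_def by (auto simp: image_def)

lemma \<pi>_inv: "j < K \<Longrightarrow> j \<noteq> k0 \<Longrightarrow> j \<noteq> l0 \<Longrightarrow> inv_into {..<n} \<pi> j < n \<and> \<pi> (inv_into {..<n} \<pi> j) = j"
proof -
  assume "j < K" "j \<noteq> k0" "j \<noteq> l0"
  then have "j \<in> \<pi> ` {..<n}" using \<pi> unfolding bij_betw_def by auto
  then show ?thesis using inv_into_into[of j \<pi> "{..<n}"] f_inv_into_f[of j \<pi> "{..<n}"] by auto
qed

lemma Zm_\<pi>: "i < n \<Longrightarrow> Zm y t (\<pi> i) = y i" using \<pi>_facts[of i] by (simp add: Zm_def)
lemma Zm_l0: "Zm y t l0 = t" by (simp add: Zm_def)

lemma Zm_cspace: "Zm y t \<in> cspace K" using k0 l0 by (auto simp: Zm_def cspace_def)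

lemma dot_Zm: "dot (Zm y t) = 1"
  unfolding dot_split using k0 l0 by (simp add: Zm_\<pi>) (simp add: Zm_def)

lemma Zm_eq:
  assumes "\<zeta> \<in> cspace K" "dot \<zeta> = 1" "\<And>i. i < n \<Longrightarrow> y i = \<zeta> (\<pi> i)"
  shows "Zm y (\<zeta> l0) = \<zeta>"
proof
  fix j
  have d: "1 = (\<Sum>i<n. a (\<pi> i) * y i) + a k0 * \<zeta> k0 + a l0 * \<zeta> l0"
    using assms(2,3) unfolding dot_split by simp
  consider "j = l0" | "j = k0" "j \<noteq> l0" | "j < K" "j \<noteq> k0" "j \<noteq> l0" | "j \<ge> K" by linarith
  then show "Zm y (\<zeta> l0) j = \<zeta> j"
  proof cases
    case 2
    have "a k0 * \<zeta> k0 = 1 - (\<Sum>i<n. a (\<pi> i) * y i) - a l0 * \<zeta> l0" using d by (simp add: algebra_simps)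
    then have "(1 - (\<Sum>i<n. a (\<pi> i) * y i) - a l0 * \<zeta> l0) / a k0 = \<zeta> k0" using k0 by (metis nonzero_mult_div_cancel_left)
    then show ?thesis using 2 by (simp add: Zm_def)
  next
    case 3
    then show ?thesis using \<pi>_inv[OF 3] assms(3) by (simp add: Zm_def)
  next
    case 4
    then show ?thesis using assms(1) k0 l0 by (auto simp: Zm_def cspace_def)
  qed (simp add: Zm_def)
qed

lemma Zm_shift: "Zm y t' = Zm y t + cvec (t' - t) dv"
proof
  fix j
  show "Zm y t' j = (Zm y t + cvec (t' - t) dv) j"
    using k0 l0 by (auto simp: Zm_def dv_def unit_vec_def field_simps)
qed

lemma fz_diff: "fz y t' - fz y t = (t' - t) * Gq (Zm y t) (t' - t)"
proof -
  have "T dv (Zm y t) (Zm y t) = T (Zm y t) (Zm y t) dv" "T (Zm y t) dv (Zm y t) = T (Zm y t) (Zm y t) dv"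
    "T dv dv (Zm y t) = T (Zm y t) dv dv" "T dv (Zm y t) dv = T (Zm y t) dv dv"
    by (metis T_swap12 T_swap23)+
  then show ?thesis
    unfolding fz_def Gq_def Zm_shift[of y t' t] T_lin by (simp add: algebra_simps power2_eq_square)
qed

lemma NN_Zm:
  assumes "\<zeta> \<in> NN" "\<And>i. i < n \<Longrightarrow> y i = \<zeta> (\<pi> i)"
  shows "\<zeta> = Zm y (\<zeta> l0)"
  using Zm_eq[of \<zeta> y] assms by (simp add: NN_def)

lemma NN_l0: "\<zeta> \<in> NN \<Longrightarrow> \<zeta>' \<in> NN \<Longrightarrow> cmod (\<zeta> l0 - \<zeta>' l0) < 2 * \<rho>"
proof -
  assume "\<zeta> \<in> NN" "\<zeta>' \<in> NN"
  then have "cmod (\<zeta> l0 - z0 l0) < \<rho>" "cmod (\<zeta>' l0 - z0 l0) < \<rho>" by (auto simp: NN_def WW_def)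
  then show ?thesis using norm_triangle_ineq4[of "\<zeta> l0 - z0 l0" "\<zeta>' l0 - z0 l0"] by simp
qed

lemma z0_NN: "z0 \<in> NN"
  using z0 D0 \<rho>(1) by (auto simp: NN_def WW_def X_def D0_def Bd_def)

text \<open>Points with the same first \<open>n\<close> chart coordinates differ by a multiple of
  \<open>dv\<close>, and the cubic separates them because \<open>Gq\<close> does not vanish.\<close>

lemma inj_\<Phi>: "inj_on \<Phi> NN"
proof (rule inj_onI)
  fix \<zeta> \<zeta>' assume z: "\<zeta> \<in> NN" "\<zeta>' \<in> NN" and eq: "\<Phi> \<zeta> = \<Phi> \<zeta>'"
  have y: "\<zeta>' (\<pi> i) = \<zeta> (\<pi> i)" if "i < n" for i using fun_cong[OF eq, of i] that by (simp add: \<Phi>_def)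
  have F: "T \<zeta> \<zeta> \<zeta> = T \<zeta>' \<zeta>' \<zeta>'" using fun_cong[OF eq, of n] by (simp add: \<Phi>_def)
  define w where "w = (\<lambda>i. \<zeta> (\<pi> i))"
  have zz: "\<zeta> = Zm w (\<zeta> l0)" "\<zeta>' = Zm w (\<zeta>' l0)"
    using NN_Zm[OF z(1), of w] NN_Zm[OF z(2), of w] y by (auto simp: w_def)
  have "fz w (\<zeta>' l0) = fz w (\<zeta> l0)" unfolding fz_def using zz F by simp
  then have "(\<zeta>' l0 - \<zeta> l0) * Gq \<zeta> (\<zeta>' l0 - \<zeta> l0) = 0" using fz_diff[of w "\<zeta>' l0" "\<zeta> l0"] zz by simp
  moreover have "Gq \<zeta> (\<zeta>' l0 - \<zeta> l0) \<noteq> 0"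
    using z NN_l0[OF z(2,1)] by (intro Gq_bound) (auto simp: NN_def)
  ultimately show "\<zeta> = \<zeta>'" using zz by simp
qed

lemma open_WW: "open WW"
proof -
  have c: "continuous_on UNIV (\<lambda>\<zeta>. T \<zeta> \<zeta> dv)" "continuous_on UNIV (\<lambda>\<zeta>. T \<zeta> dv dv)"
    unfolding continuous_on_def by (intro ballI tendsto_T coord_tendsto tendsto_const)+
  have "open {\<zeta>. cmod (3 * T \<zeta> \<zeta> dv - D0) < cmod D0 / 8}" "open {\<zeta>. cmod (3 * T \<zeta> dv dv) < Bd}"
    "open {\<zeta>::nat \<Rightarrow> complex. cmod (\<zeta> l0 - z0 l0) < \<rho>}"
    by (intro open_Collect_less continuous_on_norm continuous_on_diff continuous_on_mult continuous_on_const c continuous_on_coord)+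
  then show ?thesis unfolding WW_def by (intro open_Collect_conj)
qed

lemma Zm_tendsto:
  assumes "\<And>i. i < n \<Longrightarrow> ((\<lambda>w. y w i) \<longlongrightarrow> y' i) F" "(t \<longlongrightarrow> t') F"
  shows "((\<lambda>w. Zm (y w) (t w) j) \<longlongrightarrow> Zm y' t' j) F"
proof -
  consider "j = l0" | "j = k0" "j \<noteq> l0" | "j < K" "j \<noteq> k0" "j \<noteq> l0" | "j \<ge> K" "j \<noteq> k0" "j \<noteq> l0" by linarith
  then show ?thesis
  proof cases
    case 2
    have "((\<lambda>w. (1 - (\<Sum>i<n. a (\<pi> i) * y w i) - a l0 * t w) / a k0) \<longlongrightarrow> (1 - (\<Sum>i<n. a (\<pi> i) * y' i) - a l0 * t') / a k0) F"
      using k0 by (intro tendsto_intros assms) auto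
    then show ?thesis using 2 by (simp add: Zm_def)
  next
    case 3
    then show ?thesis using assms(1) \<pi>_inv[OF 3] by (simp add: Zm_def)
  qed (use assms in \<open>simp_all add: Zm_def\<close>)
qed

lemma hdiff_Zm:
  assumes "\<And>i. i < n \<Longrightarrow> hdiff k U (\<lambda>w. y w i) p" "hdiff k U t p"
  shows "hdiff k U (\<lambda>w. Zm (y w) (t w) j) p"
proof -
  consider "j = l0" | "j = k0" "j \<noteq> l0" | "j < K" "j \<noteq> k0" "j \<noteq> l0" | "j \<ge> K" "j \<noteq> k0" "j \<noteq> l0" by linarith
  then show ?thesis
  proof cases
    case 2
    have "hdiff k U (\<lambda>w. (1 - (\<Sum>i<n. a (\<pi> i) * y w i) - a l0 * t w) / a k0) p"
      using k0 by (intro hdiff_divide hdiff_diff hdiff_sum hdiff_cmult hdiff_const assms) auto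
    then show ?thesis using 2 by (simp add: Zm_def)
  next
    case 3
    then show ?thesis using assms(1) \<pi>_inv[OF 3] by (simp add: Zm_def)
  qed (use assms in \<open>simp_all add: Zm_def hdiff_const\<close>)
qed

lemma open_Zm: "open {p :: (nat \<Rightarrow> complex) \<times> complex. Zm (fst p) (snd p) \<in> WW}"
proof -
  have "continuous_on UNIV (\<lambda>p :: (nat \<Rightarrow> complex) \<times> complex. Zm (fst p) (snd p))"
    unfolding continuous_on_def
  proof (intro ballI tendsto_funI Zm_tendsto)
    fix p :: "(nat \<Rightarrow> complex) \<times> complex" and i
    have "(fst \<longlongrightarrow> fst p) (at p within UNIV)" "(snd \<longlongrightarrow> snd p) (at p within UNIV)" by (auto intro: tendsto_intros)
    then show "((\<lambda>x. fst x i) \<longlongrightarrow> fst p i) (at p within UNIV)" "(snd \<longlongrightarrow> snd p) (at p within UNIV)"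
      using isCont_tendsto_compose[of "fst p" "\<lambda>w. w i" fst] coord_tendsto[of i "fst p" UNIV] by (auto simp: isCont_def)
  qed
  from open_vimage[OF open_WW this] show ?thesis by (simp add: vimage_def)
qed

text \<open>Newton's iteration with the derivative frozen at \<open>D0\<close>. As \<open>Gq\<close>
  stays within \<open>cmod D0 / 2\<close> of \<open>D0\<close>, the map contracts by 1/2; the last
  hypothesis lets the centre move by at most \<open>\<eta> / 2\<close>, so the ball is
  invariant.\<close>

lemma solve:
  assumes "\<And>t. t \<in> cball t1 \<eta> \<Longrightarrow> Zm y t \<in> WW" "\<eta> > 0" "cmod (fz y t1 - s) \<le> \<eta> * cmod D0 / 2"
  shows "\<exists>t\<in>cball t1 \<eta>. fz y t = s"
proof -
  define g where "g = (\<lambda>t. t - (fz y t - s) / D0)"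
  have lip: "dist (g t) (g t') \<le> 1/2 * dist t t'" if "t \<in> cball t1 \<eta>" "t' \<in> cball t1 \<eta>" for t t'
  proof -
    have W: "Zm y t \<in> WW" "Zm y t' \<in> WW" using that assms(1) by auto
    have l: "cmod (t' - t) < 2 * \<rho>"
    proof -
      have "cmod (t - z0 l0) < \<rho>" "cmod (t' - z0 l0) < \<rho>" using W by (auto simp: WW_def Zm_l0)
      then show ?thesis using norm_triangle_ineq4[of "t' - z0 l0" "t - z0 l0"] by simp
    qed
    have "g t' - g t = (t' - t) * ((D0 - Gq (Zm y t) (t' - t)) / D0)"
    proof -
      have "fz y t' = fz y t + (t' - t) * Gq (Zm y t) (t' - t)" using fz_diff[of y t' t] by (simp add: algebra_simps)
      note eq = this
      show ?thesis unfolding g_def eq using D0 by (simp add: field_simps)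
    qed
    then have "cmod (g t' - g t) = cmod (t' - t) * (cmod (Gq (Zm y t) (t' - t) - D0) / cmod D0)"
      by (simp add: norm_mult norm_divide norm_minus_commute)
    also have "\<dots> \<le> cmod (t' - t) * (1/2)"
      using Gq_bound(1)[OF W(1) l] D0 by (intro mult_left_mono) (auto simp: field_simps)
    finally show ?thesis by (simp add: dist_norm norm_minus_commute mult.commute)
  qed
  have t1: "t1 \<in> cball t1 \<eta>" using assms(2) by simp
  have "g t \<in> cball t1 \<eta>" if t: "t \<in> cball t1 \<eta>" for t
  proof -
    have "dist t1 (g t1) \<le> \<eta> / 2" using assms(3) D0 unfolding g_def dist_norm by (simp add: norm_divide field_simps)
    moreover have "dist (g t1) (g t) \<le> 1/2 * \<eta>" using lip[OF t1 t] t by simp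
    ultimately show ?thesis using dist_triangle[of t1 "g t" "g t1"] by simp
  qed
  then have "g ` cball t1 \<eta> \<subseteq> cball t1 \<eta>" by blast
  moreover have "complete (cball t1 \<eta>)" "cball t1 \<eta> \<noteq> {}" using t1 by (auto intro: compact_imp_complete)
  ultimately have "\<exists>!t\<in>cball t1 \<eta>. g t = t"
    using lip by (intro Banach_fix[where c = "1/2"]) auto
  then obtain t where "t \<in> cball t1 \<eta>" "g t = t" by blast
  then show ?thesis unfolding g_def using D0 by auto
qed

lemma fz_tendsto: "((\<lambda>\<xi>. fz \<xi> t) \<longlongrightarrow> fz \<xi>1 t) (at \<xi>1 within S)"
  unfolding fz_def by (intro tendsto_T Zm_tendsto coord_tendsto tendsto_const)

lemma openin_\<Phi>: "openin (cspace_top (n + 1)) (\<Phi> ` NN)"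
proof (subst openin_subopen, intro ballI)
  fix \<xi>1 assume "\<xi>1 \<in> \<Phi> ` NN"
  then obtain \<zeta>1 where z1: "\<zeta>1 \<in> NN" "\<xi>1 = \<Phi> \<zeta>1" by blast
  have zm1: "\<zeta>1 = Zm \<xi>1 (\<zeta>1 l0)" using NN_Zm[OF z1(1), of \<xi>1] z1(2) by (simp add: \<Phi>_def)
  let ?t1 = "\<zeta>1 l0"
  have "(\<xi>1, ?t1) \<in> {p. Zm (fst p) (snd p) \<in> WW}" using zm1 z1 by (simp add: NN_def)
  then obtain A B where AB: "open A" "open B" "\<xi>1 \<in> A" "?t1 \<in> B" "A \<times> B \<subseteq> {p. Zm (fst p) (snd p) \<in> WW}"
    using open_Zm by (elim open_prod_elim[of _ "(\<xi>1, ?t1)"]) auto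
  obtain \<eta> where \<eta>: "\<eta> > 0" "cball ?t1 \<eta> \<subseteq> B" using AB(2,4) open_contains_cball by blast
  \<comment> \<open>The initial error that \<open>solve\<close> tolerates at the centre
    \<open>?t1\<close>.\<close>
  define C where "C = {\<xi>. cmod (fz \<xi> ?t1 - \<xi> n) < \<eta> * cmod D0 / 2}"
  have "continuous_on UNIV (\<lambda>\<xi>. fz \<xi> ?t1)" unfolding continuous_on_def using fz_tendsto by blast
  then have "open C" unfolding C_def
    by (intro open_Collect_less continuous_on_norm continuous_on_diff continuous_on_coord continuous_on_const)
  have "fz \<xi>1 ?t1 = T \<zeta>1 \<zeta>1 \<zeta>1" by (simp only: fz_def zm1[symmetric])
  moreover have "\<xi>1 n = T \<zeta>1 \<zeta>1 \<zeta>1" by (simp add: z1(2) \<Phi>_def)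
  ultimately have "fz \<xi>1 ?t1 = \<xi>1 n" by simp
  then have "\<xi>1 \<in> C" unfolding C_def using \<eta> D0 by simp
  have sub: "cspace (n + 1) \<inter> (A \<inter> C) \<subseteq> \<Phi> ` NN"
  proof
    fix \<xi> assume x: "\<xi> \<in> cspace (n + 1) \<inter> (A \<inter> C)"
    have W: "Zm \<xi> t \<in> WW" if "t \<in> cball ?t1 \<eta>" for t
    proof -
      have "(\<xi>, t) \<in> A \<times> B" using x that \<eta>(2) by auto
      then show ?thesis using AB(5) by auto
    qed
    obtain t where t: "t \<in> cball ?t1 \<eta>" "fz \<xi> t = \<xi> n"
      using solve[of ?t1 \<eta> \<xi> "\<xi> n"] W \<eta>(1) x unfolding C_def by force
    have "Zm \<xi> t \<in> NN" using W[OF t(1)] Zm_cspace dot_Zm by (simp add: NN_def)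
    moreover have "\<Phi> (Zm \<xi> t) = \<xi>"
      using x t(2) by (auto simp: \<Phi>_def Zm_\<pi> fz_def cspace_def fun_eq_iff)
    ultimately show "\<xi> \<in> \<Phi> ` NN" by (metis image_eqI)
  qed
  have "\<xi>1 \<in> cspace (n + 1)" unfolding z1(2) by (auto simp: \<Phi>_def cspace_def)
  then show "\<exists>S. openin (cspace_top (n + 1)) S \<and> \<xi>1 \<in> S \<and> S \<subseteq> \<Phi> ` NN"
    using sub AB(1,3) \<open>open C\<close> \<open>\<xi>1 \<in> C\<close> by (intro exI[of _ "cspace (n + 1) \<inter> (A \<inter> C)"]) (auto intro: openin_open_Int)
qed

definition \<Psi> :: "(nat \<Rightarrow> complex) \<Rightarrow> nat \<Rightarrow> complex" where "\<Psi> = inv_into NN \<Phi>"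

lemma \<Psi>:
  assumes "\<xi> \<in> \<Phi> ` NN"
  shows "\<Psi> \<xi> \<in> NN" "\<Phi> (\<Psi> \<xi>) = \<xi>" "\<Psi> \<xi> = Zm \<xi> (\<Psi> \<xi> l0)" "fz \<xi> (\<Psi> \<xi> l0) = \<xi> n"
proof -
  show 1: "\<Psi> \<xi> \<in> NN" "\<Phi> (\<Psi> \<xi>) = \<xi>" using assms by (auto simp: \<Psi>_def inv_into_into f_inv_into_f)
  have "\<xi> i = \<Psi> \<xi> (\<pi> i)" if "i < n" for i using fun_cong[OF 1(2), of i] that by (simp add: \<Phi>_def)
  then show 3: "\<Psi> \<xi> = Zm \<xi> (\<Psi> \<xi> l0)" by (intro NN_Zm 1)
  show "fz \<xi> (\<Psi> \<xi> l0) = \<xi> n" unfolding fz_def 3[symmetric] using fun_cong[OF 1(2), of n] by (simp add: \<Phi>_def)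
qed

lemma \<Psi>\<Phi>: "\<zeta> \<in> NN \<Longrightarrow> \<Psi> (\<Phi> \<zeta>) = \<zeta>" unfolding \<Psi>_def using inj_\<Phi> by simp

text \<open>Implicit differentiation from the identity
  \<open>(\<tau> \<xi> - \<tau> \<xi>1) * Q \<xi> = R \<xi>\<close>. Since \<open>R\<close> tends to
  0 and \<open>Q\<close> is bounded away from 0, \<open>\<tau>\<close> is continuous at
  \<open>\<xi>1\<close>; hence so is \<open>Q\<close>, and division by \<open>Q\<close> gives the
  Caratheodory coefficients.\<close>

lemma hdiff_\<Psi>_l0:
  assumes x1: "\<xi>1 \<in> \<Phi> ` NN"
  shows "hdiff (n + 1) (\<Phi> ` NN) (\<lambda>\<xi>. \<Psi> \<xi> l0) \<xi>1"
proof -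
  define \<tau> where "\<tau> = (\<lambda>\<xi>. \<Psi> \<xi> l0)"
  have "hdiff (n + 1) (\<Phi> ` NN) (\<lambda>\<xi>. fz \<xi> (\<tau> \<xi>1)) \<xi>1"
    unfolding fz_def by (intro hdiff_T hdiff_Zm hdiff_const hdiff_coord) auto
  then obtain E where E: "\<And>\<xi>. \<xi> \<in> \<Phi> ` NN \<Longrightarrow> fz \<xi> (\<tau> \<xi>1) - fz \<xi>1 (\<tau> \<xi>1) = (\<Sum>i<n+1. E i \<xi> * (\<xi> i - \<xi>1 i))"
      "\<And>i. i < n + 1 \<Longrightarrow> (E i \<longlongrightarrow> E i \<xi>1) (at \<xi>1 within \<Phi> ` NN)"
    by (rule hdiffE) blast
  define Q where "Q = (\<lambda>\<xi>. Gq (\<Psi> \<xi>) (\<tau> \<xi>1 - \<tau> \<xi>))"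
  have Q: "Q \<xi> \<noteq> 0" "cmod (Q \<xi>) \<ge> cmod D0 / 2" if "\<xi> \<in> \<Phi> ` NN" for \<xi>
    using Gq_bound(2,3)[of "\<Psi> \<xi>" "\<tau> \<xi>1 - \<tau> \<xi>"] \<Psi>(1)[OF that] NN_l0[OF \<Psi>(1)[OF x1] \<Psi>(1)[OF that]]
    unfolding Q_def \<tau>_def NN_def by auto
  define R where "R = (\<lambda>\<xi>. \<Sum>i<n+1. ((if i = n then 1 else 0) - E i \<xi>) * (\<xi> i - \<xi>1 i))"
  have main: "(\<tau> \<xi> - \<tau> \<xi>1) * Q \<xi> = R \<xi>" if x: "\<xi> \<in> \<Phi> ` NN" for \<xi>
  proof -
    have "fz \<xi> (\<tau> \<xi>1) - fz \<xi> (\<tau> \<xi>) = (\<tau> \<xi>1 - \<tau> \<xi>) * Q \<xi>"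
      unfolding Q_def using fz_diff[of \<xi> "\<tau> \<xi>1" "\<tau> \<xi>"] \<Psi>(3)[OF x] by (simp add: \<tau>_def)
    moreover have "fz \<xi> (\<tau> \<xi>) = \<xi> n" "fz \<xi>1 (\<tau> \<xi>1) = \<xi>1 n" using \<Psi>(4)[OF x] \<Psi>(4)[OF x1] by (auto simp: \<tau>_def)
    moreover have "R \<xi> = (\<Sum>i<n+1. (if i = n then 1 else 0) * (\<xi> i - \<xi>1 i)) - (\<Sum>i<n+1. E i \<xi> * (\<xi> i - \<xi>1 i))"
      unfolding R_def left_diff_distrib sum_subtractf ..
    moreover have "(\<Sum>i<n+1. (if i = n then 1 else 0) * (\<xi> i - \<xi>1 i)) = \<xi> n - \<xi>1 n"
      by (simp add: if_distrib[of "\<lambda>t. t * _"] cong: if_cong)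
    ultimately have "R \<xi> = (fz \<xi> (\<tau> \<xi>) - fz \<xi>1 (\<tau> \<xi>1)) - (fz \<xi> (\<tau> \<xi>1) - fz \<xi>1 (\<tau> \<xi>1))"
      unfolding E(1)[OF x] by (simp only:)
    also have "\<dots> = - ((\<tau> \<xi>1 - \<tau> \<xi>) * Q \<xi>)" unfolding \<open>fz \<xi> (\<tau> \<xi>1) - fz \<xi> (\<tau> \<xi>) = _\<close>[symmetric] by simp
    finally show ?thesis by (simp add: algebra_simps)
  qed
  have ev: "eventually (\<lambda>\<xi>. \<xi> \<in> \<Phi> ` NN) (at \<xi>1 within \<Phi> ` NN)"
    unfolding eventually_at_topological by (intro exI[of _ UNIV]) auto
  have "((\<lambda>\<xi>. R \<xi>) \<longlongrightarrow> (\<Sum>i<n+1. ((if i = n then 1 else 0) - E i \<xi>1) * (\<xi>1 i - \<xi>1 i))) (at \<xi>1 within \<Phi> ` NN)"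
    unfolding R_def by (intro tendsto_sum tendsto_mult tendsto_diff tendsto_const E(2) coord_tendsto) simp
  then have "(R \<longlongrightarrow> 0) (at \<xi>1 within \<Phi> ` NN)" by simp
  then have "((\<lambda>\<xi>. 2 / cmod D0 * cmod (R \<xi>)) \<longlongrightarrow> 2 / cmod D0 * cmod 0) (at \<xi>1 within \<Phi> ` NN)"
    by (intro tendsto_intros)
  then have R0: "((\<lambda>\<xi>. 2 / cmod D0 * cmod (R \<xi>)) \<longlongrightarrow> 0) (at \<xi>1 within \<Phi> ` NN)" by simp
  have "((\<lambda>\<xi>. \<tau> \<xi> - \<tau> \<xi>1) \<longlongrightarrow> 0) (at \<xi>1 within \<Phi> ` NN)"
  proof (rule Lim_null_comparison[OF _ R0])
    show "\<forall>\<^sub>F \<xi> in at \<xi>1 within \<Phi> ` NN. norm (\<tau> \<xi> - \<tau> \<xi>1) \<le> 2 / cmod D0 * cmod (R \<xi>)"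
      using ev
    proof eventually_elim
      case (elim \<xi>)
      have "cmod (\<tau> \<xi> - \<tau> \<xi>1) * (cmod D0 / 2) \<le> cmod (\<tau> \<xi> - \<tau> \<xi>1) * cmod (Q \<xi>)"
        by (intro mult_left_mono Q elim) auto
      also have "\<dots> = cmod (R \<xi>)" using main[OF elim] by (metis norm_mult)
      finally show ?case using D0 by (simp add: field_simps)
    qed
  qed
  then have \<tau>t: "(\<tau> \<longlongrightarrow> \<tau> \<xi>1) (at \<xi>1 within \<Phi> ` NN)" by (simp add: LIM_zero_iff)
  have \<Psi>t: "((\<lambda>\<xi>. \<Psi> \<xi> i) \<longlongrightarrow> \<Psi> \<xi>1 i) (at \<xi>1 within \<Phi> ` NN)" for i
  proof -
    have "((\<lambda>\<xi>. Zm \<xi> (\<tau> \<xi>) i) \<longlongrightarrow> Zm \<xi>1 (\<tau> \<xi>1) i) (at \<xi>1 within \<Phi> ` NN)"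
      by (intro Zm_tendsto coord_tendsto \<tau>t)
    moreover have "eventually (\<lambda>\<xi>. Zm \<xi> (\<tau> \<xi>) i = \<Psi> \<xi> i) (at \<xi>1 within \<Phi> ` NN)"
      using ev by eventually_elim (simp only: \<tau>_def \<Psi>(3)[symmetric])
    ultimately have "((\<lambda>\<xi>. \<Psi> \<xi> i) \<longlongrightarrow> Zm \<xi>1 (\<tau> \<xi>1) i) (at \<xi>1 within \<Phi> ` NN)"
      by (rule Lim_transform_eventually)
    then show ?thesis by (simp only: \<tau>_def \<Psi>(3)[OF x1, symmetric])
  qed
  have Qt: "(Q \<longlongrightarrow> Q \<xi>1) (at \<xi>1 within \<Phi> ` NN)"
    unfolding Q_def Gq_def by (intro tendsto_intros tendsto_T \<Psi>t \<tau>t)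
  show ?thesis
  proof (rule hdiffI[where g = "\<lambda>i \<xi>. ((if i = n then 1 else 0) - E i \<xi>) / Q \<xi>"])
    fix \<xi> assume x: "\<xi> \<in> \<Phi> ` NN"
    have "\<tau> \<xi> - \<tau> \<xi>1 = R \<xi> / Q \<xi>" using main[OF x] Q(1)[OF x] by (simp add: field_simps)
    then show "\<Psi> \<xi> l0 - \<Psi> \<xi>1 l0 = (\<Sum>i<n+1. ((if i = n then 1 else 0) - E i \<xi>) / Q \<xi> * (\<xi> i - \<xi>1 i))"
      unfolding R_def \<tau>_def sum_divide_distrib by simp
  next
    fix i assume "i < n + 1"
    then show "((\<lambda>\<xi>. ((if i = n then 1 else 0) - E i \<xi>) / Q \<xi>) \<longlongrightarrow> ((if i = n then 1 else 0) - E i \<xi>1) / Q \<xi>1) (at \<xi>1 within \<Phi> ` NN)"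
      by (intro tendsto_divide tendsto_diff tendsto_const E(2) Qt Q(1)[OF x1])
  qed
qed

lemma hdiff_\<Psi>:
  assumes "\<xi>1 \<in> \<Phi> ` NN"
  shows "hdiff (n + 1) (\<Phi> ` NN) (\<lambda>\<xi>. \<Psi> \<xi> j) \<xi>1"
proof -
  have "hdiff (n + 1) (\<Phi> ` NN) (\<lambda>\<xi>. Zm \<xi> (\<Psi> \<xi> l0) j) \<xi>1"
    by (intro hdiff_Zm hdiff_\<Psi>_l0 assms hdiff_coord) simp
  then show ?thesis
    by (subst hdiff_cong[where f' = "\<lambda>\<xi>. Zm \<xi> (\<Psi> \<xi> l0) j"])
      (simp_all only: \<Psi>(3)[symmetric] assms)
qed

definition UU :: "ppoint set" where "UU = ppt ` NN"
definition ph :: "ppoint \<Rightarrow> nat \<Rightarrow> complex" where "ph p = \<Phi> (rep p)"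

lemma NN_DD: "NN \<subseteq> DD" by (auto simp: NN_def DD_def)
lemma rep_NN: "\<zeta> \<in> NN \<Longrightarrow> rep (ppt \<zeta>) = \<zeta>" by (simp add: rep_ppt NN_def)
lemma ph_ppt: "\<zeta> \<in> NN \<Longrightarrow> ph (ppt \<zeta>) = \<Phi> \<zeta>" by (simp add: ph_def rep_NN)
lemma ph_UU: "ph ` UU = \<Phi> ` NN" unfolding UU_def image_image by (intro image_cong refl ph_ppt)

lemma inj_ph: "inj_on ph UU"
proof (rule inj_onI)
  fix p q assume "p \<in> UU" "q \<in> UU" and eq: "ph p = ph q"
  then obtain z w where zw: "z \<in> NN" "w \<in> NN" "p = ppt z" "q = ppt w" unfolding UU_def by blast
  then have "z = w" using eq inj_\<Phi> ph_ppt by (metis inj_onD)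
  then show "p = q" using zw by simp
qed

lemma inv_ph: "\<xi> \<in> \<Phi> ` NN \<Longrightarrow> inv_into UU ph \<xi> = ppt (\<Psi> \<xi>)"
  using \<Psi>(1,2)[of \<xi>] inj_ph ph_ppt[of "\<Psi> \<xi>"] by (intro inv_into_f_eq) (auto simp: UU_def)

lemma openin_UU: "openin (proj_top (n + 1)) UU"
proof -
  have "openin (subtopology (proj_top (n + 1)) (ppt ` DD)) {p \<in> topspace (subtopology (proj_top (n + 1)) (ppt ` DD)). rep p \<in> WW}"
    using open_WW by (intro openin_continuous_map_preimage[OF continuous_map_rep]) simp
  moreover have "topspace (subtopology (proj_top (n + 1)) (ppt ` DD)) = ppt ` DD"
    using openin_subset[OF openin_ppt_DD] by (simp add: inf.absorb2)
  moreover have "{p \<in> ppt ` DD. rep p \<in> WW} = UU"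
  proof (intro equalityI subsetI)
    fix p assume "p \<in> {p \<in> ppt ` DD. rep p \<in> WW}"
    then obtain z where z: "z \<in> DD" "p = ppt z" "rep p \<in> WW" by blast
    have r: "rep p = (\<lambda>i. z i / dot z)" using z by (simp add: rep_ppt DD_def)
    have "dot (rep p) = 1" unfolding r using dot_scale[of "1 / dot z" z] z by (simp add: DD_def)
    moreover have "rep p \<in> cspace K" unfolding r using z by (auto simp: DD_def cspace_def)
    ultimately have "rep p \<in> NN" using z by (simp add: NN_def)
    then show "p \<in> UU" using ppt_rep[OF z(1)] z(2) unfolding UU_def by (metis image_eqI)
  next
    fix p assume "p \<in> UU"
    then obtain z where z: "z \<in> NN" "p = ppt z" unfolding UU_def by blast
    then show "p \<in> {p \<in> ppt ` DD. rep p \<in> WW}" using NN_DD rep_NN by (auto simp: NN_def)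
  qed
  ultimately show ?thesis using openin_trans_full openin_ppt_DD by metis
qed

lemma chart_ph: "is_chart (proj_top (n + 1)) (n + 1) (UU, ph)"
proof (rule is_chartI[OF openin_UU])
  show "openin (cspace_top (n + 1)) (ph ` UU)" unfolding ph_UU by (rule openin_\<Phi>)
  have cr: "continuous_map (subtopology (proj_top (n + 1)) UU) euclidean rep"
    using NN_DD by (intro continuous_map_from_subtopology_mono[OF continuous_map_rep]) (auto simp: UU_def)
  show "continuous_map (subtopology (proj_top (n + 1)) UU) euclidean ph"
  proof (rule continuous_map_funI)
    fix i
    have "continuous_map euclidean euclidean (\<lambda>\<zeta>. \<Phi> \<zeta> i)"
      using continuous_on_T[of UNIV] by (cases "i < n"; cases "i = n") (auto simp: \<Phi>_def continuous_on_coord)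
    from continuous_map_compose[OF cr this]
    show "continuous_map (subtopology (proj_top (n + 1)) UU) euclidean (\<lambda>p. ph p i)" by (simp add: o_def ph_def)
  qed
  show "continuous_map (top_of_set (ph ` UU)) (proj_top (n + 1)) (\<lambda>\<xi>. ppt (\<Psi> \<xi>))"
  proof -
    have "continuous_on (\<Phi> ` NN) (\<lambda>\<xi>. \<Psi> \<xi> j)" for j
      unfolding continuous_on_def using hdiff_tendsto[OF hdiff_\<Psi>] by blast
    then have "continuous_map (top_of_set (ph ` UU)) (top_of_set (punctured_cspace K)) \<Psi>"
      unfolding ph_UU continuous_map_in_subtopology
      using \<Psi>(1) NN_DD DD_punctured by (intro conjI continuous_map_funI) auto
    from continuous_map_compose[OF this continuous_map_ppt[of "n + 1", unfolded Suc_Suc_K]]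
    show ?thesis by (simp add: o_def)
  qed
  show "ppt (\<Psi> (ph p)) = p" if "p \<in> UU" for p
    using that ph_ppt \<Psi>\<Phi> by (auto simp: UU_def)
qed

text \<open>Both transitions to an affine chart are explicit: quotients of coordinates of
  \<open>\<Psi>\<close> one way, \<open>\<Phi>\<close> of the normalized \<open>ins i w\<close> the
  other way.\<close>

lemma ph_maximal: "(UU, ph) \<in> maximal_atlas PS"
proof -
  have "compatible_charts (n + 1) (UU, ph) (aset i, aff i)" if i: "i \<le> n + 1" for i
    unfolding compatible_charts_def prod.case
  proof (intro conjI)
    have op: "openin (proj_top (n + 1)) (UU \<inter> aset i)" using openin_UU openin_aset by blast
    have coord: "\<xi> \<in> \<Phi> ` NN \<and> \<Psi> \<xi> i \<noteq> 0 \<and> \<Psi> \<xi> \<in> punctured_cspace K" if x: "\<xi> \<in> ph ` (UU \<inter> aset i)" for \<xi>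
    proof -
      have xN: "\<xi> \<in> \<Phi> ` NN" using x ph_UU by blast
      obtain p where p: "p \<in> UU" "p \<in> aset i" "\<xi> = ph p" using x by blast
      have "ppt (\<Psi> \<xi>) = p" using inv_ph[OF xN] p inj_ph by simp
      moreover have "\<Psi> \<xi> \<in> punctured_cspace K" using \<Psi>(1)[OF xN] NN_DD DD_punctured by blast
      ultimately show ?thesis using xN p mem_aset by metis
    qed
    show "holomorphic_between (n + 1) (n + 1) (ph ` (UU \<inter> aset i)) (aff i \<circ> inv_into UU ph)"
    proof (rule holomorphic_betweenI)
      show "openin (cspace_top (n + 1)) (ph ` (UU \<inter> aset i))" by (rule chart_open_image[OF chart_ph op]) blast
      show "(aff i \<circ> inv_into UU ph) ` ph ` (UU \<inter> aset i) \<subseteq> cspace (n + 1)"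
      proof
        fix w assume "w \<in> (aff i \<circ> inv_into UU ph) ` ph ` (UU \<inter> aset i)"
        then obtain \<xi> where x: "\<xi> \<in> ph ` (UU \<inter> aset i)" "w = aff i (inv_into UU ph \<xi>)" by auto
        then show "w \<in> cspace (n + 1)" using coord[OF x(1)] inv_ph aff_cspace i by simp
      qed
      fix \<xi> j assume x: "\<xi> \<in> ph ` (UU \<inter> aset i)" and j: "j < n + 1"
      let ?j = "if j < i then j else Suc j"
      have "hdiff (n + 1) (\<Phi> ` NN) (\<lambda>\<xi>. \<Psi> \<xi> ?j / \<Psi> \<xi> i) \<xi>"
        using coord[OF x] by (intro hdiff_divide hdiff_\<Psi>) auto
      then have "hdiff (n + 1) (ph ` (UU \<inter> aset i)) (\<lambda>\<xi>. \<Psi> \<xi> ?j / \<Psi> \<xi> i) \<xi>"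
        by (rule hdiff_subset) (use ph_UU in blast)
      then show "hdiff (n + 1) (ph ` (UU \<inter> aset i)) (\<lambda>z. (aff i \<circ> inv_into UU ph) z j) \<xi>"
        by (subst hdiff_cong[where f' = "\<lambda>\<xi>. \<Psi> \<xi> ?j / \<Psi> \<xi> i"]) (use coord x inv_ph aff_ppt in auto)
    qed
    have im: "aff i ` (UU \<inter> aset i) = {w \<in> cspace (n + 1). ppt (ins i w) \<in> UU}"
    proof (intro equalityI subsetI)
      fix w assume "w \<in> aff i ` (UU \<inter> aset i)"
      then obtain z where z: "z \<in> punctured_cspace K" "z i \<noteq> 0" "ppt z \<in> UU" "w = aff i (ppt z)" unfolding aset_def by blast
      then show "w \<in> {w \<in> cspace (n + 1). ppt (ins i w) \<in> UU}" using aff_cspace i ppt_ins_aff by simp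
    next
      fix w assume w: "w \<in> {w \<in> cspace (n + 1). ppt (ins i w) \<in> UU}"
      then have "ppt (ins i w) \<in> UU \<inter> aset i" "w = aff i (ppt (ins i w))"
        using ins_cspace[of w i] i by (auto simp: aset_def)
      then show "w \<in> aff i ` (UU \<inter> aset i)" by blast
    qed
    have inv: "inv_into (aset i) (aff i) w = ppt (ins i w)" if "w \<in> cspace (n + 1)" for w
      using inv_aff[of "ins i w" i] ins_cspace[OF that i] by simp
    have dd: "dot (ins i w) \<noteq> 0 \<and> rep (ppt (ins i w)) = (\<lambda>j. ins i w j / dot (ins i w))"
      if "w \<in> cspace (n + 1)" "ppt (ins i w) \<in> UU" for w
    proof -
      have "ppt (ins i w) \<in> ppt ` DD" using that(2) NN_DD unfolding UU_def by blast
      then have "ins i w \<in> DD" using ppt_image_DD ins_cspace[OF that(1) i] by blast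
      then show ?thesis by (auto simp: DD_def rep_ppt)
    qed
    show "holomorphic_between (n + 1) (n + 1) (aff i ` (UU \<inter> aset i)) (ph \<circ> inv_into (aset i) (aff i))"
      unfolding im
    proof (rule holomorphic_betweenI)
      have "openin (cspace_top (n + 1)) {w \<in> topspace (cspace_top (n + 1)). ppt (ins i w) \<in> UU}"
        by (rule openin_continuous_map_preimage[OF continuous_map_ppt_ins[OF i] openin_UU])
      then show "openin (cspace_top (n + 1)) {w \<in> cspace (n + 1). ppt (ins i w) \<in> UU}" by simp
      show "(ph \<circ> inv_into (aset i) (aff i)) ` {w \<in> cspace (n + 1). ppt (ins i w) \<in> UU} \<subseteq> cspace (n + 1)"
        by (auto simp: ph_def \<Phi>_def cspace_def)
      fix w j assume w: "w \<in> {w \<in> cspace (n + 1). ppt (ins i w) \<in> UU}" and j: "j < n + 1"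
      let ?S = "{w \<in> cspace (n + 1). ppt (ins i w) \<in> UU}"
      define r where "r = (\<lambda>w j. ins i w j / dot (ins i w))"
      have ih: "hdiff (n + 1) ?S (\<lambda>w. ins i w j) w" if "j < K" for j
      proof -
        consider "j < i" | "j = i" | "j > i" by linarith
        then show ?thesis using that i by cases (auto simp: ins_def hdiff_const intro!: hdiff_coord)
      qed
      have rh: "hdiff (n + 1) ?S (\<lambda>w. r w j) w" if "j < K" for j
        unfolding r_def using dd w that by (intro hdiff_divide hdiff_dot ih) auto
      have "hdiff (n + 1) ?S (\<lambda>w. \<Phi> (r w) j) w"
      proof (cases "j < n")
        case True
        then show ?thesis using rh \<pi>_facts by (simp add: \<Phi>_def)
      next
        case False
        then show ?thesis using j hdiff_T[OF rh rh rh] by (simp add: \<Phi>_def)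
      qed
      then show "hdiff (n + 1) ?S (\<lambda>z. (ph \<circ> inv_into (aset i) (aff i)) z j) w"
        by (subst hdiff_cong[where f' = "\<lambda>w. \<Phi> (r w) j"]) (use w inv dd in \<open>auto simp: ph_def r_def\<close>)
    qed
  qed
  then have "\<forall>c'\<in>affine_chart (n + 1) ` {..n + 1}. compatible_charts (n + 1) (UU, ph) c'"
    by (auto simp only: affine_chart_eq atMost_iff)
  then show ?thesis using chart_ph unfolding maximal_atlas_def by (simp only: PS_simps mem_Collect_eq proj_space_def cmanifold.simps)
qed

text \<open>The chart coordinate with index \<open>n\<close> is the value of the cubic, so it
  vanishes exactly on \<open>X\<close>.\<close>

lemma ph_flat: "ph ` (UU \<inter> ppt ` X) = ph ` UU \<inter> cspace n"
proof (intro equalityI subsetI)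
  fix \<xi> assume "\<xi> \<in> ph ` (UU \<inter> ppt ` X)"
  then obtain z where z: "z \<in> X" "ppt z \<in> UU" "\<xi> = ph (ppt z)" by blast
  then have "\<xi> = \<Phi> z" by (simp add: ph_def rep_ppt_X)
  then have "\<xi> \<in> cspace n" using z(1) by (auto simp: cspace_def \<Phi>_def X_def)
  then show "\<xi> \<in> ph ` UU \<inter> cspace n" using z by blast
next
  fix \<xi> assume x: "\<xi> \<in> ph ` UU \<inter> cspace n"
  then obtain z where z: "z \<in> NN" "\<xi> = \<Phi> z" using ph_UU by blast
  have "\<Phi> z n = 0" using x z by (auto simp: cspace_def)
  then have "z \<in> X" using z by (simp add: \<Phi>_def X_def NN_def)
  then show "\<xi> \<in> ph ` (UU \<inter> ppt ` X)" using z ph_ppt[OF z(1)] unfolding UU_def by (metis IntI image_eqI)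
qed

end

context affine_cubic begin

lemma exists_flat_chart:
  assumes "z \<in> X"
  shows "\<exists>U \<phi>. (U, \<phi>) \<in> maximal_atlas PS \<and> ppt z \<in> U \<and> \<phi> ` (U \<inter> ppt ` X) = \<phi> ` U \<inter> cspace n"
proof -
  obtain k l where kl: "k < K" "l < K" "k \<noteq> l" "a k \<noteq> 0" "T z z (unit_vec l - cvec (a l / a k) (unit_vec k)) \<noteq> 0"
    using exists_transversal[OF assms] by blast
  have "card ({..<K} - {k, l}) = n" using kl by (simp add: card_Diff_subset)
  then obtain \<pi> where "bij_betw \<pi> {..<n} ({..<K} - {k, l})"
    using ex_bij_betw_nat_finite[of "{..<K} - {k, l}"] by (auto simp: atLeast0LessThan)
  then interpret flat_point n c a z k l \<pi>
    using assms kl by unfold_locales auto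
  show ?thesis using ph_maximal ph_flat z0_NN unfolding UU_def by blast
qed

section \<open>The affine cubic as a manifold\<close>

abbreviation "Y \<equiv> ppt ` X"
abbreviation "Mf \<equiv> submanifold PS n Y"

lemma Mf_simps: "mtop Mf = subtopology (proj_top (n + 1)) Y" "cdim Mf = n"
  unfolding submanifold_def cmanifold.simps PS_simps by (rule refl)+

lemma Mf_atlas: "(V, \<psi>) \<in> atlas Mf \<longleftrightarrow>
    (\<exists>U. V = U \<inter> Y \<and> (U, \<psi>) \<in> maximal_atlas PS \<and> \<psi> ` (U \<inter> Y) = \<psi> ` U \<inter> cspace n)"
  unfolding submanifold_def by auto

lemma Y_DD: "Y \<subseteq> ppt ` DD" using X_DD by blast

lemma points_Mf: "points Mf = Y"
  using Y_DD ppt_DD_subset unfolding Mf_simps topspace_subtopology topspace_proj_top by blast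

lemma rep_Y: "p \<in> Y \<Longrightarrow> rep p \<in> X" "p \<in> Y \<Longrightarrow> ppt (rep p) = p"
  using rep_ppt_X by auto

lemma X_punctured: "X \<subseteq> punctured_cspace K" using X_DD DD_punctured by blast
lemma X_cspace: "X \<subseteq> cspace K" by (auto simp: X_def)

lemma continuous_map_rep_Mf: "continuous_map (mtop Mf) (top_of_set X) rep"
  unfolding continuous_map_in_subtopology
proof
  show "continuous_map (mtop Mf) euclidean rep"
    unfolding Mf_simps by (rule continuous_map_from_subtopology_mono[OF continuous_map_rep Y_DD])
  show "rep \<in> topspace (mtop Mf) \<rightarrow> X" unfolding points_Mf using rep_Y by blast
qed

lemma continuous_map_ppt_Mf: "continuous_map (top_of_set X) (mtop Mf) ppt"
  unfolding Mf_simps continuous_map_in_subtopology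
proof
  show "continuous_map (top_of_set X) (proj_top (n + 1)) ppt"
    by (rule continuous_map_from_subtopology_mono[OF continuous_map_ppt[of "n + 1", unfolded Suc_Suc_K] X_punctured])
qed auto

lemma homeomorphic_ppt_Mf: "homeomorphic_maps (top_of_set X) (mtop Mf) ppt rep"
  unfolding homeomorphic_maps_def using continuous_map_ppt_Mf continuous_map_rep_Mf points_Mf rep_Y rep_ppt_X by auto

lemma chart_restrict:
  assumes "(U, \<psi>) \<in> maximal_atlas PS" "\<psi> ` (U \<inter> Y) = \<psi> ` U \<inter> cspace n"
  shows "is_chart (mtop Mf) n (U \<inter> Y, \<psi>)" "\<xi> \<in> \<psi> ` (U \<inter> Y) \<Longrightarrow> inv_into (U \<inter> Y) \<psi> \<xi> = inv_into U \<psi> \<xi>"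
proof -
  note D = is_chartD[OF maximal_chartD(1)[OF assms(1)]]
  have inj: "inj_on \<psi> (U \<inter> Y)" using D(4) by (rule inj_on_subset) blast
  show inv: "inv_into (U \<inter> Y) \<psi> \<xi> = inv_into U \<psi> \<xi>" if mem: "\<xi> \<in> \<psi> ` (U \<inter> Y)" for \<xi>
  proof -
    obtain p where p: "p \<in> U \<inter> Y" "\<xi> = \<psi> p" using mem by blast
    then show ?thesis using inv_into_f_f[OF D(4), of p] inv_into_f_f[OF inj, of p] by simp
  qed
  show "is_chart (mtop Mf) n (U \<inter> Y, \<psi>)"
  proof (rule is_chartI)
    show "openin (mtop Mf) (U \<inter> Y)" unfolding Mf_simps openin_subtopology using D(1) by blast
    obtain N where N: "open N" "\<psi> ` U = cspace (n + 1) \<inter> N" using D(2) unfolding openin_open by blast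
    have "cspace n \<subseteq> cspace (n + 1)" by (auto simp: cspace_def)
    then have "\<psi> ` (U \<inter> Y) = cspace n \<inter> N" using N(2) assms(2) by blast
    then show "openin (cspace_top n) (\<psi> ` (U \<inter> Y))" using N(1) by (simp add: openin_open_Int)
    have "subtopology (mtop Mf) (U \<inter> Y) = subtopology (proj_top (n + 1)) (U \<inter> Y)"
      unfolding Mf_simps subtopology_subtopology by (rule arg_cong[where f = "subtopology _"]) blast
    then show "continuous_map (subtopology (mtop Mf) (U \<inter> Y)) euclidean \<psi>"
      using continuous_map_from_subtopology_mono[OF D(6), of "U \<inter> Y"] by simp
    show "continuous_map (top_of_set (\<psi> ` (U \<inter> Y))) (mtop Mf) (inv_into U \<psi>)"
      unfolding Mf_simps continuous_map_in_subtopology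
    proof
      show "continuous_map (top_of_set (\<psi> ` (U \<inter> Y))) (proj_top (n + 1)) (inv_into U \<psi>)"
        by (rule continuous_map_from_subtopology_mono[OF D(7)]) blast
      show "inv_into U \<psi> \<in> topspace (top_of_set (\<psi> ` (U \<inter> Y))) \<rightarrow> Y"
        using D(4) by auto
    qed
    show "inv_into U \<psi> (\<psi> p) = p" if "p \<in> U \<inter> Y" for p using that D(4) by simp
  qed
qed

lemma Mf_chart: "(V, \<psi>) \<in> atlas Mf \<Longrightarrow> is_chart (mtop Mf) n (V, \<psi>)"
  unfolding Mf_atlas using chart_restrict(1) by blast

lemma Mf_chart_Y: "(V, \<psi>) \<in> atlas Mf \<Longrightarrow> V \<subseteq> Y"
  unfolding Mf_atlas by blast

text \<open>In a flattened chart the coordinate with index \<open>n\<close> is 0 on the submanifold.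
  So \<open>cspace n\<close> enters \<open>cspace (n + 1)\<close> by the identity, and
  \<open>rep_chart_hdiff\<close> can be composed with it.\<close>

lemma hdiff_rep_inv:
  assumes V: "(V, \<psi>) \<in> atlas Mf" and p: "p \<in> V" and j: "j < K"
  shows "hdiff n (\<psi> ` V) (\<lambda>\<xi>. rep (inv_into V \<psi> \<xi>) j) (\<psi> p)"
proof -
  obtain U where U: "V = U \<inter> Y" "(U, \<psi>) \<in> maximal_atlas PS" "\<psi> ` (U \<inter> Y) = \<psi> ` U \<inter> cspace n"
    using V unfolding Mf_atlas by blast
  have "hdiff n (\<psi> ` V) (\<lambda>\<xi>. rep (inv_into U \<psi> \<xi>) j) (\<psi> p)"
  proof (rule hdiff_compose[where F = "\<lambda>w. w" and h = "\<lambda>\<xi>. rep (inv_into U \<psi> \<xi>) j"])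
    show "hdiff (n + 1) (\<psi> ` (U \<inter> ppt ` DD)) (\<lambda>\<xi>. rep (inv_into U \<psi> \<xi>) j) (\<psi> p)"
      using p Y_DD unfolding U(1) by (intro rep_chart_hdiff[OF U(2) _ _ j]) auto
    show "hdiff n (\<psi> ` V) (\<lambda>w. w i) (\<psi> p)" if "i < n + 1" for i
    proof (cases "i < n")
      case False
      have "w i = 0" if "w \<in> \<psi> ` V" for w
        using that False U by (auto simp: cspace_def)
      then show ?thesis using p hdiff_const[of n "\<psi> ` V" 0] by (subst hdiff_cong[where f' = "\<lambda>_. 0"]) auto
    qed (rule hdiff_coord)
    show "(\<lambda>w. w) ` \<psi> ` V \<subseteq> \<psi> ` (U \<inter> ppt ` DD)" using U(1) Y_DD by auto
    show "\<psi> ` (U \<inter> ppt ` DD) \<subseteq> cspace (n + 1)" using is_chartD(3)[OF maximal_chartD(1)[OF U(2)]] by blast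
  qed (use p in blast)
  then show ?thesis
    by (subst hdiff_cong[where f' = "\<lambda>\<xi>. rep (inv_into U \<psi> \<xi>) j"]) (use chart_restrict(2)[OF U(2,3)] U(1) p in auto)
qed

lemma openin_punctured: "openin (cspace_top K) (punctured_cspace K)"
proof -
  have "punctured_cspace K = cspace K \<inter> (\<Union>i\<le>n + 1. {z. z i \<noteq> 0})"
    using punctured_coord by (auto simp: punctured_cspace_def)
  moreover have "open (\<Union>i\<le>n + 1. {z :: nat \<Rightarrow> complex. z i \<noteq> 0})" using open_coord_ne by blast
  ultimately show ?thesis by (simp add: openin_open_Int)
qed

text \<open>A chart of the submanifold extends to an open cone in the ambient space.
  Differentiability in all \<open>K\<close> coordinates makes it composable with any differentiable
  map into \<open>X\<close>.\<close>

lemma hdiff_chart_ppt: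
  assumes V: "(V, \<psi>) \<in> atlas Mf"
  shows "\<exists>\<Omega>. openin (cspace_top K) \<Omega> \<and> {z \<in> X. ppt z \<in> V} = X \<inter> \<Omega> \<and> (\<forall>z\<in>\<Omega>. \<forall>j<n. hdiff K \<Omega> (\<lambda>z. \<psi> (ppt z) j) z)"
proof -
  obtain U where U: "V = U \<inter> Y" "(U, \<psi>) \<in> maximal_atlas PS"
    using V unfolding Mf_atlas by blast
  let ?\<Omega> = "{z \<in> punctured_cspace K. ppt z \<in> U}"
  have "openin (top_of_set (punctured_cspace K)) {z \<in> topspace (top_of_set (punctured_cspace K)). ppt z \<in> U}"
    using is_chartD(1)[OF maximal_chartD(1)[OF U(2)]]
    by (rule openin_continuous_map_preimage[OF continuous_map_ppt[of "n + 1", unfolded Suc_Suc_K]])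
  then have "openin (top_of_set (punctured_cspace K)) ?\<Omega>" by simp
  then have "openin (cspace_top K) ?\<Omega>" by (rule openin_trans[OF _ openin_punctured])
  moreover have "{z \<in> X. ppt z \<in> V} = X \<inter> ?\<Omega>" using X_punctured U(1) by blast
  moreover have "hdiff K ?\<Omega> (\<lambda>z. \<psi> (ppt z) j) z" if "z \<in> ?\<Omega>" "j < n" for z j
    using that by (intro chart_ppt_hdiff[OF U(2)]) auto
  ultimately show ?thesis by blast
qed

text \<open>The topological properties are transported from \<open>X\<close> by \<open>ppt\<close>,
  and transition maps factor through \<open>X\<close>: \<open>rep\<close> after an inverse chart,
  followed by a chart after \<open>ppt\<close>.\<close>

lemma complex_manifold_Mf: "complex_manifold Mf"
  unfolding complex_manifold_def
proof (intro conjI ballI)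
  have h: "homeomorphic_map (top_of_set X) (mtop Mf) ppt" by (rule homeomorphic_maps_imp_map[OF homeomorphic_ppt_Mf])
  have "Hausdorff_space (top_of_set X)" by (simp add: Hausdorff_space_subtopology)
  then show "Hausdorff_space (mtop Mf)"
    using homeomorphic_Hausdorff_space[OF homeomorphic_map_imp_homeomorphic_space[OF h]] by simp
  show "second_countable (mtop Mf)"
    by (rule second_countable_homeomorphic[OF second_countable_subtopology[OF second_countable_euclidean] h])
  show "is_chart (mtop Mf) (cdim Mf) c" if "c \<in> atlas Mf" for c
    unfolding Mf_simps(2) using Mf_chart[of "fst c" "snd c"] that by simp
  show "(\<Union>c\<in>atlas Mf. fst c) = points Mf"
    unfolding points_Mf
  proof (intro equalityI subsetI)
    fix p assume "p \<in> (\<Union>c\<in>atlas Mf. fst c)"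
    then show "p \<in> Y" using Mf_chart_Y by fastforce
  next
    fix p assume "p \<in> Y"
    then obtain z where z: "z \<in> X" "p = ppt z" by blast
    obtain U \<phi> where "(U, \<phi>) \<in> maximal_atlas PS" "ppt z \<in> U" "\<phi> ` (U \<inter> Y) = \<phi> ` U \<inter> cspace n"
      using exists_flat_chart[OF z(1)] by blast
    then have "(U \<inter> Y, \<phi>) \<in> atlas Mf" "p \<in> U \<inter> Y" using z unfolding Mf_atlas by auto
    then show "p \<in> (\<Union>c\<in>atlas Mf. fst c)" by force
  qed
  have *: "holomorphic_between n n (\<phi> ` (V \<inter> W)) (\<psi> \<circ> inv_into V \<phi>)"
    if V: "(V, \<phi>) \<in> atlas Mf" and W: "(W, \<psi>) \<in> atlas Mf" for V \<phi> W \<psi>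
  proof (rule holomorphic_betweenI)
    note D = is_chartD[OF Mf_chart[OF V]]
    note E = is_chartD[OF Mf_chart[OF W]]
    have inv: "inv_into V \<phi> \<xi> \<in> V \<inter> W" if "\<xi> \<in> \<phi> ` (V \<inter> W)" for \<xi> using that D(4) by auto
    show "openin (cspace_top n) (\<phi> ` (V \<inter> W))"
      using D(1) E(1) by (intro chart_open_image[OF Mf_chart[OF V]]) auto
    show "(\<psi> \<circ> inv_into V \<phi>) ` \<phi> ` (V \<inter> W) \<subseteq> cspace n" using inv E(3) by auto
    fix \<xi> j assume x: "\<xi> \<in> \<phi> ` (V \<inter> W)" and j: "j < n"
    obtain p where p: "p \<in> V \<inter> W" "\<xi> = \<phi> p" using x by blast
    obtain \<Omega> where \<Omega>: "openin (cspace_top K) \<Omega>" "{z \<in> X. ppt z \<in> W} = X \<inter> \<Omega>"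
      "\<And>z j. z \<in> \<Omega> \<Longrightarrow> j < n \<Longrightarrow> hdiff K \<Omega> (\<lambda>z. \<psi> (ppt z) j) z"
      using hdiff_chart_ppt[OF W] by blast
    have R: "rep q \<in> \<Omega> \<and> ppt (rep q) = q" if "q \<in> V \<inter> W" for q
    proof -
      have q: "q \<in> W" "q \<in> Y" using that Mf_chart_Y[OF W] by auto
      then have "rep q \<in> {z \<in> X. ppt z \<in> W}" using rep_Y[OF q(2)] by simp
      then show ?thesis using \<Omega>(2) rep_Y(2)[OF q(2)] by blast
    qed
    have "hdiff n (\<phi> ` (V \<inter> W)) (\<lambda>\<xi>. \<psi> (ppt (rep (inv_into V \<phi> \<xi>))) j) \<xi>"
    proof (rule hdiff_compose[where F = "\<lambda>\<xi>. rep (inv_into V \<phi> \<xi>)" and h = "\<lambda>z. \<psi> (ppt z) j", OF \<Omega>(3)[OF _ j]])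
      show "hdiff n (\<phi> ` (V \<inter> W)) (\<lambda>\<xi>. rep (inv_into V \<phi> \<xi>) i) \<xi>" if "i < K" for i
        unfolding p(2) by (rule hdiff_subset[OF hdiff_rep_inv[OF V _ that]]) (use p in auto)
      show "\<Omega> \<subseteq> cspace K" using openin_subset[OF \<Omega>(1)] by simp
    qed (use inv R x in auto)
    then show "hdiff n (\<phi> ` (V \<inter> W)) (\<lambda>z. (\<psi> \<circ> inv_into V \<phi>) z j) \<xi>"
      by (subst hdiff_cong[where f' = "\<lambda>\<xi>. \<psi> (ppt (rep (inv_into V \<phi> \<xi>))) j"]) (use inv R x in auto)
  qed
  fix c c' assume a: "c \<in> atlas Mf" "c' \<in> atlas Mf"
  obtain V \<phi> W \<psi> where c: "c = (V, \<phi>)" "c' = (W, \<psi>)" by fastforce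
  show "compatible_charts (cdim Mf) c c'"
    using *[OF a(1)[unfolded c] a(2)[unfolded c]] *[OF a(2)[unfolded c] a(1)[unfolded c]] Int_commute[of V W]
    unfolding Mf_simps(2) compatible_charts_def c by simp
qed

text \<open>Reduction to affine coordinates: \<open>\<sigma>\<close> is differentiable on the whole
  ambient space and preserves \<open>X\<close>. In charts the spray is \<open>rep\<close> after an
  inverse chart, then \<open>\<sigma>\<close>, then a chart after \<open>ppt\<close>.\<close>

lemma holomorphic_spray_Mf:
  assumes s1: "\<And>x t. x \<in> X \<Longrightarrow> t \<in> cspace r \<Longrightarrow> \<sigma> x t \<in> X"
    and s2: "\<And>\<zeta> j. \<zeta> \<in> cspace (K + r) \<Longrightarrow> j < K \<Longrightarrow> hdiff (K + r) (cspace (K + r)) (\<lambda>\<zeta>. \<sigma> (ctake K \<zeta>) (cdrop K \<zeta>) j) \<zeta>"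
    and s3: "\<And>x. x \<in> X \<Longrightarrow> \<sigma> x (\<lambda>i. 0) = x"
  shows "holomorphic_spray Mf (trivial_bundle Mf r) (\<lambda>(p, t). ppt (\<sigma> (rep p) t))"
proof -
  let ?s = "\<lambda>(p, t). ppt (\<sigma> (rep p) t)"
  have T: "complex_manifold (times_cspace Mf r)" by (rule complex_manifold_times[OF complex_manifold_Mf])
  define Z where "Z = {\<zeta> \<in> cspace (K + r). ctake K \<zeta> \<in> X}"
  define S where "S = (\<lambda>\<zeta>. \<sigma> (ctake K \<zeta>) (cdrop K \<zeta>))"
  have SX: "S \<zeta> \<in> X" if "\<zeta> \<in> Z" for \<zeta> using that s1 cdrop_cspace by (auto simp: S_def Z_def)
  have cS: "continuous_map (top_of_set Z) (top_of_set X) S"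
    unfolding continuous_map_in_subtopology
  proof
    have "continuous_on Z (\<lambda>\<zeta>. S \<zeta> j)" for j
    proof (cases "j < K")
      case True
      have "((\<lambda>\<zeta>. S \<zeta> j) \<longlongrightarrow> S \<zeta> j) (at \<zeta> within Z)" if "\<zeta> \<in> Z" for \<zeta>
      proof -
        have "hdiff (K + r) (cspace (K + r)) (\<lambda>\<zeta>. S \<zeta> j) \<zeta>" unfolding S_def using that True by (intro s2) (auto simp: Z_def)
        then show ?thesis by (intro hdiff_tendsto[OF hdiff_subset]) (auto simp: Z_def)
      qed
      then show ?thesis unfolding continuous_on_def by blast
    next
      case False
      then have "S \<zeta> j = 0" if "\<zeta> \<in> Z" for \<zeta> using SX[OF that] by (auto simp: X_def cspace_def)
      then show ?thesis by (subst continuous_on_cong[where g = "\<lambda>_. 0"]) auto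
    qed
    then show "continuous_map (top_of_set Z) euclidean S" by (intro continuous_map_funI) simp
  qed (use SX in auto)
  have cC: "continuous_map (prod_topology (mtop Mf) (cspace_top r)) (top_of_set Z) (\<lambda>(p, t). ccat K (rep p) t)"
    unfolding continuous_map_in_subtopology
  proof
    show "continuous_map (prod_topology (mtop Mf) (cspace_top r)) euclidean (\<lambda>(p, t). ccat K (rep p) t)"
    proof (rule continuous_map_funI)
      fix i
      have "continuous_map (mtop Mf) euclidean rep" using continuous_map_rep_Mf by (simp add: continuous_map_in_subtopology)
      from continuous_map_compose[OF continuous_map_fst continuous_map_coord[OF this, of i]]
      have 1: "continuous_map (prod_topology (mtop Mf) (cspace_top r)) euclidean (\<lambda>p. rep (fst p) i)" by (simp add: o_def)
      have "continuous_map (cspace_top r) euclidean (\<lambda>v. v (i - K))" using continuous_on_coord by simp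
      from continuous_map_compose[OF continuous_map_snd this]
      have 2: "continuous_map (prod_topology (mtop Mf) (cspace_top r)) euclidean (\<lambda>p. snd p (i - K))" by (simp add: o_def)
      show "continuous_map (prod_topology (mtop Mf) (cspace_top r)) euclidean (\<lambda>p. (case p of (p, t) \<Rightarrow> ccat K (rep p) t) i)"
        using 1 2 by (simp add: ccat_def split_def)
    qed
    show "(\<lambda>(p, t). ccat K (rep p) t) \<in> topspace (prod_topology (mtop Mf) (cspace_top r)) \<rightarrow> Z"
      unfolding topspace_prod_topology points_Mf Z_def using rep_Y(1) X_cspace
      by (auto simp: Pi_iff subset_iff ccat_cspace)
  qed
  have cont: "continuous_map (prod_topology (mtop Mf) (cspace_top r)) (mtop Mf) ?s"
  proof (rule continuous_map_eq[OF continuous_map_compose[OF continuous_map_compose[OF cC cS] continuous_map_ppt_Mf]])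
    fix q assume "q \<in> topspace (prod_topology (mtop Mf) (cspace_top r))"
    then have "fst q \<in> Y" unfolding topspace_prod_topology points_Mf by auto
    then have "rep (fst q) \<in> cspace K" using rep_Y(1) X_cspace by blast
    then show "(ppt \<circ> (S \<circ> (\<lambda>(p, t). ccat K (rep p) t))) q = ?s q"
      by (simp add: S_def split_def)
  qed
  have "holomorphic_map (times_cspace Mf r) Mf ?s"
  proof (rule holomorphic_mapI)
    show "is_chart (mtop (times_cspace Mf r)) (cdim (times_cspace Mf r)) c" if "c \<in> atlas (times_cspace Mf r)" for c
      using T that unfolding complex_manifold_def by blast
    show "is_chart (mtop Mf) (cdim Mf) c" if "c \<in> atlas Mf" for c
      using complex_manifold_Mf that unfolding complex_manifold_def by blast
    show "continuous_map (mtop (times_cspace Mf r)) (mtop Mf) ?s" using cont by simp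
    fix W \<Phi> V \<psi> p j
    assume W: "(W, \<Phi>) \<in> atlas (times_cspace Mf r)" and V: "(V, \<psi>) \<in> atlas Mf" and p: "p \<in> W" "?s p \<in> V" and "j < cdim Mf"
    then have j: "j < n" unfolding Mf_simps(2) by blast
    obtain U \<phi> where U: "(U, \<phi>) \<in> atlas Mf" "W = U \<times> cspace r" "\<Phi> = (\<lambda>(x, v). ccat n (\<phi> x) v)"
      using W unfolding times_cspace_atlas Mf_simps by auto
    note ch = Mf_chart[OF U(1)]
    let ?R = "\<Phi> ` {x\<in>W. ?s x \<in> V}"
    obtain \<Omega> where \<Omega>: "openin (cspace_top K) \<Omega>" "{z \<in> X. ppt z \<in> V} = X \<inter> \<Omega>"
      "\<And>z j. z \<in> \<Omega> \<Longrightarrow> j < n \<Longrightarrow> hdiff K \<Omega> (\<lambda>z. \<psi> (ppt z) j) z"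
      using hdiff_chart_ppt[OF V] by blast
    have R: "\<zeta> \<in> cspace (n + r) \<and> ctake n \<zeta> \<in> \<phi> ` U" if "\<zeta> \<in> ?R" for \<zeta>
      using that is_chartD(3)[OF ch] unfolding U by (auto simp: image_subset_iff ccat_cspace)
    have inv: "inv_into W \<Phi> \<zeta> = (inv_into U \<phi> (ctake n \<zeta>), cdrop n \<zeta>)" if "\<zeta> \<in> ?R" for \<zeta>
      using times_chart(3)[OF ch, of \<zeta> r] R[OF that] unfolding U by auto
    have injW: "inj_on \<Phi> W" using is_chartD(4)[OF times_chart(1)[OF ch, of r]] unfolding U .
    have sV: "?s (inv_into W \<Phi> \<zeta>) \<in> V" if "\<zeta> \<in> ?R" for \<zeta> using that injW by auto
    define F1 where "F1 = (\<lambda>\<zeta>. ccat K (rep (inv_into U \<phi> (ctake n \<zeta>))) (cdrop n \<zeta>))"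
    have repX: "rep (inv_into U \<phi> (ctake n \<zeta>)) \<in> X" if "\<zeta> \<in> ?R" for \<zeta>
      using inv_into_into[of "ctake n \<zeta>" \<phi> U] R[OF that] Mf_chart_Y[OF U(1)] rep_Y(1) by blast
    have F1c: "F1 \<zeta> \<in> cspace (K + r)" "S (F1 \<zeta>) = \<sigma> (rep (inv_into U \<phi> (ctake n \<zeta>))) (cdrop n \<zeta>)" if "\<zeta> \<in> ?R" for \<zeta>
    proof -
      have "rep (inv_into U \<phi> (ctake n \<zeta>)) \<in> cspace K" using repX[OF that] X_cspace by blast
      moreover have "cdrop n \<zeta> \<in> cspace r" using R[OF that] cdrop_cspace by blast
      ultimately show "F1 \<zeta> \<in> cspace (K + r)" "S (F1 \<zeta>) = \<sigma> (rep (inv_into U \<phi> (ctake n \<zeta>))) (cdrop n \<zeta>)"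
        unfolding F1_def S_def by (simp_all add: ccat_cspace)
    qed
    have SX': "S (F1 \<zeta>) \<in> X" if "\<zeta> \<in> ?R" for \<zeta>
      unfolding F1c(2)[OF that] using repX[OF that] R[OF that] cdrop_cspace s1 by blast
    have eq: "\<psi> (?s (inv_into W \<Phi> \<zeta>)) j = \<psi> (ppt (S (F1 \<zeta>))) j" if "\<zeta> \<in> ?R" for \<zeta>
      unfolding inv[OF that] F1c(2)[OF that] by simp
    have S\<Omega>: "S (F1 \<zeta>) \<in> \<Omega>" if "\<zeta> \<in> ?R" for \<zeta>
    proof -
      have "ppt (S (F1 \<zeta>)) \<in> V" using sV[OF that] unfolding inv[OF that] F1c(2)[OF that] by simp
      then show ?thesis using SX'[OF that] \<Omega>(2) by blast
    qed
    have pR: "\<Phi> p \<in> ?R" using p by blast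
    have h1: "hdiff (n + r) ?R (\<lambda>\<zeta>. F1 \<zeta> i) (\<Phi> p)" if "i < K + r" for i
    proof (cases "i < K")
      case True
      obtain q where q: "q \<in> U" "ctake n (\<Phi> p) = \<phi> q" using R[OF pR] by blast
      have "hdiff (n + r) ?R (\<lambda>\<zeta>. rep (inv_into U \<phi> (ctake n \<zeta>)) i) (\<Phi> p)"
        by (rule hdiff_ctake[where f = "\<lambda>\<xi>. rep (inv_into U \<phi> \<xi>) i", OF hdiff_rep_inv[OF U(1) q(1) True, folded q(2)]])
          (use R pR is_chartD(3)[OF ch] in auto)
      then show ?thesis using True by (simp add: F1_def ccat_def)
    next
      case False
      then have "i - K + n < n + r" using that by linarith
      then show ?thesis using False hdiff_coord[of "i - K + n" "n + r" ?R "\<Phi> p"] by (simp add: F1_def ccat_def cdrop_def)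
    qed
    have h2: "hdiff (n + r) ?R (\<lambda>\<zeta>. S (F1 \<zeta>) i) (\<Phi> p)" if "i < K" for i
    proof (rule hdiff_compose[where F = F1 and h = "\<lambda>\<zeta>. S \<zeta> i" and l = "K + r" and V = "cspace (K + r)"])
      show "hdiff (K + r) (cspace (K + r)) (\<lambda>\<zeta>. S \<zeta> i) (F1 (\<Phi> p))"
        unfolding S_def using F1c(1)[OF pR] that by (rule s2)
    qed (use F1c(1) h1 pR in auto)
    have "hdiff (n + r) ?R (\<lambda>\<zeta>. \<psi> (ppt (S (F1 \<zeta>))) j) (\<Phi> p)"
    proof (rule hdiff_compose[where F = "\<lambda>\<zeta>. S (F1 \<zeta>)" and h = "\<lambda>z. \<psi> (ppt z) j" and l = K and V = \<Omega>])
      show "\<Omega> \<subseteq> cspace K" using openin_subset[OF \<Omega>(1)] by simp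
    qed (use \<Omega>(3)[OF S\<Omega>[OF pR] j] S\<Omega> h2 pR in auto)
    then show "hdiff (cdim (times_cspace Mf r)) ?R (\<lambda>\<xi>. \<psi> (?s (inv_into W \<Phi> \<xi>)) j) (\<Phi> p)"
      unfolding times_cspace_simps Mf_simps(2)
      by (rule hdiff_cong[THEN iffD2, rotated 2]) (erule eq, rule eq[OF pR])
  qed
  then show ?thesis
    unfolding holomorphic_spray_def
    using holomorphic_vector_bundle_trivial[OF complex_manifold_Mf, of r] s3 rep_Y points_Mf
    by (auto simp: trivial_bundle_def)
qed

section \<open>Domination\<close>

text \<open>\<open>G\<close> acts as the Jacobian matrix of \<open>\<psi> \<circ> ppt\<close> at
  \<open>z\<close>, tested only along curves in \<open>X\<close>. Membership in the chart domain is
  recorded along with it, for use with the coordinates from \<open>n\<close> on.\<close>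

definition is_gradient :: "ppoint set \<Rightarrow> (ppoint \<Rightarrow> nat \<Rightarrow> complex) \<Rightarrow> (nat \<Rightarrow> complex) \<Rightarrow> (nat \<Rightarrow> nat \<Rightarrow> complex) \<Rightarrow> bool" where
  "is_gradient V \<psi> z G \<longleftrightarrow> (\<forall>i<n. \<forall>\<gamma> d. \<gamma> (0::complex) = z \<longrightarrow> (\<forall>\<^sub>F t in at 0. \<gamma> t \<in> X) \<longrightarrow>
     (\<forall>k<K. ((\<lambda>t. \<gamma> t k) has_field_derivative d k) (at 0)) \<longrightarrow>
     (\<forall>\<^sub>F t in at 0. ppt (\<gamma> t) \<in> V) \<and>
     ((\<lambda>t. \<psi> (ppt (\<gamma> t)) i) has_field_derivative (\<Sum>k<K. G i k * d k)) (at 0))"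

lemma curve_tendsto:
  assumes "\<gamma> (0::complex) \<in> X" "\<forall>\<^sub>F t in at 0. \<gamma> t \<in> X" "\<And>k. k < K \<Longrightarrow> ((\<lambda>t. \<gamma> t k) has_field_derivative d k) (at 0)"
  shows "(\<gamma> \<longlongrightarrow> \<gamma> 0) (at 0)"
proof (rule tendsto_funI)
  fix k
  show "((\<lambda>t. \<gamma> t k) \<longlongrightarrow> \<gamma> 0 k) (at 0)"
  proof (cases "k < K")
    case True
    from DERIV_isCont[OF assms(3)[OF this]] show ?thesis by (simp add: isCont_def)
  next
    case False
    have "\<forall>\<^sub>F t in at 0. \<gamma> 0 k = \<gamma> t k"
      using assms(2) by eventually_elim (use False assms(1) in \<open>auto simp: X_def cspace_def\<close>)
    then show ?thesis by (rule Lim_transform_eventually[OF tendsto_const])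
  qed
qed

lemma exists_gradient:
  assumes V: "(V, \<psi>) \<in> atlas Mf" and z: "z \<in> X" "ppt z \<in> V"
  shows "\<exists>G. is_gradient V \<psi> z G"
proof -
  obtain \<Omega> where \<Omega>: "openin (cspace_top K) \<Omega>" "{z \<in> X. ppt z \<in> V} = X \<inter> \<Omega>"
    "\<And>z j. z \<in> \<Omega> \<Longrightarrow> j < n \<Longrightarrow> hdiff K \<Omega> (\<lambda>z. \<psi> (ppt z) j) z"
    using hdiff_chart_ppt[OF V] by blast
  have z\<Omega>: "z \<in> \<Omega>" using z \<Omega>(2) by blast
  have \<Omega>c: "\<Omega> \<subseteq> cspace K" using openin_subset[OF \<Omega>(1)] by simp
  obtain N where N: "open N" "\<Omega> = cspace K \<inter> N" using \<Omega>(1) unfolding openin_open by blast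
  have "\<forall>i. \<exists>g. i < n \<longrightarrow> (\<forall>\<gamma> d. \<gamma> (0::complex) = z \<longrightarrow> (\<forall>\<^sub>F t in at 0. \<gamma> t \<in> \<Omega>) \<longrightarrow>
     (\<forall>k<K. ((\<lambda>t. \<gamma> t k) has_field_derivative d k) (at 0)) \<longrightarrow>
     ((\<lambda>t. \<psi> (ppt (\<gamma> t)) i) has_field_derivative (\<Sum>k<K. g k * d k)) (at 0))"
    using hdiff_gradient[OF \<Omega>(3)[OF z\<Omega>] \<Omega>c z\<Omega>] by blast
  from choice[OF this] obtain G where G: "\<forall>i. i < n \<longrightarrow> (\<forall>\<gamma> d. \<gamma> (0::complex) = z \<longrightarrow> (\<forall>\<^sub>F t in at 0. \<gamma> t \<in> \<Omega>) \<longrightarrow>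
     (\<forall>k<K. ((\<lambda>t. \<gamma> t k) has_field_derivative d k) (at 0)) \<longrightarrow>
     ((\<lambda>t. \<psi> (ppt (\<gamma> t)) i) has_field_derivative (\<Sum>k<K. G i k * d k)) (at 0))"
    by (rule exE)
  have "is_gradient V \<psi> z G"
    unfolding is_gradient_def
  proof (intro allI impI)
    fix i \<gamma> d assume i: "i < n" and g: "\<gamma> (0::complex) = z" "\<forall>\<^sub>F t in at 0. \<gamma> t \<in> X"
      and d: "\<forall>k<K. ((\<lambda>t. \<gamma> t k) has_field_derivative d k) (at 0)"
    have "(\<gamma> \<longlongrightarrow> z) (at 0)" using curve_tendsto[of \<gamma> d] g z d by simp
    then have "\<forall>\<^sub>F t in at 0. \<gamma> t \<in> N" using N z\<Omega> unfolding tendsto_def by blast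
    with g(2) have ev: "\<forall>\<^sub>F t in at 0. \<gamma> t \<in> \<Omega> \<and> ppt (\<gamma> t) \<in> V"
    proof eventually_elim
      case (elim t)
      then have "\<gamma> t \<in> X \<inter> \<Omega>" using X_cspace N(2) by blast
      then show ?case using \<Omega>(2) by blast
    qed
    then have "\<forall>\<^sub>F t in at 0. \<gamma> t \<in> \<Omega>" by eventually_elim simp
    then have "((\<lambda>t. \<psi> (ppt (\<gamma> t)) i) has_field_derivative (\<Sum>k<K. G i k * d k)) (at 0)"
      using G i g(1) d by blast
    moreover have "\<forall>\<^sub>F t in at 0. ppt (\<gamma> t) \<in> V" using ev by eventually_elim simp
    ultimately show "(\<forall>\<^sub>F t in at 0. ppt (\<gamma> t) \<in> V) \<and> ((\<lambda>t. \<psi> (ppt (\<gamma> t)) i) has_field_derivative (\<Sum>k<K. G i k * d k)) (at 0)"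
      by blast
  qed
  then show ?thesis by blast
qed

text \<open>Apply the hypothesis to the velocity of the curve in \<open>X\<close> whose image in the chart moves on a straight line
  in the direction \<open>cnj cf\<close>.\<close>

lemma gradient_regular:
  fixes cf :: "nat \<Rightarrow> complex"
  assumes V: "(V, \<psi>) \<in> atlas Mf" and z: "z \<in> X" "ppt z \<in> V" and G: "is_gradient V \<psi> z G"
    and c: "\<And>y. T z z y = 0 \<Longrightarrow> dot y = 0 \<Longrightarrow> (\<Sum>k<K. (\<Sum>i<n. cf i * G i k) * y k) = 0"
  shows "\<forall>i<n. cf i = 0"
proof -
  note D = is_chartD[OF Mf_chart[OF V]]
  define \<xi> where "\<xi> = (\<lambda>t i. \<psi> (ppt z) i + t * (if i < n then cnj (cf i) else 0))"
  have \<xi>0: "\<xi> 0 = \<psi> (ppt z)" by (simp add: \<xi>_def)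
  have pV: "\<psi> (ppt z) \<in> \<psi> ` V" using z by blast
  have pc: "\<psi> (ppt z) \<in> cspace n" using pV D(3) by blast
  obtain N where N: "open N" "\<psi> ` V = cspace n \<inter> N" using D(2) unfolding openin_open by blast
  have d\<xi>: "((\<lambda>t. \<xi> t i) has_field_derivative (if i < n then cnj (cf i) else 0)) (at 0)" for i
    unfolding \<xi>_def by (auto intro!: derivative_eq_intros)
  have "(\<xi> \<longlongrightarrow> \<xi> 0) (at 0)"
  proof (rule tendsto_funI)
    show "((\<lambda>t. \<xi> t i) \<longlongrightarrow> \<xi> 0 i) (at 0)" for i using DERIV_isCont[OF d\<xi>[of i]] by (simp add: isCont_def)
  qed
  then have "\<forall>\<^sub>F t in at 0. \<xi> t \<in> N" unfolding tendsto_def using N pV \<xi>0 by auto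
  then have ev\<xi>: "\<forall>\<^sub>F t in at 0. \<xi> t \<in> \<psi> ` V"
  proof eventually_elim
    case (elim t)
    have "\<xi> t \<in> cspace n" using pc by (auto simp: \<xi>_def cspace_def)
    then show ?case using elim N(2) by blast
  qed
  define \<gamma> where "\<gamma> = (\<lambda>t. rep (inv_into V \<psi> (\<xi> t)))"
  have inv: "inv_into V \<psi> \<zeta> \<in> V" if "\<zeta> \<in> \<psi> ` V" for \<zeta> using that by (rule inv_into_into)
  have \<gamma>0: "\<gamma> 0 = z" unfolding \<gamma>_def \<xi>0 using inv_into_f_f[OF D(4) z(2)] rep_ppt_X[OF z(1)] by simp
  have ev\<gamma>: "\<forall>\<^sub>F t in at 0. \<gamma> t \<in> X \<and> ppt (\<gamma> t) = inv_into V \<psi> (\<xi> t) \<and> \<psi> (ppt (\<gamma> t)) = \<xi> t"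
    using ev\<xi>
  proof eventually_elim
    case (elim t)
    have "inv_into V \<psi> (\<xi> t) \<in> Y" using inv[OF elim] Mf_chart_Y[OF V] by blast
    from rep_Y(1)[OF this] rep_Y(2)[OF this] show ?case unfolding \<gamma>_def using f_inv_into_f[OF elim] by simp
  qed
  have "\<forall>k. \<exists>y. k < K \<longrightarrow> ((\<lambda>t. \<gamma> t k) has_field_derivative y) (at 0)"
  proof (intro allI)
    fix k
    show "\<exists>y. k < K \<longrightarrow> ((\<lambda>t. \<gamma> t k) has_field_derivative y) (at 0)"
    proof (cases "k < K")
      case True
      obtain g where "\<And>\<gamma> d. \<gamma> (0::complex) = \<psi> (ppt z) \<Longrightarrow> \<forall>\<^sub>F t in at 0. \<gamma> t \<in> \<psi> ` V \<Longrightarrow>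
         \<forall>i<n. ((\<lambda>t. \<gamma> t i) has_field_derivative d i) (at 0) \<Longrightarrow>
         ((\<lambda>t. rep (inv_into V \<psi> (\<gamma> t)) k) has_field_derivative (\<Sum>i<n. g i * d i)) (at 0)"
        using hdiff_gradient[OF hdiff_rep_inv[OF V z(2) True] D(3) pV] by blast
      from this[of \<xi> "\<lambda>i. if i < n then cnj (cf i) else 0", OF \<xi>0 ev\<xi>] d\<xi> show ?thesis unfolding \<gamma>_def by blast
    qed simp
  qed
  then obtain y where y: "\<And>k. k < K \<Longrightarrow> ((\<lambda>t. \<gamma> t k) has_field_derivative y k) (at 0)" by metis
  have ev0: "\<forall>\<^sub>F t in at 0. \<gamma> t \<in> X" using ev\<gamma> by eventually_elim simp
  have \<gamma>t: "((\<lambda>t. \<gamma> t k) \<longlongrightarrow> z k) (at 0)" if "k < K" for k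
    using DERIV_isCont[OF y[OF that]] \<gamma>0 by (simp add: isCont_def)
  have quot: "((\<lambda>t. (\<gamma> t k - z k) / t) \<longlongrightarrow> y k) (at 0)" if "k < K" for k
    using y[OF that] unfolding has_field_derivative_iff \<gamma>0 by simp
  \<comment> \<open>The difference quotient of the curve. Telescoping the cubic over its three
    arguments turns \<open>T \<gamma> \<gamma> \<gamma> = 0\<close> into the tangency of
    \<open>y\<close> by taking limits.\<close>
  define q where "q = (\<lambda>t. cvec (1 / t) (\<gamma> t - z))"
  have q: "((\<lambda>t. q t k) \<longlongrightarrow> y k) (at 0)" if "k < K" for k
    using quot[OF that] by (simp add: q_def)
  have "((\<lambda>t. T (q t) (\<gamma> t) (\<gamma> t) + T z (q t) (\<gamma> t) + T z z (q t)) \<longlongrightarrow> T y z z + T z y z + T z z y) (at 0)"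
    by (intro tendsto_add tendsto_T q \<gamma>t tendsto_const)
  moreover have "\<forall>\<^sub>F t in at 0. T (q t) (\<gamma> t) (\<gamma> t) + T z (q t) (\<gamma> t) + T z z (q t) = 0"
    using ev0
  proof eventually_elim
    case (elim t)
    have "T (q t) (\<gamma> t) (\<gamma> t) + T z (q t) (\<gamma> t) + T z z (q t) = 1 / t * (T (\<gamma> t) (\<gamma> t) (\<gamma> t) - T z z z)"
      unfolding q_def T_lin T_diff by (simp add: algebra_simps)
    then show ?case using elim z by (simp add: X_def)
  qed
  ultimately have "((\<lambda>t. 0) \<longlongrightarrow> T y z z + T z y z + T z z y) (at (0::complex))"
    by (rule Lim_transform_eventually)
  from tendsto_unique[OF trivial_limit_at this tendsto_const] have "T y z z + T z y z + T z z y = 0" .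
  moreover have "T y z z = T z z y" "T z y z = T z z y" by (metis T_swap12 T_swap23)+
  ultimately have Ty: "T z z y = 0" by simp
  have "((\<lambda>t. dot (q t)) \<longlongrightarrow> dot y) (at 0)"
    unfolding dot_def by (intro tendsto_sum tendsto_mult tendsto_const q) simp
  moreover have "\<forall>\<^sub>F t in at 0. dot (q t) = 0"
    using ev0
  proof eventually_elim
    case (elim t)
    have "dot (\<gamma> t - z) = 0" using elim z linf_diff[OF dot_linf] by (simp add: X_def)
    then show ?case unfolding q_def dot_cvec by simp
  qed
  ultimately have "((\<lambda>t. 0) \<longlongrightarrow> dot y) (at (0::complex))" by (rule Lim_transform_eventually)
  from tendsto_unique[OF trivial_limit_at this tendsto_const] have doty: "dot y = 0" .
  have "(\<Sum>k<K. G i k * y k) = cnj (cf i)" if i: "i < n" for i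
  proof -
    have "((\<lambda>t. \<psi> (ppt (\<gamma> t)) i) has_field_derivative (\<Sum>k<K. G i k * y k)) (at 0)"
      using G i \<gamma>0 ev0 y unfolding is_gradient_def by blast
    moreover have "((\<lambda>t. \<psi> (ppt (\<gamma> t)) i) has_field_derivative cnj (cf i)) (at 0)"
    proof (subst DERIV_cong_ev[OF refl _ refl, where g = "\<lambda>t. \<xi> t i"])
      have "\<psi> (ppt (\<gamma> 0)) = \<xi> 0" unfolding \<gamma>0 \<xi>0 ..
      then show "\<forall>\<^sub>F t in nhds 0. \<psi> (ppt (\<gamma> t)) i = \<xi> t i"
        unfolding eventually_nhds_conv_at using ev\<gamma> by (auto elim!: eventually_mono)
    qed (use d\<xi>[of i] i in simp)
    ultimately show ?thesis by (rule DERIV_unique)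
  qed
  \<comment> \<open>The direction \<open>cnj (cf i)\<close> turns the hypothesis into the vanishing
    of a sum of squared moduli.\<close>
  then have "(\<Sum>i<n. cf i * cnj (cf i)) = (\<Sum>i<n. cf i * (\<Sum>k<K. G i k * y k))" by simp
  also have "\<dots> = (\<Sum>k<K. (\<Sum>i<n. cf i * G i k) * y k)"
    unfolding sum_distrib_left sum_distrib_right by (subst sum.swap) (simp add: mult.assoc)
  also have "\<dots> = 0" by (rule c[OF Ty doty])
  finally have "(\<Sum>i<n. cf i * cnj (cf i)) = 0" .
  then have "complex_of_real (\<Sum>i<n. (cmod (cf i))^2) = 0"
    unfolding of_real_sum by (simp only: complex_norm_square)
  then have "(\<Sum>i<n. (cmod (cf i))^2) = 0" by (simp only: of_real_eq_0_iff)
  then show ?thesis by (simp add: sum_nonneg_eq_0_iff)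
qed

text \<open>The chain rule for the curve \<open>\<tau> \<mapsto> \<sigma> z (\<tau> e)\<close>.
  Chart coordinates from \<open>n\<close> on are 0 near the base point, which is the second branch
  of the conditional.\<close>

lemma vertical_image_Mf:
  assumes V: "(V, \<psi>) \<in> atlas Mf" and z: "z \<in> X" "ppt z \<in> V" and G: "is_gradient V \<psi> z G"
    and s1: "\<And>x t. x \<in> X \<Longrightarrow> t \<in> cspace r \<Longrightarrow> \<sigma> x t \<in> X" and s3: "\<And>x. x \<in> X \<Longrightarrow> \<sigma> x (\<lambda>i. 0) = x"
    and s4: "\<And>e k. e \<in> cspace r \<Longrightarrow> k < K \<Longrightarrow> ((\<lambda>\<tau>. \<sigma> z (\<lambda>i. \<tau> * e i) k) has_field_derivative D e k) (at 0)"
  shows "vertical_image (trivial_bundle Mf r) (\<lambda>(p, t). ppt (\<sigma> (rep p) t)) \<psi> (ppt z)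
    = (\<lambda>e i. if i < n then \<Sum>k<K. G i k * D e k else 0) ` cspace r"
proof -
  have zY: "ppt z \<in> points Mf" unfolding points_Mf using z by blast
  note fib = fibre_trivial_bundle[OF zY, of r]
  have d: "deriv (\<lambda>\<tau>. \<psi> (ppt (\<sigma> (rep (ppt z)) (\<lambda>i. \<tau> * e i))) i) 0 = (if i < n then \<Sum>k<K. G i k * D e k else 0)"
    if e: "e \<in> cspace r" for e i
  proof -
    define \<gamma> where "\<gamma> = (\<lambda>\<tau>. \<sigma> z (\<lambda>i. \<tau> * e i))"
    have \<gamma>X: "\<gamma> \<tau> \<in> X" for \<tau> unfolding \<gamma>_def using e by (intro s1 z) (auto simp: cspace_def)
    have \<gamma>0: "\<gamma> 0 = z" unfolding \<gamma>_def using s3[OF z(1)] by simp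
    have \<gamma>d: "\<forall>k<K. ((\<lambda>t. \<gamma> t k) has_field_derivative D e k) (at 0)" unfolding \<gamma>_def using s4[OF e] by blast
    have main: "(\<forall>\<^sub>F t in at 0. ppt (\<gamma> t) \<in> V) \<and> ((\<lambda>t. \<psi> (ppt (\<gamma> t)) i) has_field_derivative (\<Sum>k<K. G i k * D e k)) (at 0)" if "i < n" for i
    proof -
      have "\<forall>\<^sub>F t in at 0. \<gamma> t \<in> X" using \<gamma>X by simp
      then show ?thesis using G[unfolded is_gradient_def] that \<gamma>0 \<gamma>d by blast
    qed
    have r: "rep (ppt z) = z" by (rule rep_ppt_X[OF z(1)])
    show ?thesis
      unfolding r \<gamma>_def[symmetric]
    proof (cases "i < n")
      case True
      from DERIV_imp_deriv[OF conjunct2[OF main[OF this]]] True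
      show "deriv (\<lambda>\<tau>. \<psi> (ppt (\<sigma> z (\<lambda>i. \<tau> * e i))) i) 0 = (if i < n then \<Sum>k<K. G i k * D e k else 0)"
        unfolding \<gamma>_def by simp
    next
      \<comment> \<open>That the curve stays in the chart is part of the gradient property at any
        index below \<open>n\<close>; index 0 is available since \<open>n \<ge> 3\<close>.\<close>
      case False
      have "\<forall>\<^sub>F t in at 0. ppt (\<gamma> t) \<in> V" using main[of 0] n3 by simp
      moreover have "ppt (\<gamma> 0) \<in> V" unfolding \<gamma>0 by (rule z(2))
      ultimately have "\<forall>\<^sub>F t in nhds 0. ppt (\<gamma> t) \<in> V" unfolding eventually_nhds_conv_at by blast
      then have "\<forall>\<^sub>F t in nhds 0. \<psi> (ppt (\<gamma> t)) i = 0"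
      proof eventually_elim
        case (elim t)
        then have "\<psi> (ppt (\<gamma> t)) \<in> cspace n" using is_chartD(3)[OF Mf_chart[OF V]] by blast
        then show ?case using False by (simp add: cspace_def)
      qed
      then have "((\<lambda>t. \<psi> (ppt (\<gamma> t)) i) has_field_derivative 0) (at 0)"
        by (subst DERIV_cong_ev[OF refl _ refl, where g = "\<lambda>_. 0"]) auto
      from DERIV_imp_deriv[OF this] False
      show "deriv (\<lambda>\<tau>. \<psi> (ppt (\<sigma> z (\<lambda>i. \<tau> * e i))) i) 0 = (if i < n then \<Sum>k<K. G i k * D e k else 0)"
        unfolding \<gamma>_def by simp
    qed
  qed
  have "vertical_image (trivial_bundle Mf r) (\<lambda>(p, t). ppt (\<sigma> (rep p) t)) \<psi> (ppt z)
    = (\<lambda>e i. deriv (\<lambda>\<tau>. \<psi> (ppt (\<sigma> (rep (ppt z)) (\<lambda>i. \<tau> * e i))) i) 0) ` cspace r"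
    unfolding vertical_image_def fib by (auto simp: trivial_bundle_def image_iff)
  also have "\<dots> = (\<lambda>e i. if i < n then \<Sum>k<K. G i k * D e k else 0) ` cspace r"
    by (intro image_cong refl ext d)
  finally show ?thesis .
qed

section \<open>Conic sprays: holomorphy, velocity and iteration\<close>

lemma field_differentiable_isCont: "f field_differentiable (at (w::complex)) \<Longrightarrow> isCont f w"
  using field_differentiable_imp_continuous_at by blast

lemma hdiff_conic_spray:
  assumes x: "\<And>i. i < K \<Longrightarrow> hdiff k U (\<lambda>w. x w i) p" and t: "hdiff k U t p" and j: "j < K"
  shows "hdiff k U (\<lambda>w. conic_spray u v (x w) (t w) j) p"
proof -
  have xT: "hdiff k U (\<lambda>w. T (x w) (x w) (x w)) p" "hdiff k U (\<lambda>w. T b (x w) (x w)) p" "hdiff k U (\<lambda>w. T b d (x w)) p" for b d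
    by (intro hdiff_T x hdiff_const; assumption)+
  have xd: "hdiff k U (\<lambda>w. dot (x w)) p" by (rule hdiff_dot[OF x])
  note rules = hdiff_add hdiff_diff hdiff_uminus hdiff_mult hdiff_power hdiff_const xT xd
  have m: "hdiff k U (\<lambda>w. fm0 u v (x w)) p" "hdiff k U (\<lambda>w. fm1 u v (x w)) p" "hdiff k U (\<lambda>w. fm2 u v (x w)) p"
    unfolding fm0_def fm1_def fm2_def by (intro rules)+
  have h: "hdiff k U (\<lambda>w. fh0 u v (x w)) p" "hdiff k U (\<lambda>w. fh1 u v (x w)) p" "hdiff k U (\<lambda>w. fh2 u v (x w)) p"
    unfolding fh0_def fh1_def fh2_def by (intro rules m)+
  have kk: "hdiff k U (\<lambda>w. fk0 u v (x w)) p" "hdiff k U (\<lambda>w. fk1 u v (x w)) p" "hdiff k U (\<lambda>w. fk2 u v (x w)) p"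
    unfolding fk0_def fk1_def fk2_def by (intro rules h)+
  have "hdiff k U (\<lambda>w. f\<delta> u v (x w)) p" unfolding f\<delta>_def by (intro rules)
  then have dt: "hdiff k U (\<lambda>w. f\<delta> u v (x w) * (t w)^2) p" by (intro hdiff_mult hdiff_power t)
  have s: "hdiff k U (\<lambda>w. fs u v (x w) (t w)) p" "hdiff k U (\<lambda>w. f\<kappa> u v (x w) (t w)) p"
    unfolding fs_def f\<kappa>_def
    by (intro hdiff_mult t hdiff_power hdiff_comp1[OF dt sinhc_differentiable] hdiff_comp1[OF dt coshc_differentiable])+
  show ?thesis unfolding conic_spray_def by (intro hdiff_add hdiff_mult hdiff_const x j s m kk)
qed

text \<open>The base point moves together with the time, as iteration requires. After division by
  \<open>\<tau>\<close> the coefficient of \<open>M\<close> tends to \<open>e\<close> because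
  \<open>sinhc 0 = 1\<close>, and that of \<open>M^2\<close> tends to 0; for the rest continuity
  suffices.\<close>

lemma conic_spray_DERIV:
  assumes \<gamma>0: "\<gamma> 0 = x" and d: "\<And>k. k < K \<Longrightarrow> ((\<lambda>\<tau>. \<gamma> \<tau> k) has_field_derivative d k) (at (0::complex))" and j: "j < K"
  shows "((\<lambda>\<tau>. conic_spray u v (\<gamma> \<tau>) (\<tau> * e) j) has_field_derivative d j + e * velocity u v x j) (at 0)"
proof -
  have \<gamma>t: "((\<lambda>\<tau>. \<gamma> \<tau> k) \<longlongrightarrow> x k) (at 0)" if "k < K" for k
    using DERIV_isCont[OF d[OF that]] \<gamma>0 by (simp add: isCont_def)
  have quot: "((\<lambda>\<tau>. (\<gamma> \<tau> j - x j) / \<tau>) \<longlongrightarrow> d j) (at 0)"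
    using d[OF j] unfolding has_field_derivative_iff \<gamma>0 by simp
  have Tt: "((\<lambda>\<tau>. T (\<gamma> \<tau>) (\<gamma> \<tau>) (\<gamma> \<tau>)) \<longlongrightarrow> T x x x) (at 0)" "((\<lambda>\<tau>. T b (\<gamma> \<tau>) (\<gamma> \<tau>)) \<longlongrightarrow> T b x x) (at 0)"
    "((\<lambda>\<tau>. T b b' (\<gamma> \<tau>)) \<longlongrightarrow> T b b' x) (at 0)" for b b'
    by (intro tendsto_T \<gamma>t tendsto_const; assumption)+
  have dt: "((\<lambda>\<tau>. dot (\<gamma> \<tau>)) \<longlongrightarrow> dot x) (at 0)"
    unfolding dot_def by (intro tendsto_sum tendsto_mult tendsto_const \<gamma>t) simp
  have m: "((\<lambda>\<tau>. fm0 u v (\<gamma> \<tau>)) \<longlongrightarrow> fm0 u v x) (at 0)" "((\<lambda>\<tau>. fm1 u v (\<gamma> \<tau>)) \<longlongrightarrow> fm1 u v x) (at 0)" "((\<lambda>\<tau>. fm2 u v (\<gamma> \<tau>)) \<longlongrightarrow> fm2 u v x) (at 0)"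
    unfolding fm0_def fm1_def fm2_def by (intro tendsto_intros Tt dt)+
  have h: "((\<lambda>\<tau>. fh0 u v (\<gamma> \<tau>)) \<longlongrightarrow> fh0 u v x) (at 0)" "((\<lambda>\<tau>. fh1 u v (\<gamma> \<tau>)) \<longlongrightarrow> fh1 u v x) (at 0)" "((\<lambda>\<tau>. fh2 u v (\<gamma> \<tau>)) \<longlongrightarrow> fh2 u v x) (at 0)"
    unfolding fh0_def fh1_def fh2_def by (intro tendsto_intros Tt m)+
  have k: "((\<lambda>\<tau>. fk0 u v (\<gamma> \<tau>)) \<longlongrightarrow> fk0 u v x) (at 0)" "((\<lambda>\<tau>. fk1 u v (\<gamma> \<tau>)) \<longlongrightarrow> fk1 u v x) (at 0)" "((\<lambda>\<tau>. fk2 u v (\<gamma> \<tau>)) \<longlongrightarrow> fk2 u v x) (at 0)"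
    unfolding fk0_def fk1_def fk2_def by (intro tendsto_intros h dt)+
  have "((\<lambda>\<tau>. f\<delta> u v (\<gamma> \<tau>)) \<longlongrightarrow> f\<delta> u v x) (at 0)"
    unfolding f\<delta>_def by (intro tendsto_intros Tt dt)
  then have "((\<lambda>\<tau>. f\<delta> u v (\<gamma> \<tau>) * (\<tau> * e)^2) \<longlongrightarrow> f\<delta> u v x * (0 * e)^2) (at 0)"
    by (intro tendsto_intros)
  then have w: "((\<lambda>\<tau>. f\<delta> u v (\<gamma> \<tau>) * (\<tau> * e)^2) \<longlongrightarrow> 0) (at 0)" by simp
  have sc: "((\<lambda>\<tau>. sinhc (f\<delta> u v (\<gamma> \<tau>) * (\<tau> * e)^2)) \<longlongrightarrow> sinhc 0) (at 0)" "((\<lambda>\<tau>. coshc (f\<delta> u v (\<gamma> \<tau>) * (\<tau> * e)^2)) \<longlongrightarrow> coshc 0) (at 0)"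
    by (intro isCont_tendsto_compose[OF _ w] field_differentiable_isCont sinhc_differentiable coshc_differentiable)+
  define A where "A = (\<lambda>y. fm0 u v y * y j + fm1 u v y * u j + fm2 u v y * v j)"
  define B where "B = (\<lambda>y. fk0 u v y * y j + fk1 u v y * u j + fk2 u v y * v j)"
  have At: "((\<lambda>\<tau>. A (\<gamma> \<tau>)) \<longlongrightarrow> A x) (at 0)" unfolding A_def by (intro tendsto_intros m \<gamma>t j)
  have Bt: "((\<lambda>\<tau>. B (\<gamma> \<tau>)) \<longlongrightarrow> B x) (at 0)" unfolding B_def by (intro tendsto_intros k \<gamma>t j)
  have "((\<lambda>\<tau>. (\<gamma> \<tau> j - x j) / \<tau> + e * sinhc (f\<delta> u v (\<gamma> \<tau>) * (\<tau> * e)^2) * A (\<gamma> \<tau>)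
      + \<tau> * e^2 * coshc (f\<delta> u v (\<gamma> \<tau>) * (\<tau> * e)^2) * B (\<gamma> \<tau>)) \<longlongrightarrow>
      d j + e * sinhc 0 * A x + 0 * e^2 * coshc 0 * B x) (at 0)"
    by (intro tendsto_add tendsto_mult quot tendsto_const tendsto_ident_at sc At Bt)
  moreover have "\<forall>\<^sub>F \<tau> in at 0. (\<gamma> \<tau> j - x j) / \<tau> + e * sinhc (f\<delta> u v (\<gamma> \<tau>) * (\<tau> * e)^2) * A (\<gamma> \<tau>)
      + \<tau> * e^2 * coshc (f\<delta> u v (\<gamma> \<tau>) * (\<tau> * e)^2) * B (\<gamma> \<tau>)
      = (conic_spray u v (\<gamma> \<tau>) (\<tau> * e) j - conic_spray u v (\<gamma> 0) (0 * e) j) / (\<tau> - 0)"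
    unfolding eventually_at_topological
  proof (intro exI[of _ UNIV] conjI ballI impI)
    fix \<tau> :: complex assume "\<tau> \<noteq> 0"
    moreover have "conic_spray u v (\<gamma> 0) (0 * e) = x" by (simp add: \<gamma>0 conic_spray_0)
    moreover have "conic_spray u v (\<gamma> \<tau>) (\<tau> * e) j = \<gamma> \<tau> j + \<tau> * e * sinhc (f\<delta> u v (\<gamma> \<tau>) * (\<tau> * e)^2) * A (\<gamma> \<tau>)
       + (\<tau> * e)^2 * coshc (f\<delta> u v (\<gamma> \<tau>) * (\<tau> * e)^2) * B (\<gamma> \<tau>)"
      unfolding conic_spray_def fs_def f\<kappa>_def A_def B_def by (simp add: algebra_simps)
    ultimately show "(\<gamma> \<tau> j - x j) / \<tau> + e * sinhc (f\<delta> u v (\<gamma> \<tau>) * (\<tau> * e)^2) * A (\<gamma> \<tau>)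
      + \<tau> * e^2 * coshc (f\<delta> u v (\<gamma> \<tau>) * (\<tau> * e)^2) * B (\<gamma> \<tau>)
      = (conic_spray u v (\<gamma> \<tau>) (\<tau> * e) j - conic_spray u v (\<gamma> 0) (0 * e) j) / (\<tau> - 0)"
      by (simp add: add_divide_distrib diff_divide_distrib power2_eq_square)
  qed auto
  ultimately have "((\<lambda>\<tau>. conic_spray u v (\<gamma> \<tau>) (\<tau> * e) j) has_field_derivative
      d j + e * sinhc 0 * A x + 0 * e^2 * coshc 0 * B x) (at 0)"
    unfolding has_field_derivative_iff by (rule Lim_transform_eventually)
  then show ?thesis by (simp add: A_def velocity_def)
qed

text \<open>At the zero section the differential of the iterated spray is the sum of the differentials of its
  constituents, so it is a single dominating spray.\<close>

primrec iterated_spray :: "((nat \<Rightarrow> complex) \<times> (nat \<Rightarrow> complex)) list \<Rightarrow> nat \<Rightarrow> (nat \<Rightarrow> complex) \<Rightarrow> (nat \<Rightarrow> complex) \<Rightarrow> nat \<Rightarrow> complex" where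
  "iterated_spray ls 0 x t = x"
| "iterated_spray ls (Suc j) x t = conic_spray (fst (ls ! j)) (snd (ls ! j)) (iterated_spray ls j x t) (t j)"

lemma iterated_spray_X:
  assumes "\<And>u v. (u, v) \<in> set ls \<Longrightarrow> line u v \<and> u \<in> cspace K \<and> v \<in> cspace K" "m \<le> length ls" "x \<in> X"
  shows "iterated_spray ls m x t \<in> X"
  using assms(2)
proof (induction m)
  case (Suc m)
  have "(fst (ls ! m), snd (ls ! m)) \<in> set ls" using Suc.prems by simp
  then have "line (fst (ls ! m)) (snd (ls ! m))" "fst (ls ! m) \<in> cspace K" "snd (ls ! m) \<in> cspace K"
    using assms(1) by blast+
  then show ?case unfolding iterated_spray.simps using Suc by (intro conic_spray_X) auto
qed (simp add: assms)

lemma iterated_spray_0: "iterated_spray ls m x (\<lambda>i. 0) = x"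
  by (induction m) (simp_all add: conic_spray_0)

lemma hdiff_iterated_spray:
  assumes "m \<le> r" "j < K"
  shows "hdiff (K + r) (cspace (K + r)) (\<lambda>\<zeta>. iterated_spray ls m (ctake K \<zeta>) (cdrop K \<zeta>) j) \<zeta>"
  using assms
proof (induction m arbitrary: j)
  case 0
  then show ?case using hdiff_coord[of j "K + r"] by (simp add: ctake_def)
next
  case (Suc m)
  have "hdiff (K + r) (cspace (K + r)) (\<lambda>\<zeta>. cdrop K \<zeta> m) \<zeta>"
    unfolding cdrop_def using Suc.prems by (intro hdiff_coord) simp
  then show ?case unfolding iterated_spray.simps using Suc by (intro hdiff_conic_spray) auto
qed

lemma iterated_spray_DERIV:
  assumes "j < K"
  shows "((\<lambda>\<tau>. iterated_spray ls m x (\<lambda>i. \<tau> * e i) j) has_field_derivative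
     (\<Sum>i<m. e i * velocity (fst (ls ! i)) (snd (ls ! i)) x j)) (at 0)"
  using assms
proof (induction m arbitrary: j)
  case (Suc m)
  have "iterated_spray ls m x (\<lambda>i. 0 * e i) = x" using iterated_spray_0[of ls m x] by simp
  from conic_spray_DERIV[where \<gamma> = "\<lambda>\<tau>. iterated_spray ls m x (\<lambda>i. \<tau> * e i)", OF this Suc.IH Suc.prems]
  show ?case by simp
qed simp

text \<open>A covector killing the chart images of all velocities pulls back by \<open>G\<close> to
  one that kills the velocities. By \<open>dom\<close> it kills the tangent space, and by
  \<open>gradient_regular\<close> it is 0.\<close>

lemma span_velocities:
  assumes dom: "\<And>w. (\<And>u v. (u, v) \<in> set ls \<Longrightarrow> (\<Sum>i<K. w i * velocity u v z i) = 0) \<Longrightarrow>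
       (\<And>y. T z z y = 0 \<Longrightarrow> dot y = 0 \<Longrightarrow> (\<Sum>i<K. w i * y i) = 0)"
    and V: "(V, \<psi>) \<in> atlas Mf" and z: "z \<in> X" "ppt z \<in> V" and G: "is_gradient V \<psi> z G"
  shows "\<exists>e. \<forall>i<n. (\<Sum>j<length ls. e j * (\<Sum>k<K. G i k * velocity (fst (ls ! j)) (snd (ls ! j)) z k)) = y i"
proof -
  have "\<exists>e. \<forall>i\<in>{..<n}. (\<Sum>j<length ls. e j * (\<Sum>k<K. G i k * velocity (fst (ls ! j)) (snd (ls ! j)) z k)) = y i"
  proof (rule span_if_no_annihilator)
    fix c assume c: "\<And>j. j \<in> {..<length ls} \<Longrightarrow> (\<Sum>i<n. c i * (\<Sum>k<K. G i k * velocity (fst (ls ! j)) (snd (ls ! j)) z k)) = 0"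
    have "\<forall>i<n. c i = 0"
    proof (rule gradient_regular[OF V z G])
      fix y assume y: "T z z y = 0" "dot y = 0"
      show "(\<Sum>k<K. (\<Sum>i<n. c i * G i k) * y k) = 0"
      proof (rule dom[OF _ y])
        fix u v assume "(u, v) \<in> set ls"
        then obtain j where j: "j < length ls" "ls ! j = (u, v)" by (metis in_set_conv_nth)
        have "(\<Sum>k<K. (\<Sum>i<n. c i * G i k) * velocity u v z k) = (\<Sum>i<n. c i * (\<Sum>k<K. G i k * velocity u v z k))"
          unfolding sum_distrib_left sum_distrib_right by (subst sum.swap) (simp add: mult.assoc)
        then show "(\<Sum>k<K. (\<Sum>i<n. c i * G i k) * velocity u v z k) = 0" using c[of j] j by simp
      qed
    qed
    then show "\<forall>i\<in>{..<n}. c i = 0" by simp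
  qed simp_all
  then obtain e where e: "\<forall>i\<in>{..<n}. (\<Sum>j<length ls. e j * (\<Sum>k<K. G i k * velocity (fst (ls ! j)) (snd (ls ! j)) z k)) = y i"
    by (rule exE)
  show ?thesis
  proof (intro exI[of _ e] allI impI)
    fix i assume "i < n"
    then have "i \<in> {..<n}" by simp
    then show "(\<Sum>j<length ls. e j * (\<Sum>k<K. G i k * velocity (fst (ls ! j)) (snd (ls ! j)) z k)) = y i"
      by (rule bspec[OF e])
  qed
qed

lemma dominating_Mf:
  "(\<exists>(N :: nat) s. dominating_spray_family Mf {..<N} (\<lambda>_. trivial_line_bundle Mf) s) \<and> holomorphically_elliptic Mf"
proof -
  obtain Q where Q: "finite Q" "\<forall>(u, v)\<in>Q. line u v \<and> u \<in> cspace K \<and> v \<in> cspace K"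
    "\<forall>x\<in>X. \<forall>w. (\<forall>(u, v)\<in>Q. (\<Sum>i<K. w i * velocity u v x i) = 0) \<longrightarrow>
       (\<forall>y. T x x y = 0 \<longrightarrow> dot y = 0 \<longrightarrow> (\<Sum>i<K. w i * y i) = 0)"
    using finite_dominating_lines by blast
  obtain ls where ls: "set ls = Q" using finite_list[OF Q(1)] by blast
  define N where "N = length ls"
  have lines: "line u v \<and> u \<in> cspace K \<and> v \<in> cspace K" if "(u, v) \<in> set ls" for u v
    using Q(2) that ls by blast
  have dom: "(\<Sum>i<K. w i * y i) = 0"
    if "x \<in> X" "\<And>u v. (u, v) \<in> set ls \<Longrightarrow> (\<Sum>i<K. w i * velocity u v x i) = 0" "T x x y = 0" "dot y = 0" for x w y
    using Q(3) that ls by blast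
  define vel where "vel = (\<lambda>j z. velocity (fst (ls ! j)) (snd (ls ! j)) z)"
  have span: "\<exists>e. \<forall>i<n. (\<Sum>j<N. e j * (\<Sum>k<K. G i k * vel j z k)) = y i"
    if "(V, \<psi>) \<in> atlas Mf" "z \<in> X" "ppt z \<in> V" "is_gradient V \<psi> z G" for V \<psi> z G y
    unfolding N_def vel_def by (rule span_velocities[OF dom[OF that(2)] that])
  \<comment> \<open>The fibre of the trivial line bundle is \<open>cspace 1\<close>, whose only
    coordinate has index 0.\<close>
  define s1 where "s1 = (\<lambda>j x (t :: nat \<Rightarrow> complex). conic_spray (fst (ls ! j)) (snd (ls ! j)) x (t 0))"
  have s1X: "s1 j x t \<in> X" if "j < N" "x \<in> X" for j x t
    using lines[of "fst (ls ! j)" "snd (ls ! j)"] that unfolding s1_def N_def by (intro conic_spray_X) auto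
  have s10: "s1 j x (\<lambda>i. 0) = x" for j x by (simp add: s1_def conic_spray_0)
  have s1h: "hdiff (K + 1) (cspace (K + 1)) (\<lambda>\<zeta>. s1 j (ctake K \<zeta>) (cdrop K \<zeta>) i) \<zeta>" if "i < K" for i j \<zeta>
    unfolding s1_def
  proof (rule hdiff_conic_spray[OF _ _ that])
    show "hdiff (K + 1) (cspace (K + 1)) (\<lambda>w. ctake K w i) \<zeta>" if "i < K" for i
      using that hdiff_coord[of i "K + 1"] by (simp add: ctake_def)
    show "hdiff (K + 1) (cspace (K + 1)) (\<lambda>w. cdrop K w 0) \<zeta>"
      unfolding cdrop_def by (rule hdiff_coord) simp
  qed
  have s1d: "((\<lambda>\<tau>. s1 j x (\<lambda>i. \<tau> * e i) k) has_field_derivative e 0 * vel j x k) (at 0)" if "k < K" for j x e k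
  proof -
    have "((\<lambda>\<tau>. conic_spray (fst (ls ! j)) (snd (ls ! j)) x (\<tau> * e 0) k) has_field_derivative 0 + e 0 * velocity (fst (ls ! j)) (snd (ls ! j)) x k) (at 0)"
      by (rule conic_spray_DERIV[where \<gamma> = "\<lambda>_. x" and d = "\<lambda>_. 0", OF refl _ that]) simp
    then show ?thesis by (simp add: s1_def vel_def)
  qed
  have "dominating_spray_family Mf {..<N} (\<lambda>_. trivial_line_bundle Mf) (\<lambda>j (p, t). ppt (s1 j (rep p) t))"
    unfolding dominating_spray_family_def
  proof (intro conjI ballI complex_manifold_Mf)
    show "holomorphic_spray Mf (trivial_line_bundle Mf) (\<lambda>(p, t). ppt (s1 j (rep p) t))" if "j \<in> {..<N}" for j
      using that by (intro holomorphic_spray_Mf s1X s10 s1h) auto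
    fix p c assume p: "p \<in> points Mf" and c: "c \<in> atlas Mf"
    obtain V \<psi> where V: "c = (V, \<psi>)" by fastforce
    show "case c of (V, \<psi>) \<Rightarrow> p \<in> V \<longrightarrow>
        {\<lambda>i. \<Sum>j<N. w j i |w. \<forall>j\<in>{..<N}. w j \<in> vertical_image (trivial_line_bundle Mf) (\<lambda>(p, t). ppt (s1 j (rep p) t)) \<psi> p} = cspace (cdim Mf)"
      unfolding V prod.case Mf_simps(2)
    proof
      assume pV: "p \<in> V"
      obtain z where z: "z \<in> X" "p = ppt z" using p unfolding points_Mf by blast
      note V' = c[unfolded V] and zV = pV[unfolded z(2)]
      obtain G where G: "is_gradient V \<psi> z G" using exists_gradient[OF V' z(1) zV] by blast
      let ?W = "\<lambda>j. vertical_image (trivial_line_bundle Mf) (\<lambda>(p, t). ppt (s1 j (rep p) t)) \<psi> p"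
      have vi: "?W j
          = (\<lambda>e i. if i < n then \<Sum>k<K. G i k * (e 0 * vel j z k) else 0) ` cspace 1" if "j < N" for j
        unfolding z(2) using that by (intro vertical_image_Mf[OF V' z(1) zV G] s1X s10 s1d)
      show "{\<lambda>i. \<Sum>j<N. w j i |w. \<forall>j\<in>{..<N}. w j \<in> ?W j} = cspace n" (is "?L = _")
      proof (intro equalityI subsetI)
        fix y assume "y \<in> ?L"
        then obtain w where w: "y = (\<lambda>i. \<Sum>j<N. w j i)" "\<And>j. j < N \<Longrightarrow> w j \<in> ?W j"
          by blast
        have "w j i = 0" if "j < N" "i \<ge> n" for i j
          using w(2)[OF that(1)] that(2) unfolding vi[OF that(1)] by auto
        then show "y \<in> cspace n" unfolding w(1) cspace_def by simp
      next
        fix y assume y: "y \<in> cspace n"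
        obtain e where e: "\<And>i. i < n \<Longrightarrow> (\<Sum>j<N. e j * (\<Sum>k<K. G i k * vel j z k)) = y i"
          using span[OF V' z(1) zV G, of y] by blast
        define w where "w = (\<lambda>j i. if i < n then \<Sum>k<K. G i k * (e j * vel j z k) else 0)"
        have "w j \<in> ?W j" if "j < N" for j
          unfolding vi[OF that] w_def by (rule image_eqI[of _ _ "\<lambda>i. if i = 0 then e j else 0"]) (auto simp: cspace_def)
        moreover have "y = (\<lambda>i. \<Sum>j<N. w j i)"
        proof
          fix i
          show "y i = (\<Sum>j<N. w j i)"
          proof (cases "i < n")
            case True
            then show ?thesis using e[OF True] by (simp add: w_def sum_distrib_left mult_ac)
          next
            case False
            then show ?thesis using y by (simp add: w_def cspace_def)
          qed
        qed
        ultimately show "y \<in> ?L"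
          by blast
      qed
    qed
  qed simp
  \<comment> \<open>For ellipticity: the fibre coordinates of the bundle of rank \<open>N\<close>
    are the times of the successive sprays, and the same spanning statement applies.\<close>
  moreover have "dominating_spray Mf (trivial_bundle Mf N) (\<lambda>(p, t). ppt (iterated_spray ls N (rep p) t))"
    unfolding dominating_spray_def dominating_spray_family_def
  proof (intro conjI ballI complex_manifold_Mf)
    have iX: "iterated_spray ls N x t \<in> X" if "x \<in> X" for x t
      using lines that unfolding N_def by (intro iterated_spray_X) auto
    show "holomorphic_spray Mf (trivial_bundle Mf N) (\<lambda>(p, t). ppt (iterated_spray ls N (rep p) t))"
      by (intro holomorphic_spray_Mf iX hdiff_iterated_spray iterated_spray_0) auto
    fix p c assume p: "p \<in> points Mf" and c: "c \<in> atlas Mf"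
    obtain V \<psi> where V: "c = (V, \<psi>)" by fastforce
    show "case c of (V, \<psi>) \<Rightarrow> p \<in> V \<longrightarrow>
        {\<lambda>i. \<Sum>j\<in>{()}. w j i |w. \<forall>j\<in>{()}. w j \<in> vertical_image (trivial_bundle Mf N) (\<lambda>(p, t). ppt (iterated_spray ls N (rep p) t)) \<psi> p} = cspace (cdim Mf)"
      unfolding V prod.case Mf_simps(2)
    proof
      assume pV: "p \<in> V"
      obtain z where z: "z \<in> X" "p = ppt z" using p unfolding points_Mf by blast
      note V' = c[unfolded V] and zV = pV[unfolded z(2)]
      obtain G where G: "is_gradient V \<psi> z G" using exists_gradient[OF V' z(1) zV] by blast
      define VI where "VI = vertical_image (trivial_bundle Mf N) (\<lambda>(p, t). ppt (iterated_spray ls N (rep p) t)) \<psi> p"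
      have vi: "VI = (\<lambda>e i. if i < n then \<Sum>k<K. G i k * (\<Sum>j<N. e j * vel j z k) else 0) ` cspace N"
        unfolding VI_def z(2) vel_def
        by (intro vertical_image_Mf[OF V' z(1) zV G] iX iterated_spray_0 iterated_spray_DERIV)
      have "VI = cspace n"
      proof (intro equalityI subsetI)
        fix y assume "y \<in> VI"
        then show "y \<in> cspace n" unfolding vi cspace_def by auto
      next
        fix y assume y: "y \<in> cspace n"
        obtain e where e: "\<And>i. i < n \<Longrightarrow> (\<Sum>j<N. e j * (\<Sum>k<K. G i k * vel j z k)) = y i"
          using span[OF V' z(1) zV G, of y] by blast
        \<comment> \<open>Truncated so as to lie in the fibre \<open>cspace N\<close>.\<close>
        define e' where "e' = (\<lambda>j. if j < N then e j else 0)"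
        have "y i = (if i < n then \<Sum>k<K. G i k * (\<Sum>j<N. e' j * vel j z k) else 0)" for i
        proof (cases "i < n")
          case True
          have "(\<Sum>k<K. G i k * (\<Sum>j<N. e' j * vel j z k)) = (\<Sum>j<N. e j * (\<Sum>k<K. G i k * vel j z k))"
            unfolding sum_distrib_left by (subst sum.swap) (simp add: e'_def mult_ac)
          then show ?thesis using e[OF True] True by simp
        next
          case False
          then show ?thesis using y by (simp add: cspace_def)
        qed
        then have "y = (\<lambda>i. if i < n then \<Sum>k<K. G i k * (\<Sum>j<N. e' j * vel j z k) else 0)" ..
        moreover have "e' \<in> cspace N" by (simp add: e'_def cspace_def)
        ultimately show "y \<in> VI" unfolding vi by (rule image_eqI)
      qed
      moreover have "{\<lambda>i. \<Sum>j\<in>{()}. w j i |w. \<forall>j\<in>{()}. w j \<in> VI} = VI" for VI :: "(nat \<Rightarrow> complex) set"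
      proof (intro equalityI subsetI)
        fix y assume "y \<in> VI"
        then show "y \<in> {\<lambda>i. \<Sum>j\<in>{()}. w j i |w. \<forall>j\<in>{()}. w j \<in> VI}"
          by (intro CollectI exI[of _ "\<lambda>_. y"]) simp
      qed auto
      ultimately show "{\<lambda>i. \<Sum>j\<in>{()}. w j i |w. \<forall>j\<in>{()}. w j \<in> vertical_image (trivial_bundle Mf N) (\<lambda>(p, t). ppt (iterated_spray ls N (rep p) t)) \<psi> p} = cspace n"
        unfolding VI_def by simp
    qed
  qed simp
  ultimately show ?thesis unfolding holomorphically_elliptic_def by blast
qed

end

theorem theorem1p5:
  fixes n :: nat and S H\<^sub>0 B :: "ppoint set" and M :: "ppoint cmanifold"
  assumes "n \<ge> 3"
    and "smooth_hypersurface (n + 1) 3 S"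
    and "hyperplane (n + 1) H\<^sub>0"
    and "B = S \<inter> H\<^sub>0"
    and "M = submanifold (proj_space (n + 1)) n (S - B)"
  shows "(\<exists>(N :: nat) s. dominating_spray_family M {..<N} (\<lambda>_. trivial_line_bundle M) s)
    \<and> holomorphically_elliptic M"
proof -
  have K: "n + 1 + 1 = n + 2" by simp
  obtain c where S: "S = ppt ` {z \<in> punctured_cspace (n + 2). form (n + 2) 3 c z = 0}"
    and jac: "\<forall>z\<in>punctured_cspace (n + 2). form (n + 2) 3 c z = 0 \<longrightarrow> (\<exists>i\<le>n + 1. partial_deriv i (form (n + 2) 3 c) z \<noteq> 0)"
    using assms(2) unfolding smooth_hypersurface_def K by blast
  obtain a where a: "a \<in> punctured_cspace (n + 2)"
    and H: "H\<^sub>0 = ppt ` {z \<in> punctured_cspace (n + 2). (\<Sum>i\<le>n + 1. a i * z i) = 0}"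
    using assms(3) unfolding hyperplane_def K by blast
  have le: "i \<le> n + 1 \<longleftrightarrow> i < n + 2" for i by linarith
  interpret affine_cubic n c a
    using assms(1) a jac unfolding le by unfold_locales blast+
  have set: "{..n + 1} = {..<n + 2}" using le by auto
  \<comment> \<open>Points off the hyperplane are those that can be normalized by
    \<open>dot = 1\<close>.\<close>
  have "S - B = Y"
  proof (intro equalityI subsetI)
    fix p assume p: "p \<in> S - B"
    then obtain z where z: "z \<in> punctured_cspace K" "T z z z = 0" "p = ppt z"
      unfolding S polar_form[symmetric] by blast
    have "dot z \<noteq> 0"
    proof
      assume "dot z = 0"
      then have "p \<in> H\<^sub>0" using z unfolding H set dot_def by blast
      then show False using p assms(4) by blast
    qed
    \<comment> \<open>Rescaling multiplies the cubic by a nonzero cube, so its vanishing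
      persists.\<close>
    define w where "w = cvec (1 / dot z) z"
    have "w \<in> X" using z(1,2) \<open>dot z \<noteq> 0\<close> unfolding X_def w_def
      by (auto simp: T_lin dot_cvec cspace_def punctured_cspace_def)
    moreover have "p = ppt w" using z(3) ppt_scale[of "1 / dot z" z] \<open>dot z \<noteq> 0\<close> by (simp add: w_def cvec_def)
    ultimately show "p \<in> Y" by blast
  next
    fix p assume "p \<in> Y"
    then obtain z where z: "z \<in> X" "p = ppt z" by blast
    have "p \<in> S" using z X_punctured unfolding S polar_form[symmetric] by (auto simp: X_def)
    moreover have "p \<notin> H\<^sub>0"
    proof
      assume "p \<in> H\<^sub>0"
      then obtain w where w: "dot w = 0" "ppt w = ppt z" unfolding H set dot_def z(2) by force
      then obtain t where "z = (\<lambda>i. t * w i)" using ppt_eqE by blast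
      then have "dot z = 0" using w(1) dot_scale by simp
      then show False using z(1) by (simp add: X_def)
    qed
    ultimately show "p \<in> S - B" using assms(4) by blast
  qed
  then show ?thesis using dominating_Mf assms(5) by simp
qed

end
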